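(* Let $(E,\nabla)$ be an object of $\mathbf{MC}^{\mathrm o}(R((x))/R)$ which admits a TLJ-form over $R((x))$. Let $\nabla=\nabla^{\mathrm{rs}}+P_\nabla$ be its logarithmic decomposition over $R((x))$, and let $(\dot E,\dot\nabla)=\varprojlim_\ell(E|_\ell,\nabla|_\ell^{\mathrm{rs}})\in\mathbf{MC}_{\mathrm{rs}}(R((x))/R)$ be the limit of the regular-singular parts of the reductions $(E,\nabla)|_\ell$. Then $(E,\nabla^{\mathrm{rs}})$ and $(\dot E,\dot\nabla)$ are isomorphic.
   Context: $C$ is an algebraically closed field of characteristic zero; $R$ is a complete discrete valuation domain and $C$-algebra with maximal ideal $\mathfrak r$ and a fixed isomorphism $R\simeq C[[t]]$; $R_\ell=R/\mathfrak r^{\ell+1}$. $\tau\subset C$ is a fixed set of representatives of $C/\mathbb Z$ with $\tau\cap\mathbb Z=\{0\}$. $R((x)):=R[[x]][x^{-1}]$, with derivation $\vartheta(\sum a_nx^n)=\sum na_nx^n$. For $s\ge1$, $x_s^s=x$, and $\vartheta$ is extended to $C((x_s))$ by $\vartheta=s^{-1}x_s\frac{d}{dx_s}$. Connections. $\mathbf{MC}(R((x))/R)$: pairs $(E,\nabla)$ with $E$ a finitely generated $R((x))$-module and $\nabla:E\to E$ $R$-linear with $\nabla(fe)=\vartheta(f)e+f\nabla(e)$; arrows are $R((x))$-linear maps commuting with $\nabla$. $\mathbf{MC}^{\mathrm o}$: objects without $R$-torsion (then $E$ is free). $(E,\nabla)$ is regular-singular (in $\mathbf{MC}_{\mathrm{rs}}$)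 if $(E,\nabla)\simeq(\mathcal E[x^{-1}],\nabla)$ for a finitely generated $R[[x]]$-module $\mathcal E$ with $R$-linear $\nabla$ satisfying Leibniz for $\vartheta$ (a logarithmic model). The same definitions apply with $C$ in place of $R$. For a finite dimensional local $C$-algebra $\Lambda$, $\mathbf{MC}(C((x))/C)_{(\Lambda)}$ is the category of objects of $\mathbf{MC}(C((x))/C)$ with a $C$-algebra morphism from $\Lambda$ to their endomorphism ring. Matrices. $\mathrm{Mat}(\nabla,\mathbf e)=(a_{ij})$ means $\nabla(e_j)=\sum_i a_{ij}e_i$. $\mathrm J^\flat_r(f)$ denotes an $r\times r$ matrix with diagonal entries $f$, entries just below the diagonal in $\{0,1\}$ (unspecified), other entries $0$. TLJ-form over $R((x))$. A representative of $\varphi\in R[x^{-1}]/\mathbb Z$ is an $f\in R((x))$ whose class modulo $\mathbb Z+xR[[x]]$ is $\varphi$. $(E,\nabla)\in\mathbf{MC}^{\mathrm o}(R((x))/R)$ admits a TLJ-decomposition over $R((x))$ if $(E,\nabla)=\bigoplus_{\varphi\in\Phi}(E_\varphi,\nabla_\varphi)$ with $\Phi\subset R[x^{-1}]/\mathbb Z$ finite and $E_\varphi$ the subconnection generated by $\ker(\nabla-f_\varphi)^{q_\varphi}$ for a representative $f_\varphi$ and $q_\varphi$ large. It admits a TLJ-form if moreover each $E_\varphi$ has an $R((x))$-basis $\mathbf e_\varphi$ with $\mathrm{Mat}(\nabla_\varphi,\mathbf e_\varphi)=\mathrm J^\flat_{r_\varphi}(f_\varphi)$ for a representative $f_\varphi$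 of $\varphi$. Logarithmic decomposition over $R((x))$. When $(E,\nabla)$ admits a TLJ-form over $R((x))$, this is the unique decomposition $\nabla=\nabla^{\mathrm{rs}}+P_\nabla$ with: (i) $(E,\nabla^{\mathrm{rs}})\in\mathbf{MC}_{\mathrm{rs}}(R((x))/R)$ admitting a TLJ-form over $R((x))$; (ii) $P_\nabla\in\mathrm{End}_{R((x))}(E)$ diagonalizable with all eigenvalues in $x^{-1}R[x^{-1}]$; (iii) for the TLJ-decomposition $(E,\nabla^{\mathrm{rs}})=\bigoplus_{\varrho\in\Sigma}(E_\varrho,\nabla_\varrho)$, $\Sigma\subset R/\mathbb Z$, each $E_\varrho$ is $P_\nabla$-stable and has an $R((x))$-basis $\mathbf e_\varrho$ with $\mathrm{Mat}(\nabla^{\mathrm{rs}}|_{E_\varrho},\mathbf e_\varrho)=\mathrm J^\flat_{r_\varrho}(c_\varrho)$ and $\mathrm{Mat}(\nabla|_{E_\varrho},\mathbf e_\varrho)=\mathrm{diag}(\mathrm J^\flat_{r_{\varrho1}}(c_\varrho+f_{\varrho1}),\dots,\mathrm J^\flat_{r_{\varrho m}}(c_\varrho+f_{\varrho m}))$ for some $c_\varrho\in R$, $f_{\varrho i}\in x^{-1}R[x^{-1}]$. Logarithmic decomposition over $C((x))$ with $\Lambda$-action. By Levelt, $(F,\nabla)\in\mathbf{MC}(C((x))/C)$ has a unique decomposition $\nabla=S_\nabla+N_\nabla$ with $S_\nabla$ a connection which becomes a direct sum of rank one connections over some $C((x_s))$, $N_\nabla$ nilpotent $C((x))$-linear, and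 $S_\nabla N_\nabla=N_\nabla S_\nabla$; the smallest such $s$ is the Turrittin index. For $(F,\nabla)\in\mathbf{MC}(C((x))/C)_{(\Lambda)}$ with Turrittin index $s$, the logarithmic decomposition is the decomposition $\nabla=\nabla^{\mathrm{rs}}+P_\nabla$ such that: $(F,\nabla^{\mathrm{rs}})\in\mathbf{MC}_{\mathrm{rs}}(C((x))/C)_{(\Lambda)}$; $P_\nabla\in\mathrm{End}_{\Lambda((x))}(F)$ is diagonalizable over $C((x_s))$; and in the decomposition $F=\bigoplus_{\varrho\in\Sigma}F_\varrho$, $\Sigma\subset C/\mathbb Z$, of $(F,\nabla^{\mathrm{rs}})$ into isotypical components over $C((x))$ (the sums of the rank one subconnections of type $\varrho$ for the semisimple part of $\nabla^{\mathrm{rs}}$, a rank one connection $\mathbf f\mapsto f\mathbf f$ being of type the class of $f$ modulo $\mathbb Z+xC[[x]]$), each $F_\varrho$ is $P_\nabla$-stable and $C((x_s))\otimes F_\varrho$ has a basis in which $\nabla^{\mathrm{rs}}$ has matrix $\mathrm J^\flat_{r_\varrho}(c_\varrho)$ and $\nabla$ has matrix $\mathrm{diag}(\mathrm J^\flat_{r_{\varrho1}}(c_\varrho+f_{\varrho1}),\dots,\mathrm J^\flat_{r_{\varrho m}}(c_\varrho+f_{\varrho m}))$ with $c_\varrho\in C$, $f_{\varrho i}\in x_s^{-1}C[x_s^{-1}]$. Reduction and limit. $(E,\nabla)|_\ell=(E|_\ell,\nabla|_\ell)$ is the reduction modulo $\mathfrak r^{\ell+1}$, regarded as an object of $\mathbf{MC}(C((x))/C)_{(R_\ell)}$,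 and $\nabla|_\ell^{\mathrm{rs}}$ is the regular-singular part of its logarithmic decomposition. These satisfy $(E|_{\ell+1},\nabla|_{\ell+1}^{\mathrm{rs}})|_\ell=(E|_\ell,\nabla|_\ell^{\mathrm{rs}})$. Each $(E|_\ell,\nabla|_\ell^{\mathrm{rs}})$ has a Deligne-Manin lattice $\mathcal E_\ell$ with respect to $\tau$ (a free logarithmic model over $C[[x]]$ such that all eigenvalues of the map induced by $\nabla$ on $\mathcal E_\ell/x\mathcal E_\ell$ lie in $\tau$), stable under $R_\ell$, and $\mathcal E_{\ell+1}|_\ell\simeq\mathcal E_\ell$. Then $\varprojlim_\ell(E|_\ell,\nabla|_\ell^{\mathrm{rs}}):=(\mathcal E[x^{-1}],\nabla)$ with $(\mathcal E,\nabla)=\varprojlim_\ell\mathcal E_\ell$, a logarithmic connection over $R[[x]]$.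
   Formalization: In both logarithmic decompositions (over R((x)) and C((x))), the unspecified entries below the diagonal in the matrices of ∇^rs and ∇ are required to agree, so P_∇ is diagonal in that basis; with independent entries the decomposition is not unique and the claim fails. *)

theory Defs
  imports
    "Jordan_Normal_Form.Matrix"
    "HOL-Algebra.Algebraic_Closure_Type"
    "HOL-Computational_Algebra.Formal_Laurent_Series"
    "HOL-Library.FuncSet"
begin

text \<open>
  Conventions. With \<open>'c\<close> the field \<open>C\<close>, the ring \<open>R = C[[t]]\<close> is the type \<open>'c fps\<close>, so that
  \<open>C((x))\<close> and \<open>R((x))\<close> are \<open>'c fls\<close> and \<open>'c fps fls\<close> (outer variable \<open>x\<close>), while \<open>C[[x]]\<close> and
  \<open>R[[x]]\<close> are \<open>'c fps\<close> and \<open>'c fps fps\<close>. Modules are module records of HOL-Algebra, only the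
  additive structure and the scalar multiplication of which are meaningful, over the ring
  \<^const>\<open>ring_of_type_algebra\<close> of all elements of a type. A submodule \<open>H\<close> of \<open>M\<close> is regarded as
  a module by replacing the carrier, \<open>M\<lparr>carrier := H\<rparr>\<close>. Connections are called \<open>D\<close>, and \<open>Drs\<close> is the
  regular-singular part of \<open>D\<close>.
\<close>

section \<open>Modules\<close>

abbreviation is_module :: "('k::comm_ring_1, 'm) module \<Rightarrow> bool" where
  "is_module M \<equiv> Module.module ring_of_type_algebra M"

abbreviation is_submodule :: "'m set \<Rightarrow> ('k::comm_ring_1, 'm) module \<Rightarrow> bool" where
  "is_submodule H M \<equiv> Module.submodule H ring_of_type_algebra M"

definition finitely_generated :: "('k::comm_ring_1, 'm) module \<Rightarrow> bool" where
  "finitely_generated M \<longleftrightarrow>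
     (\<exists>(n::nat) e. e \<in> {..<n} \<rightarrow> carrier M \<and>
        (\<forall>v\<in>carrier M. \<exists>a. v = (\<Oplus>\<^bsub>M\<^esub>i\<in>{..<n}. a i \<odot>\<^bsub>M\<^esub> e i)))"

definition is_basis :: "('k::comm_ring_1, 'm) module \<Rightarrow> nat \<Rightarrow> (nat \<Rightarrow> 'm) \<Rightarrow> bool" where
  "is_basis M n e \<longleftrightarrow>
     e \<in> {..<n} \<rightarrow> carrier M \<and>
     (\<forall>v\<in>carrier M. \<exists>!a. a \<in> {..<n} \<rightarrow>\<^sub>E UNIV \<and> v = (\<Oplus>\<^bsub>M\<^esub>i\<in>{..<n}. a i \<odot>\<^bsub>M\<^esub> e i))"

definition linear_map ::
  "('k::comm_ring_1, 'm) module \<Rightarrow> ('k, 'n) module \<Rightarrow> ('m \<Rightarrow> 'n) \<Rightarrow> bool" where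
  "linear_map M M' \<phi> \<longleftrightarrow>
     \<phi> \<in> carrier M \<rightarrow> carrier M' \<and>
     (\<forall>v\<in>carrier M. \<forall>w\<in>carrier M. \<phi> (v \<oplus>\<^bsub>M\<^esub> w) = \<phi> v \<oplus>\<^bsub>M'\<^esub> \<phi> w) \<and>
     (\<forall>a. \<forall>v\<in>carrier M. \<phi> (a \<odot>\<^bsub>M\<^esub> v) = a \<odot>\<^bsub>M'\<^esub> \<phi> v)"

definition internal_direct_sum ::
  "('k::comm_ring_1, 'm) module \<Rightarrow> 'i set \<Rightarrow> ('i \<Rightarrow> 'm set) \<Rightarrow> bool" where
  "internal_direct_sum M I H \<longleftrightarrow>
     finite I \<and> (\<forall>i\<in>I. is_submodule (H i) M) \<and>
     (\<forall>v\<in>carrier M. \<exists>!w. w \<in> (\<Pi>\<^sub>E i\<in>I. H i) \<and> v = (\<Oplus>\<^bsub>M\<^esub>i\<in>I. w i))"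

definition restrict_scalars :: "('a \<Rightarrow> 'k) \<Rightarrow> ('k, 'm) module \<Rightarrow> ('a, 'm) module" where
  "restrict_scalars h M =
     \<lparr>carrier = carrier M, monoid.mult = monoid.mult M, one = one M, zero = zero M, add = add M,
      module.smult = (\<lambda>a. module.smult M (h a))\<rparr>"

text \<open>The map on cosets of \<open>N\<close> induced by \<open>\<phi>\<close>; the cosets in the union all coincide whenever
  \<open>\<phi>\<close> is compatible with the cosets.\<close>

definition coset_map :: "('k, 'm) module \<Rightarrow> 'm set \<Rightarrow> ('m \<Rightarrow> 'm) \<Rightarrow> 'm set \<Rightarrow> 'm set" where
  "coset_map M N \<phi> Y = (\<Union>v\<in>Y. N +>\<^bsub>M\<^esub> \<phi> v)"

text \<open>The components \<open>mult\<close> and \<open>one\<close> are dummies.\<close>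

definition quotient_module :: "('k, 'm) module \<Rightarrow> 'm set \<Rightarrow> ('k, 'm set) module" where
  "quotient_module M N =
     \<lparr>carrier = a_rcosets\<^bsub>M\<^esub> N, monoid.mult = (\<lambda>_ _. N), one = N, zero = N, add = set_add M,
      module.smult = (\<lambda>a. coset_map M N (module.smult M a))\<rparr>"

text \<open>Applied to a linear endomorphism this is diagonalizability; applied to a connection it says
  that the connection is a direct sum of connections of rank one.\<close>

definition diagonalizable :: "('k::comm_ring_1, 'm) module \<Rightarrow> ('m \<Rightarrow> 'm) \<Rightarrow> bool" where
  "diagonalizable M \<phi> \<longleftrightarrow>
     (\<exists>n e a. is_basis M n e \<and> (\<forall>i<n. \<phi> (e i) = a i \<odot>\<^bsub>M\<^esub> e i))"

definition is_eigenvalue :: "('k::comm_ring_1, 'm) module \<Rightarrow> ('m \<Rightarrow> 'm) \<Rightarrow> 'k \<Rightarrow> bool" where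
  "is_eigenvalue M \<phi> a \<longleftrightarrow> (\<exists>v\<in>carrier M. v \<noteq> \<zero>\<^bsub>M\<^esub> \<and> \<phi> v = a \<odot>\<^bsub>M\<^esub> v)"


section \<open>Connections\<close>

definition theta_fls :: "'r::comm_ring_1 fls \<Rightarrow> 'r fls" where
  "theta_fls f = fls_X * fls_deriv f"

definition theta_fps :: "'r::comm_ring_1 fps \<Rightarrow> 'r fps" where
  "theta_fps f = fps_X * fps_deriv f"

text \<open>Connections for a derivation \<open>\<delta>\<close>, linear over the constants embedded by \<open>\<kappa>\<close>.\<close>

definition connection ::
  "('r \<Rightarrow> 'k) \<Rightarrow> ('k \<Rightarrow> 'k) \<Rightarrow> ('k::comm_ring_1, 'm) module \<Rightarrow> ('m \<Rightarrow> 'm) \<Rightarrow> bool" where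
  "connection \<kappa> \<delta> M D \<longleftrightarrow>
     is_module M \<and> finitely_generated M \<and>
     D \<in> carrier M \<rightarrow> carrier M \<and>
     (\<forall>v\<in>carrier M. \<forall>w\<in>carrier M. D (v \<oplus>\<^bsub>M\<^esub> w) = D v \<oplus>\<^bsub>M\<^esub> D w) \<and>
     (\<forall>r. \<forall>v\<in>carrier M. D (\<kappa> r \<odot>\<^bsub>M\<^esub> v) = \<kappa> r \<odot>\<^bsub>M\<^esub> D v) \<and>
     (\<forall>f. \<forall>v\<in>carrier M. D (f \<odot>\<^bsub>M\<^esub> v) = \<delta> f \<odot>\<^bsub>M\<^esub> v \<oplus>\<^bsub>M\<^esub> f \<odot>\<^bsub>M\<^esub> D v)"

definition MC :: "('r::comm_ring_1 fls, 'm) module \<Rightarrow> ('m \<Rightarrow> 'm) \<Rightarrow> bool" where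
  "MC M D \<longleftrightarrow> connection fls_const theta_fls M D"

definition MC_log :: "('r::comm_ring_1 fps, 'm) module \<Rightarrow> ('m \<Rightarrow> 'm) \<Rightarrow> bool" where
  "MC_log M D \<longleftrightarrow> connection fps_const theta_fps M D"

definition MCo :: "('r::comm_ring_1 fls, 'm) module \<Rightarrow> ('m \<Rightarrow> 'm) \<Rightarrow> bool" where
  "MCo M D \<longleftrightarrow> MC M D \<and>
     (\<forall>r. \<forall>v\<in>carrier M. r \<noteq> 0 \<longrightarrow> fls_const r \<odot>\<^bsub>M\<^esub> v = \<zero>\<^bsub>M\<^esub> \<longrightarrow> v = \<zero>\<^bsub>M\<^esub>)"

definition MC_isomorphic ::
  "('r::comm_ring_1 fls, 'm) module \<Rightarrow> ('m \<Rightarrow> 'm) \<Rightarrow> ('r fls, 'n) module \<Rightarrow> ('n \<Rightarrow> 'n) \<Rightarrow> bool" where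
  "MC_isomorphic M D M' D' \<longleftrightarrow>
     MC M D \<and> MC M' D' \<and>
     (\<exists>\<phi>. linear_map M M' \<phi> \<and> bij_betw \<phi> (carrier M) (carrier M') \<and>
          (\<forall>v\<in>carrier M. \<phi> (D v) = D' (\<phi> v)))"

text \<open>The last two clauses express that \<open>j\<close> exhibits \<open>M\<close>, on which \<open>x\<close> acts bijectively, as the
  localization \<open>L[x\<^sup>-\<^sup>1]\<close>; as \<open>j\<close> commutes with \<open>DL\<close> and \<open>D\<close>, the latter is the unique extension
  of \<open>DL\<close> to \<open>L[x\<^sup>-\<^sup>1]\<close>.\<close>

definition log_model ::
  "('r::comm_ring_1 fps, 'l) module \<Rightarrow> ('l \<Rightarrow> 'l) \<Rightarrow> ('l \<Rightarrow> 'm) \<Rightarrow>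
   ('r fls, 'm) module \<Rightarrow> ('m \<Rightarrow> 'm) \<Rightarrow> bool" where
  "log_model L DL j M D \<longleftrightarrow>
     MC_log L DL \<and> MC M D \<and>
     linear_map L (restrict_scalars fps_to_fls M) j \<and>
     (\<forall>v\<in>carrier L. j (DL v) = D (j v)) \<and>
     (\<forall>v\<in>carrier L. j v = \<zero>\<^bsub>M\<^esub> \<longrightarrow> (\<exists>n. fps_X ^ n \<odot>\<^bsub>L\<^esub> v = \<zero>\<^bsub>L\<^esub>)) \<and>
     (\<forall>w\<in>carrier M. \<exists>n. fls_X ^ n \<odot>\<^bsub>M\<^esub> w \<in> j ` carrier L)"

text \<open>Every finitely generated \<open>R[[x]]\<close>-module is isomorphic to a quotient of a power of \<open>R[[x]]\<close>,
  hence to one whose elements have the type chosen here.\<close>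

definition MC_rs :: "('r::comm_ring_1 fls, 'm) module \<Rightarrow> ('m \<Rightarrow> 'm) \<Rightarrow> bool" where
  "MC_rs M D \<longleftrightarrow> MC M D \<and>
     (\<exists>(L :: ('r fps, (nat \<Rightarrow> 'r fps) set) module) DL j. log_model L DL j M D)"

text \<open>The action \<open>act\<close> of the \<open>C\<close>-algebra \<open>\<Lambda>\<close>, with structure morphism \<open>\<iota>\<close>, is a morphism of
  \<open>C\<close>-algebras to the endomorphism ring of \<open>(M, D)\<close>.\<close>

definition MC_alg ::
  "'l ring \<Rightarrow> ('c \<Rightarrow> 'l) \<Rightarrow> ('l \<Rightarrow> 'm \<Rightarrow> 'm) \<Rightarrow>
   ('c::comm_ring_1 fls, 'm) module \<Rightarrow> ('m \<Rightarrow> 'm) \<Rightarrow> bool" where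
  "MC_alg \<Lambda> \<iota> act M D \<longleftrightarrow>
     MC M D \<and>
     (\<forall>a\<in>carrier \<Lambda>. linear_map M M (act a) \<and> (\<forall>v\<in>carrier M. act a (D v) = D (act a v))) \<and>
     (\<forall>v\<in>carrier M.
        (\<forall>a\<in>carrier \<Lambda>. \<forall>b\<in>carrier \<Lambda>.
           act (a \<oplus>\<^bsub>\<Lambda>\<^esub> b) v = act a v \<oplus>\<^bsub>M\<^esub> act b v \<and>
           act (a \<otimes>\<^bsub>\<Lambda>\<^esub> b) v = act a (act b v)) \<and>
        act \<one>\<^bsub>\<Lambda>\<^esub> v = v \<and>
        (\<forall>c. act (\<iota> c) v = fls_const c \<odot>\<^bsub>M\<^esub> v))"


section \<open>Matrices\<close>

definition has_matrix ::
  "('k::comm_ring_1, 'm) module \<Rightarrow> ('m \<Rightarrow> 'm) \<Rightarrow> nat \<Rightarrow> (nat \<Rightarrow> 'm) \<Rightarrow> 'k mat \<Rightarrow> bool" where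
  "has_matrix M D n e A \<longleftrightarrow>
     A \<in> carrier_mat n n \<and>
     (\<forall>j<n. D (e j) = (\<Oplus>\<^bsub>M\<^esub>i\<in>{..<n}. index_mat A (i, j) \<odot>\<^bsub>M\<^esub> e i))"

definition is_Jflat :: "nat \<Rightarrow> 'k::comm_ring_1 \<Rightarrow> 'k mat \<Rightarrow> bool" where
  "is_Jflat r f A \<longleftrightarrow>
     A \<in> carrier_mat r r \<and>
     (\<forall>i<r. \<forall>j<r. if i = j then index_mat A (i, j) = f
                  else if i = Suc j then index_mat A (i, j) \<in> {0, 1}
                  else index_mat A (i, j) = 0)"


section \<open>TLJ-forms\<close>

text \<open>Elements of \<open>R[x\<^sup>-\<^sup>1]/\<int> = R((x))/(\<int> + xR[[x]])\<close> are classes of Laurent series, so that a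
  representative of \<open>\<phi>\<close> is an element of \<open>\<phi>\<close>.\<close>

definition fls_type :: "'r::comm_ring_1 fls \<Rightarrow> 'r fls set" where
  "fls_type f = {g. \<exists>(m::int) h. g - f = of_int m + fps_to_fls (fps_X * h)}"

text \<open>The smallest submodule stable under \<open>D\<close> which contains \<open>S\<close>.\<close>

definition subconnection_generated ::
  "('k::comm_ring_1, 'm) module \<Rightarrow> ('m \<Rightarrow> 'm) \<Rightarrow> 'm set \<Rightarrow> 'm set" where
  "subconnection_generated M D S = \<Inter>{H. is_submodule H M \<and> D ` H \<subseteq> H \<and> S \<subseteq> H}"

definition TLJ_decomposition ::
  "('r::comm_ring_1 fls, 'm) module \<Rightarrow> ('m \<Rightarrow> 'm) \<Rightarrow> 'r fls set set \<Rightarrow> ('r fls set \<Rightarrow> 'm set) \<Rightarrow> bool"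
  where
  "TLJ_decomposition M D \<Phi> Ec \<longleftrightarrow>
     finite \<Phi> \<and> \<Phi> \<subseteq> range fls_type \<and> internal_direct_sum M \<Phi> Ec \<and>
     (\<forall>\<phi>\<in>\<Phi>. \<exists>f\<in>\<phi>. \<exists>q0. \<forall>q\<ge>q0.
        Ec \<phi> = subconnection_generated M D
                 {v \<in> carrier M. ((\<lambda>v. D v \<ominus>\<^bsub>M\<^esub> f \<odot>\<^bsub>M\<^esub> v) ^^ q) v = \<zero>\<^bsub>M\<^esub>})"

definition admits_TLJ_form :: "('r::comm_ring_1 fls, 'm) module \<Rightarrow> ('m \<Rightarrow> 'm) \<Rightarrow> bool" where
  "admits_TLJ_form M D \<longleftrightarrow>
     (\<exists>\<Phi> Ec. TLJ_decomposition M D \<Phi> Ec \<and>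
        (\<forall>\<phi>\<in>\<Phi>. \<exists>f\<in>\<phi>. \<exists>r e A.
           is_basis (M\<lparr>carrier := Ec \<phi>\<rparr>) r e \<and>
           has_matrix (M\<lparr>carrier := Ec \<phi>\<rparr>) D r e A \<and> is_Jflat r f A))"


section \<open>Logarithmic decompositions\<close>

definition polar_parts :: "'r::comm_ring_1 fls set" where
  "polar_parts = {f. \<forall>n\<ge>0. fls_nth f n = 0}"

text \<open>A basis in which \<open>Drs\<close> has matrix \<open>J\<^sup>\<flat>(c)\<close> and \<open>D\<close> has matrix
  \<open>diag(J\<^sup>\<flat>(c + f\<^sub>1), \<dots>, J\<^sup>\<flat>(c + f\<^sub>m))\<close>. The unspecified entries below the diagonal are the same for
  both matrices, i.e. \<open>D - Drs\<close> has the diagonal matrix with entries \<open>f\<^sub>1, \<dots>, f\<^sub>m\<close>. Without this the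
  logarithmic decomposition would not be unique: for \<open>D = \<theta> + diag(f\<^sub>1, f\<^sub>2)\<close> with \<open>f\<^sub>1 \<noteq> f\<^sub>2\<close>, one could
  take \<open>Drs = \<theta> + N\<close> with \<open>N\<close> any matrix of the form \<open>J\<^sup>\<flat>(0)\<close>.\<close>

definition has_log_basis ::
  "('r::comm_ring_1 fls, 'm) module \<Rightarrow> ('m \<Rightarrow> 'm) \<Rightarrow> ('m \<Rightarrow> 'm) \<Rightarrow> bool" where
  "has_log_basis M Drs D \<longleftrightarrow>
     (\<exists>c r e A fs Bs.
        is_basis M r e \<and>
        has_matrix M Drs r e A \<and> is_Jflat r (fls_const c) A \<and>
        has_matrix M D r e (diag_block_mat Bs) \<and>
        list_all2 (\<lambda>B f. f \<in> polar_parts \<and> is_Jflat (dim_row B) (fls_const c + f) B) Bs fs \<and>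
        (\<forall>i<r. \<forall>j<r. i \<noteq> j \<longrightarrow> index_mat A (i, j) = index_mat (diag_block_mat Bs) (i, j)))"

definition log_decomposition ::
  "('r::comm_ring_1 fls, 'm) module \<Rightarrow> ('m \<Rightarrow> 'm) \<Rightarrow> ('m \<Rightarrow> 'm) \<Rightarrow> ('m \<Rightarrow> 'm) \<Rightarrow> bool" where
  "log_decomposition M D Drs P \<longleftrightarrow>
     (\<forall>v\<in>carrier M. D v = Drs v \<oplus>\<^bsub>M\<^esub> P v) \<and>
     MC_rs M Drs \<and> admits_TLJ_form M Drs \<and>
     linear_map M M P \<and> diagonalizable M P \<and> (\<forall>a. is_eigenvalue M P a \<longrightarrow> a \<in> polar_parts) \<and>
     (\<exists>T Ec. TLJ_decomposition M Drs T Ec \<and> T \<subseteq> range (\<lambda>c. fls_type (fls_const c)) \<and>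
        (\<forall>\<rho>\<in>T. P ` Ec \<rho> \<subseteq> Ec \<rho> \<and> has_log_basis (M\<lparr>carrier := Ec \<rho>\<rparr>) Drs D))"

text \<open>For \<open>g \<in> C((x\<^sub>s))\<close>, the series \<open>g\<^sub>d \<in> C((x))\<close> in the decomposition
  \<open>g = \<Sum> x\<^sub>s\<^sup>d g\<^sub>d\<close>, \<open>0 \<le> d < s\<close>, \<open>x\<^sub>s\<^sup>s = x\<close>; for other \<open>d\<close> one has \<open>g\<^sub>d = x g\<^bsub>d+s\<^esub>\<close>.\<close>

definition xs_component :: "nat \<Rightarrow> 'c::zero fls \<Rightarrow> int \<Rightarrow> 'c fls" where
  "xs_component s g d = Abs_fls (\<lambda>m. fls_nth g (int s * m + d))"

lemma fls_nth_xs_component: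
  assumes "s \<ge> 1"
  shows "fls_nth (xs_component s g d) m = fls_nth g (int s * m + d)"
proof -
  define N where "N = - (\<bar>fls_subdegree g\<bar> + \<bar>d\<bar>)"
  have "fls_nth g (int s * m + d) = 0" if "m < N" for m
  proof -
    have "m < 0" using that by (simp add: N_def)
    hence "int s * m \<le> 1 * m" using assms by (intro mult_right_mono_neg) auto
    hence "int s * m + d < fls_subdegree g" using that by (simp add: N_def)
    thus ?thesis by simp
  qed
  thus ?thesis unfolding xs_component_def by (intro nth_Abs_fls_lower_bound) auto
qed

text \<open>The module \<open>C((x\<^sub>s)) \<otimes> M\<close>: since \<open>1, x\<^sub>s, \<dots>, x\<^sub>s\<^sup>s\<^sup>-\<^sup>1\<close> is a basis of \<open>C((x\<^sub>s))\<close> over \<open>C((x))\<close>,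
  its elements are uniquely \<open>\<Sum> x\<^sub>s\<^sup>i \<otimes> v i\<close>, \<open>i < s\<close>. Since \<open>\<theta> x\<^sub>s\<^sup>i = (i/s) x\<^sub>s\<^sup>i\<close>, a connection
  \<open>D\<close> extends by \<open>D (x\<^sub>s\<^sup>i \<otimes> w) = x\<^sub>s\<^sup>i \<otimes> (D w + (i/s) w)\<close>.\<close>

definition base_change :: "nat \<Rightarrow> ('c::field fls, 'm) module \<Rightarrow> ('c fls, nat \<Rightarrow> 'm) module" where
  "base_change s M =
     \<lparr>carrier = {..<s} \<rightarrow>\<^sub>E carrier M,
      monoid.mult = (\<lambda>_ _. \<lambda>i\<in>{..<s}. \<zero>\<^bsub>M\<^esub>), one = (\<lambda>i\<in>{..<s}. \<zero>\<^bsub>M\<^esub>),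
      zero = (\<lambda>i\<in>{..<s}. \<zero>\<^bsub>M\<^esub>),
      add = (\<lambda>v w. \<lambda>i\<in>{..<s}. v i \<oplus>\<^bsub>M\<^esub> w i),
      module.smult = (\<lambda>g v. \<lambda>k\<in>{..<s}. \<Oplus>\<^bsub>M\<^esub>i\<in>{..<s}. xs_component s g (int k - int i) \<odot>\<^bsub>M\<^esub> v i)\<rparr>"

definition base_change_endo :: "nat \<Rightarrow> ('m \<Rightarrow> 'm) \<Rightarrow> (nat \<Rightarrow> 'm) \<Rightarrow> (nat \<Rightarrow> 'm)" where
  "base_change_endo s \<phi> v = (\<lambda>i\<in>{..<s}. \<phi> (v i))"

definition base_change_connection ::
  "nat \<Rightarrow> ('c::field fls, 'm) module \<Rightarrow> ('m \<Rightarrow> 'm) \<Rightarrow> (nat \<Rightarrow> 'm) \<Rightarrow> (nat \<Rightarrow> 'm)" where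
  "base_change_connection s M D v =
     (\<lambda>i\<in>{..<s}. D (v i) \<oplus>\<^bsub>M\<^esub> fls_const (of_nat i / of_nat s) \<odot>\<^bsub>M\<^esub> v i)"

definition Levelt_decomposition ::
  "('c::field fls, 'm) module \<Rightarrow> ('m \<Rightarrow> 'm) \<Rightarrow> ('m \<Rightarrow> 'm) \<Rightarrow> ('m \<Rightarrow> 'm) \<Rightarrow> bool" where
  "Levelt_decomposition M D S N \<longleftrightarrow>
     (\<forall>v\<in>carrier M. D v = S v \<oplus>\<^bsub>M\<^esub> N v) \<and>
     MC M S \<and> (\<exists>s\<ge>1. diagonalizable (base_change s M) (base_change_connection s M S)) \<and>
     linear_map M M N \<and> (\<exists>q. \<forall>v\<in>carrier M. (N ^^ q) v = \<zero>\<^bsub>M\<^esub>) \<and>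
     (\<forall>v\<in>carrier M. S (N v) = N (S v))"

definition is_Turrittin_index :: "('c::field fls, 'm) module \<Rightarrow> ('m \<Rightarrow> 'm) \<Rightarrow> nat \<Rightarrow> bool" where
  "is_Turrittin_index M D s \<longleftrightarrow>
     (\<exists>S N. Levelt_decomposition M D S N \<and>
        s = (LEAST s. s \<ge> 1 \<and> diagonalizable (base_change s M) (base_change_connection s M S)))"

text \<open>A rank one subconnection of \<open>(M, S)\<close> of type \<open>\<rho>\<close> is a line spanned by a vector \<open>v\<close> with
  \<open>S v = f v\<close>, where \<open>f \<in> \<rho>\<close>.\<close>

definition isotypical_component ::
  "('c::field fls, 'm) module \<Rightarrow> ('m \<Rightarrow> 'm) \<Rightarrow> 'c fls set \<Rightarrow> 'm set" where
  "isotypical_component M S \<rho> =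
     subconnection_generated M S {v \<in> carrier M. \<exists>f\<in>\<rho>. S v = f \<odot>\<^bsub>M\<^esub> v}"

definition log_decomposition_alg ::
  "'l ring \<Rightarrow> ('c \<Rightarrow> 'l) \<Rightarrow> ('l \<Rightarrow> 'm \<Rightarrow> 'm) \<Rightarrow>
   ('c::field fls, 'm) module \<Rightarrow> ('m \<Rightarrow> 'm) \<Rightarrow> ('m \<Rightarrow> 'm) \<Rightarrow> ('m \<Rightarrow> 'm) \<Rightarrow> bool" where
  "log_decomposition_alg \<Lambda> \<iota> act M D Drs P \<longleftrightarrow>
     MC_alg \<Lambda> \<iota> act M D \<and>
     (\<forall>v\<in>carrier M. D v = Drs v \<oplus>\<^bsub>M\<^esub> P v) \<and>
     MC_rs M Drs \<and> MC_alg \<Lambda> \<iota> act M Drs \<and>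
     linear_map M M P \<and> (\<forall>a\<in>carrier \<Lambda>. \<forall>v\<in>carrier M. P (act a v) = act a (P v)) \<and>
     (\<exists>s. is_Turrittin_index M D s \<and>
        diagonalizable (base_change s M) (base_change_endo s P) \<and>
        (\<exists>S N T. Levelt_decomposition M Drs S N \<and>
           T \<subseteq> range (\<lambda>c. fls_type (fls_const c)) \<and>
           internal_direct_sum M T (isotypical_component M S) \<and>
           (\<forall>\<rho>\<in>T.
              P ` isotypical_component M S \<rho> \<subseteq> isotypical_component M S \<rho> \<and>
              has_log_basis (base_change s (M\<lparr>carrier := isotypical_component M S \<rho>\<rparr>))
                (base_change_connection s M Drs) (base_change_connection s M D))))"


section \<open>Reductions\<close>

definition fls_map_const :: "'c::comm_ring_1 fls \<Rightarrow> 'c fps fls" where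
  "fls_map_const f = Abs_fls (\<lambda>n. fps_const (fls_nth f n))"

lemma fls_nth_fls_map_const: "fls_nth (fls_map_const f) n = fps_const (fls_nth f n)"
  unfolding fls_map_const_def by (intro nth_Abs_fls_lower_bound[of "fls_subdegree f"]) auto

text \<open>\<open>R\<^sub>l = R/(t\<^sup>l\<^sup>+\<^sup>1)\<close> with its structure of \<open>C\<close>-algebra.\<close>

definition trunc_ideal :: "nat \<Rightarrow> 'c::comm_ring_1 fps set" where
  "trunc_ideal l = PIdl\<^bsub>ring_of_type_algebra\<^esub> (fps_X ^ Suc l)"

definition trunc_ring :: "nat \<Rightarrow> 'c::comm_ring_1 fps set ring" where
  "trunc_ring l = ring_of_type_algebra Quot trunc_ideal l"

definition trunc_const :: "nat \<Rightarrow> 'c::comm_ring_1 \<Rightarrow> 'c fps set" where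
  "trunc_const l c = trunc_ideal l +>\<^bsub>ring_of_type_algebra\<^esub> fps_const c"

definition red_kernel :: "('c::comm_ring_1 fps fls, 'e) module \<Rightarrow> nat \<Rightarrow> 'e set" where
  "red_kernel E l = (\<lambda>v. fls_const (fps_X ^ Suc l) \<odot>\<^bsub>E\<^esub> v) ` carrier E"

text \<open>The reduction \<open>E|\<^sub>l\<close>, as a module over \<open>R((x))\<close>, and then over \<open>C((x))\<close> with the action of \<open>R\<^sub>l\<close>.\<close>

definition reduction ::
  "('c::comm_ring_1 fps fls, 'e) module \<Rightarrow> nat \<Rightarrow> ('c fps fls, 'e set) module" where
  "reduction E l = quotient_module E (red_kernel E l)"

definition reduction_C ::
  "('c::comm_ring_1 fps fls, 'e) module \<Rightarrow> nat \<Rightarrow> ('c fls, 'e set) module" where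
  "reduction_C E l = restrict_scalars fls_map_const (reduction E l)"

definition reduction_act ::
  "('c::comm_ring_1 fps fls, 'e) module \<Rightarrow> nat \<Rightarrow> 'c fps set \<Rightarrow> 'e set \<Rightarrow> 'e set" where
  "reduction_act E l a Y = (\<Union>r\<in>a. fls_const r \<odot>\<^bsub>reduction E l\<^esub> Y)"

definition reduction_connection ::
  "('c::comm_ring_1 fps fls, 'e) module \<Rightarrow> ('e \<Rightarrow> 'e) \<Rightarrow> nat \<Rightarrow> 'e set \<Rightarrow> 'e set" where
  "reduction_connection E D l = coset_map E (red_kernel E l) D"

text \<open>The projection from \<open>E|\<^bsub>l+1\<^esub>\<close> to \<open>E|\<^sub>l\<close>.\<close>

definition transition ::
  "('c::comm_ring_1 fps fls, 'e) module \<Rightarrow> nat \<Rightarrow> 'e set \<Rightarrow> 'e set" where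
  "transition E l = coset_map E (red_kernel E l) (\<lambda>v. v)"

definition log_decomposition_red ::
  "('c::field fps fls, 'e) module \<Rightarrow> ('e \<Rightarrow> 'e) \<Rightarrow> nat \<Rightarrow>
   ('e set \<Rightarrow> 'e set) \<Rightarrow> ('e set \<Rightarrow> 'e set) \<Rightarrow> bool" where
  "log_decomposition_red E D l Drs P \<longleftrightarrow>
     log_decomposition_alg (trunc_ring l) (trunc_const l) (reduction_act E l)
       (reduction_C E l) (reduction_connection E D l) Drs P"


section \<open>Deligne-Manin lattices and limits\<close>

definition representatives_mod_Ints :: "'c::ring_1 set \<Rightarrow> bool" where
  "representatives_mod_Ints \<tau> \<longleftrightarrow> (\<forall>c. \<exists>!a. a \<in> \<tau> \<and> c - a \<in> \<int>) \<and> \<tau> \<inter> \<int> = {0}"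

text \<open>As a free logarithmic model embeds into \<open>M\<close>, it is taken to be a subset \<open>W\<close> of \<open>M\<close>. The last
  clause concerns the eigenvalues of the endomorphism of \<open>W/xW\<close> induced by \<open>D\<close>.\<close>

definition Deligne_Manin_lattice ::
  "'c set \<Rightarrow> ('c::field fls, 'm) module \<Rightarrow> ('m \<Rightarrow> 'm) \<Rightarrow> 'm set \<Rightarrow> bool" where
  "Deligne_Manin_lattice \<tau> M D W \<longleftrightarrow>
     W \<subseteq> carrier M \<and>
     (let L = (restrict_scalars fps_to_fls M)\<lparr>carrier := W\<rparr>;
          xW = (\<lambda>v. fps_X \<odot>\<^bsub>L\<^esub> v) ` W
      in log_model L D (\<lambda>v. v) M D \<and>
         (\<exists>n e. is_basis L n e) \<and>
         (\<forall>a. (\<exists>v\<in>W. v \<notin> xW \<and> (\<exists>w\<in>xW. D v = fps_const a \<odot>\<^bsub>L\<^esub> v \<oplus>\<^bsub>L\<^esub> w)) \<longrightarrow> a \<in> \<tau>))"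

definition limit_lattice ::
  "('c::comm_ring_1 fps fls, 'e) module \<Rightarrow> (nat \<Rightarrow> 'e set set) \<Rightarrow> (nat \<Rightarrow> 'e set) set" where
  "limit_lattice E W = {v. \<forall>l. v l \<in> W l \<and> transition E l (v (Suc l)) = v l}"

text \<open>The \<open>R((x))\<close>-module \<open>\<E>[x\<^sup>-\<^sup>1]\<close>, \<open>\<E>\<close> being the limit of the lattices \<open>W l\<close>, formed inside the
  limit of the \<open>E|\<^sub>l\<close>, on which \<open>x\<close> acts bijectively.\<close>

definition limit_module ::
  "('c::comm_ring_1 fps fls, 'e) module \<Rightarrow> (nat \<Rightarrow> 'e set set) \<Rightarrow>
   ('c fps fls, nat \<Rightarrow> 'e set) module" where
  "limit_module E W =
     \<lparr>carrier = {v. (\<forall>l. v l \<in> carrier (reduction E l) \<and> transition E l (v (Suc l)) = v l) \<and>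
                    (\<exists>n. (\<lambda>l. fls_X ^ n \<odot>\<^bsub>reduction E l\<^esub> v l) \<in> limit_lattice E W)},
      monoid.mult = (\<lambda>_ _ l. \<zero>\<^bsub>reduction E l\<^esub>), one = (\<lambda>l. \<zero>\<^bsub>reduction E l\<^esub>),
      zero = (\<lambda>l. \<zero>\<^bsub>reduction E l\<^esub>),
      add = (\<lambda>v w l. v l \<oplus>\<^bsub>reduction E l\<^esub> w l),
      module.smult = (\<lambda>f v l. f \<odot>\<^bsub>reduction E l\<^esub> v l)\<rparr>"

definition limit_connection :: "(nat \<Rightarrow> 'e set \<Rightarrow> 'e set) \<Rightarrow> (nat \<Rightarrow> 'e set) \<Rightarrow> (nat \<Rightarrow> 'e set)" where
  "limit_connection D v = (\<lambda>l. D l (v l))"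

end

theory Submission
  imports Defs
begin

text \<open>
  It is tempting to expect that the regular-singular part of the reduction modulo \<open>t\<^sup>l\<^sup>+\<^sup>1\<close> is the reduction
  of the regular-singular part. This is false when the polar parts depend on \<open>t\<close>. For the
  connection \<open>e \<mapsto> f e\<close> of rank one with \<open>f = x\<^sup>-\<^sup>1 (1 + t)\<close>, multiplication by \<open>f\<close> is not diagonalizable
  over \<open>C((x))\<close> on the reduction modulo \<open>t\<^sup>2\<close>. Instead, \<open>e' = exp (t/x) e\<close> satisfies \<open>e' \<mapsto> x\<^sup>-\<^sup>1 e'\<close>, and
  the regular-singular part of the reduction is the connection that kills \<open>e'\<close>, not \<open>e\<close>. The limit is
  therefore isomorphic to the regular-singular part, but not equal to it inside the limit of the
  reductions: the series \<open>exp (t/x)\<close> does not belong to \<open>R((x))\<close>.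

  In general the logarithmic decomposition provides a basis of \<open>E\<close> in which \<open>Drs\<close> has a constant
  triangular matrix \<open>A\<close> over \<open>R\<close> and \<open>P\<close> is diagonal with polar entries \<open>\<phi>\<^sub>j\<close>, and \<open>A\<close> commutes with
  this diagonal matrix. After shifts by powers of \<open>x\<close> the diagonal entries of \<open>A\<close> have values in \<open>\<tau>\<close> at
  \<open>t = 0\<close> (lemma \<open>adapted_basis_exists\<close>). For each \<open>l\<close> the part of \<open>\<phi>\<^sub>j\<close> divisible by \<open>t\<close> is removed by
  the gauge transformation with the exponential of a primitive of it, a finite sum modulo \<open>t\<^sup>l\<^sup>+\<^sup>1\<close>
  (lemma \<open>gauge_exists\<close>). In the twisted basis of \<open>E|\<^sub>l\<close> so obtained, \<open>D|\<^sub>l\<close> has the matrix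
  \<open>A + diag (\<phi>\<^sub>j(0))\<close> (lemma \<open>D_vec\<close>). There are three more ingredients.

  The polar part of a logarithmic decomposition over \<open>C((x))\<close> is determined by the connection: if
  \<open>(D - c - f) v\<close> is an eigenvector of \<open>P\<close> for the polar part \<open>f\<close> (or zero), then so is \<open>v\<close>. This is
  proved in coordinates over \<open>C((x\<^sub>s))\<close> and comes from the fact that an irregular connection of rank one
  has no horizontal section (lemma \<open>log_decomposition_alg_eigenspace\<close>). Hence \<open>P_red l\<close> is
  \<open>diag (\<phi>\<^sub>j(0))\<close> in the twisted basis, and \<open>Drs_red l\<close> has the matrix \<open>A\<close> (lemma \<open>Drs_red_vec\<close>).

  A Deligne-Manin lattice is unique, hence it is the span over \<open>R\<^sub>l[[x]]\<close> of the twisted basis (lemma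
  \<open>Deligne_Manin_lattice_eq\<close>).

  Finally, \<open>R[[x]]\<close> is complete for the \<open>t\<close>-adic topology. So the limit of these lattices, localized at
  \<open>x\<close>, consists of the families of vectors which have in the twisted bases the same coordinates
  \<open>a\<^sub>j \<in> R((x))\<close> for all \<open>l\<close>. It is free with the connection matrix \<open>A\<close>, just as \<open>(E, Drs)\<close>.
\<close>

section \<open>Modules, bases and direct sums\<close>

lemma ring_of_type_simps [simp]:
  "carrier ring_of_type_algebra = (UNIV :: 'k::comm_ring_1 set)"
  "x \<oplus>\<^bsub>ring_of_type_algebra\<^esub> y = x + (y :: 'k)"
  "x \<otimes>\<^bsub>ring_of_type_algebra\<^esub> y = x * (y :: 'k)"
  "\<zero>\<^bsub>ring_of_type_algebra\<^esub> = (0 :: 'k)"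
  "\<one>\<^bsub>ring_of_type_algebra\<^esub> = (1 :: 'k)"
  by (simp_all add: ring_of_type_algebra_def)

definition lincomb :: "('k::comm_ring_1, 'm) module \<Rightarrow> 'i set \<Rightarrow> ('i \<Rightarrow> 'm) \<Rightarrow> ('i \<Rightarrow> 'k) \<Rightarrow> 'm" where
  "lincomb M J b a = (\<Oplus>\<^bsub>M\<^esub>j\<in>J. a j \<odot>\<^bsub>M\<^esub> b j)"

text \<open>Bases are indexed by arbitrary finite sets, so that the bases of the summands of a direct sum can
  be put together without renumbering.\<close>

definition basis_on :: "('k::comm_ring_1, 'm) module \<Rightarrow> 'i set \<Rightarrow> ('i \<Rightarrow> 'm) \<Rightarrow> bool" where
  "basis_on M J b \<longleftrightarrow> finite J \<and> b \<in> J \<rightarrow> carrier M \<and>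
     (\<forall>v\<in>carrier M. \<exists>a. v = lincomb M J b a) \<and>
     (\<forall>a. lincomb M J b a = \<zero>\<^bsub>M\<^esub> \<longrightarrow> (\<forall>j\<in>J. a j = 0))"

locale type_module = fixes M :: "('k::comm_ring_1, 'm) module" (structure)
  assumes is_module: "is_module M"
begin

sublocale module ring_of_type_algebra M by (rule is_module)

lemma scale_closed [simp]: "v \<in> carrier M \<Longrightarrow> a \<odot> v \<in> carrier M"
  using smult_closed by simp

lemma scale_add_left: "v \<in> carrier M \<Longrightarrow> (a + b) \<odot> v = a \<odot> v \<oplus> b \<odot> v"
  using smult_l_distr[of a b v] by simp

lemma scale_add_right: "v \<in> carrier M \<Longrightarrow> w \<in> carrier M \<Longrightarrow>
    a \<odot> (v \<oplus> w) = a \<odot> v \<oplus> a \<odot> w"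
  using smult_r_distr[of a v w] by simp

lemma scale_mult: "v \<in> carrier M \<Longrightarrow> (a * b) \<odot> v = a \<odot> (b \<odot> v)"
  using smult_assoc1[of a b v] by simp

lemma scale_one [simp]: "v \<in> carrier M \<Longrightarrow> 1 \<odot> v = v"
  using smult_one by simp

lemma scale_zero_left [simp]: "v \<in> carrier M \<Longrightarrow> 0 \<odot> v = \<zero>"
  using smult_l_null by simp

lemma scale_zero_right [simp]: "a \<odot> \<zero> = \<zero>"
  using smult_r_null[of a] by simp

lemma scale_minus_left: "v \<in> carrier M \<Longrightarrow> (- a) \<odot> v = \<ominus> (a \<odot> v)"
  by (metis M.minus_equality scale_add_left scale_closed scale_zero_left add.left_inverse)

lemma minus_eq_zeroD: "v \<in> carrier M \<Longrightarrow> w \<in> carrier M \<Longrightarrow> v \<ominus> w = \<zero> \<Longrightarrow> v = w"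
  unfolding a_minus_def by (metis M.a_inv_closed M.minus_equality M.minus_minus)

lemma minus_self: "v \<in> carrier M \<Longrightarrow> v \<ominus> v = \<zero>"
  by (simp add: a_minus_def M.r_neg)

lemma lincomb_closed [simp]: "b \<in> J \<rightarrow> carrier M \<Longrightarrow> lincomb M J b a \<in> carrier M"
  unfolding lincomb_def by (intro finsum_closed) auto

lemma lincomb_cong: "b \<in> J \<rightarrow> carrier M \<Longrightarrow> (\<And>j. j \<in> J \<Longrightarrow> a j = a' j) \<Longrightarrow>
    lincomb M J b a = lincomb M J b a'"
  unfolding lincomb_def by (intro finsum_cong') auto

lemma lincomb_add: "b \<in> J \<rightarrow> carrier M \<Longrightarrow>
    lincomb M J b a \<oplus> lincomb M J b a' = lincomb M J b (\<lambda>j. a j + a' j)"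
proof -
  assume b: "b \<in> J \<rightarrow> carrier M"
  have "lincomb M J b (\<lambda>j. a j + a' j) = (\<Oplus>j\<in>J. a j \<odot> b j \<oplus> a' j \<odot> b j)"
    unfolding lincomb_def using b by (intro finsum_cong') (auto simp: scale_add_left Pi_iff)
  also have "\<dots> = lincomb M J b a \<oplus> lincomb M J b a'"
    unfolding lincomb_def using b by (intro finsum_addf) auto
  finally show ?thesis by simp
qed

lemma lincomb_scale: "finite J \<Longrightarrow> b \<in> J \<rightarrow> carrier M \<Longrightarrow>
    f \<odot> lincomb M J b a = lincomb M J b (\<lambda>j. f * a j)"
  unfolding lincomb_def
  by (subst finsum_smult_ldistr) (auto simp: scale_mult Pi_iff intro!: finsum_cong')

lemma lincomb_zero: "b \<in> J \<rightarrow> carrier M \<Longrightarrow> (\<And>j. j \<in> J \<Longrightarrow> a j = 0) \<Longrightarrow> lincomb M J b a = \<zero>"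
  unfolding lincomb_def by (intro add.finprod_one_eqI) (auto simp: Pi_iff)

lemma lincomb_minus: "b \<in> J \<rightarrow> carrier M \<Longrightarrow> \<ominus> lincomb M J b a = lincomb M J b (\<lambda>j. - a j)"
  by (rule M.minus_equality) (simp_all add: lincomb_add lincomb_zero)

lemma lincomb_diff: "b \<in> J \<rightarrow> carrier M \<Longrightarrow>
    lincomb M J b a \<ominus> lincomb M J b a' = lincomb M J b (\<lambda>j. a j - a' j)"
  by (simp add: a_minus_def lincomb_minus lincomb_add)

lemma lincomb_single: "finite J \<Longrightarrow> b \<in> J \<rightarrow> carrier M \<Longrightarrow> j \<in> J \<Longrightarrow>
    lincomb M J b (\<lambda>i. if i = j then f else 0) = f \<odot> b j"
proof -
  assume "finite J" "b \<in> J \<rightarrow> carrier M" "j \<in> J"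
  hence "lincomb M J b (\<lambda>i. if i = j then f else 0)
      = (\<Oplus>i\<in>J. if j = i then f \<odot> b i else \<zero>)"
    unfolding lincomb_def by (intro finsum_cong') (auto simp: Pi_iff)
  also have "\<dots> = f \<odot> b j"
    using \<open>finite J\<close> \<open>j \<in> J\<close> \<open>b \<in> _\<close> by (intro M.add.finprod_singleton) (auto simp: Pi_iff)
  finally show ?thesis .
qed

lemma lincomb_sum:
  assumes b: "b \<in> J \<rightarrow> carrier M" and "finite I"
  shows "(\<Oplus>i\<in>I. lincomb M J b (a i)) = lincomb M J b (\<lambda>j. \<Sum>i\<in>I. a i j)"
  using \<open>finite I\<close>
proof induction
  case empty
  show ?case using b by (simp add: lincomb_zero)
next
  case (insert x I)
  hence "(\<Oplus>i\<in>insert x I. lincomb M J b (a i))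
      = lincomb M J b (a x) \<oplus> (\<Oplus>i\<in>I. lincomb M J b (a i))"
    using b by (intro finsum_insert) auto
  thus ?case using insert b by (simp add: lincomb_add)
qed

lemma additive_finsum:
  assumes T: "T \<in> carrier M \<rightarrow> carrier M"
    and add: "\<And>v w. v \<in> carrier M \<Longrightarrow> w \<in> carrier M \<Longrightarrow> T (v \<oplus> w) = T v \<oplus> T w"
    and "finite I" and v: "v \<in> I \<rightarrow> carrier M"
  shows "T (\<Oplus>i\<in>I. v i) = (\<Oplus>i\<in>I. T (v i))"
  using \<open>finite I\<close> v
proof induction
  case empty
  have "T \<zero> = T \<zero> \<oplus> T \<zero>" using add[of "\<zero>" "\<zero>"] by simp
  moreover have "T \<zero> \<in> carrier M" using T by auto
  ultimately have "T \<zero> = \<zero>" by (metis M.add.r_cancel_one')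
  thus ?case by simp
next
  case (insert x I)
  have "T (\<Oplus>i\<in>insert x I. v i) = T (v x \<oplus> (\<Oplus>i\<in>I. v i))"
    using insert by (subst finsum_insert) auto
  also have "\<dots> = T (v x) \<oplus> (\<Oplus>i\<in>I. T (v i))"
    using insert by (subst add) auto
  also have "\<dots> = (\<Oplus>i\<in>insert x I. T (v i))"
    using insert T by (subst finsum_insert) (auto simp: Pi_iff)
  finally show ?case .
qed

text \<open>
  In the coordinates of a basis a connection is the derivation plus a matrix. This moves all later
  computations into the coefficient ring.
\<close>

lemma connection_lincomb:
  assumes T: "T \<in> carrier M \<rightarrow> carrier M"
    and add: "\<And>v w. v \<in> carrier M \<Longrightarrow> w \<in> carrier M \<Longrightarrow> T (v \<oplus> w) = T v \<oplus> T w"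
    and leib: "\<And>f v. v \<in> carrier M \<Longrightarrow> T (f \<odot> v) = \<delta> f \<odot> v \<oplus> f \<odot> T v"
    and J: "finite J" and b: "b \<in> J \<rightarrow> carrier M"
    and A: "\<And>i. i \<in> J \<Longrightarrow> T (b i) = lincomb M J b (\<lambda>j. A j i)"
  shows "T (lincomb M J b a) = lincomb M J b (\<lambda>j. \<delta> (a j) + (\<Sum>i\<in>J. A j i * a i))"
proof -
  have "T (lincomb M J b a) = (\<Oplus>i\<in>J. T (a i \<odot> b i))"
    unfolding lincomb_def using T add J b by (intro additive_finsum) auto
  also have "\<dots> = (\<Oplus>i\<in>J. lincomb M J b (\<lambda>j. (if j = i then \<delta> (a i) else 0) + A j i * a i))"
  proof (intro finsum_cong' refl)
    fix i assume i: "i \<in> J"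
    have "T (a i \<odot> b i) = \<delta> (a i) \<odot> b i \<oplus> a i \<odot> lincomb M J b (\<lambda>j. A j i)"
      using i b by (subst leib) (auto simp: A)
    also have "\<dots> = lincomb M J b (\<lambda>j. (if j = i then \<delta> (a i) else 0) + A j i * a i)"
      using i b J by (subst lincomb_single[symmetric, of J]) (auto simp: lincomb_scale lincomb_add mult.commute)
    finally show "T (a i \<odot> b i) = lincomb M J b (\<lambda>j. (if j = i then \<delta> (a i) else 0) + A j i * a i)" .
  qed (use b in auto)
  also have "\<dots> = lincomb M J b (\<lambda>j. \<Sum>i\<in>J. (if j = i then \<delta> (a i) else 0) + A j i * a i)"
    using b J by (rule lincomb_sum)
  also have "\<dots> = lincomb M J b (\<lambda>j. \<delta> (a j) + (\<Sum>i\<in>J. A j i * a i))"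
    using b J by (intro lincomb_cong) (auto simp: sum.distrib sum.delta)
  finally show ?thesis .
qed

lemma is_basis_imp_basis_on:
  assumes "is_basis M n e"
  shows "basis_on M {..<n} e"
proof -
  have e: "e \<in> {..<n} \<rightarrow> carrier M" using assms by (simp add: is_basis_def)
  have "a j = 0" if "lincomb M {..<n} e a = \<zero>" "j < n" for a j
  proof -
    have ex1: "\<exists>!a. a \<in> {..<n} \<rightarrow>\<^sub>E UNIV \<and> \<zero> = lincomb M {..<n} e a"
      using assms unfolding is_basis_def lincomb_def by simp
    have "lincomb M {..<n} e (restrict a {..<n}) = \<zero>"
      using that e by (subst lincomb_cong[of _ _ _ a]) auto
    moreover have "lincomb M {..<n} e (\<lambda>i\<in>{..<n}. 0) = \<zero>"
      using e by (intro lincomb_zero) auto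
    ultimately have "restrict a {..<n} = (\<lambda>i\<in>{..<n}. 0)"
      using ex1 by (metis PiE_restrict restrict_PiE UNIV_I restrict_PiE_iff)
    thus "a j = 0" using \<open>j < n\<close> by (metis lessThan_iff restrict_apply')
  qed
  moreover have "\<exists>a. v = lincomb M {..<n} e a" if "v \<in> carrier M" for v
    using assms that unfolding is_basis_def lincomb_def by blast
  ultimately show ?thesis using e unfolding basis_on_def by auto
qed

lemma basis_on_unique:
  assumes "basis_on M J b" "lincomb M J b a = lincomb M J b a'" "j \<in> J"
  shows "a j = a' j"
proof -
  have b: "b \<in> J \<rightarrow> carrier M" using assms by (simp add: basis_on_def)
  have "lincomb M J b (\<lambda>j. a j - a' j) = \<zero>"
    using b assms(2) by (simp add: minus_self flip: lincomb_diff)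
  thus ?thesis using assms unfolding basis_on_def by fastforce
qed

lemma submodule_type_module: "is_submodule H M \<Longrightarrow> type_module (M\<lparr>carrier := H\<rparr>)"
  by (intro type_module.intro submodule.submodule_is_module is_module)

lemma submodule_subset: "is_submodule H M \<Longrightarrow> H \<subseteq> carrier M"
  using submoduleE(1) by blast

lemma submodule_zero: "is_submodule H M \<Longrightarrow> \<zero> \<in> H"
  using subgroup.one_closed[OF submodule.axioms(1)] by fastforce

lemma submodule_diff_closed: "is_submodule H M \<Longrightarrow> v \<in> H \<Longrightarrow> w \<in> H \<Longrightarrow> v \<ominus> w \<in> H"
  using submoduleE(3,5) unfolding a_minus_def by blast

lemma submodule_scale_closed: "is_submodule H M \<Longrightarrow> v \<in> H \<Longrightarrow> a \<odot> v \<in> H"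
  using submoduleE(4) by auto

text \<open>Finite sums are defined by folding over the carrier, so that a sum formed in a submodule has to be
  compared with the same sum in the module.\<close>

lemma finsum_submodule:
  assumes H: "is_submodule H M" and "finite I" and v: "v \<in> I \<rightarrow> H"
  shows "finsum (M\<lparr>carrier := H\<rparr>) v I = finsum M v I"
  using assms(2,3)
proof induction
  case empty
  show ?case using submodule_zero[OF H] by (simp add: finsum_def finprod_def)
next
  case (insert x I)
  interpret H: type_module "M\<lparr>carrier := H\<rparr>" by (rule submodule_type_module[OF H])
  have "finsum (M\<lparr>carrier := H\<rparr>) v (insert x I) = v x \<oplus> finsum (M\<lparr>carrier := H\<rparr>) v I"
    using insert H.finsum_insert[of I x v] by (auto simp: Pi_iff)
  moreover have "finsum M v (insert x I) = v x \<oplus> finsum M v I"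
    using insert submodule_subset[OF H] by (intro finsum_insert) (auto simp: Pi_iff)
  ultimately show ?case using insert by auto
qed

lemma lincomb_submodule:
  assumes "is_submodule H M" "finite J" "b \<in> J \<rightarrow> H"
  shows "lincomb (M\<lparr>carrier := H\<rparr>) J b a = lincomb M J b a"
  unfolding lincomb_def using finsum_submodule[OF assms(1,2), of "\<lambda>j. a j \<odot> b j"] assms
  by (auto simp: submodule_scale_closed Pi_iff)

lemma finsum_Sigma:
  assumes "finite T" "\<And>\<rho>. \<rho> \<in> T \<Longrightarrow> finite (J \<rho>)"
    and v: "\<And>\<rho> k. \<rho> \<in> T \<Longrightarrow> k \<in> J \<rho> \<Longrightarrow> v (\<rho>, k) \<in> carrier M"
  shows "finsum M v (Sigma T J) = (\<Oplus>\<rho>\<in>T. \<Oplus>k\<in>J \<rho>. v (\<rho>, k))"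
  using assms
proof (induction T rule: finite_induct)
  case (insert x T)
  have *: "Sigma (insert x T) J = Pair x ` J x \<union> Sigma T J" by auto
  have "finsum M v (Sigma (insert x T) J) = finsum M v (Pair x ` J x) \<oplus> finsum M v (Sigma T J)"
    unfolding * using insert by (intro M.add.finprod_Un_disjoint) auto
  also have "finsum M v (Pair x ` J x) = (\<Oplus>k\<in>J x. v (x, k))"
    using insert by (intro M.add.finprod_reindex) (auto simp: inj_on_def)
  also have "\<dots> \<oplus> finsum M v (Sigma T J) = (\<Oplus>\<rho>\<in>insert x T. \<Oplus>k\<in>J \<rho>. v (\<rho>, k))"
    using insert by (subst finsum_insert) (auto intro!: finsum_closed)
  finally show ?case .
qed simp

lemma direct_sum_zero:
  assumes "internal_direct_sum M T H" "w \<in> (\<Pi> \<rho>\<in>T. H \<rho>)" "(\<Oplus>\<rho>\<in>T. w \<rho>) = \<zero>" "\<rho> \<in> T"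
  shows "w \<rho> = \<zero>"
proof -
  have sub: "is_submodule (H \<rho>) M" if "\<rho> \<in> T" for \<rho>
    using assms(1) that by (auto simp: internal_direct_sum_def)
  have ex1: "\<exists>!w. w \<in> (\<Pi>\<^sub>E i\<in>T. H i) \<and> \<zero> = (\<Oplus>i\<in>T. w i)"
    using assms(1) by (simp add: internal_direct_sum_def)
  have z: "\<zero> \<in> H \<rho>" if "\<rho> \<in> T" for \<rho>
    by (rule submodule_zero[OF sub[OF that]])
  have "(\<Oplus>i\<in>T. restrict w T i) = \<zero>"
    using assms(2,3) submodule_subset[OF sub]
    by (subst M.add.finprod_cong'[of T T w]) (auto simp: Pi_iff)
  moreover have "(\<Oplus>i\<in>T. (\<lambda>i\<in>T. \<zero>) i) = \<zero>"
    by (intro M.add.finprod_one_eqI) auto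
  ultimately have "restrict w T = (\<lambda>i\<in>T. \<zero>)"
    using ex1 assms(2) z by (metis (no_types, lifting) restrict_PiE_iff PiE_I PiE_restrict Pi_iff)
  thus ?thesis using \<open>\<rho> \<in> T\<close> by (metis restrict_apply')
qed

lemma direct_sum_obtain:
  assumes "internal_direct_sum M T H" "v \<in> carrier M"
  obtains w where "w \<in> (\<Pi> \<rho>\<in>T. H \<rho>)" "v = (\<Oplus>\<rho>\<in>T. w \<rho>)"
proof -
  obtain w where "w \<in> (\<Pi>\<^sub>E i\<in>T. H i) \<and> v = (\<Oplus>i\<in>T. w i)"
    using assms unfolding internal_direct_sum_def by blast
  thus ?thesis by (intro that[of w]) (auto simp: Pi_iff PiE_iff)
qed

lemma basis_on_Sigma:
  assumes ds: "internal_direct_sum M T H"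
    and b: "\<And>\<rho>. \<rho> \<in> T \<Longrightarrow> basis_on (M\<lparr>carrier := H \<rho>\<rparr>) (J \<rho>) (b \<rho>)"
  shows "basis_on M (Sigma T J) (\<lambda>(\<rho>, k). b \<rho> k)"
proof -
  have T: "finite T" and sub: "\<And>\<rho>. \<rho> \<in> T \<Longrightarrow> is_submodule (H \<rho>) M"
    using ds by (auto simp: internal_direct_sum_def)
  have J: "finite (J \<rho>)" and bH: "b \<rho> \<in> J \<rho> \<rightarrow> H \<rho>" if "\<rho> \<in> T" for \<rho>
    using b[OF that] by (auto simp: basis_on_def)
  have bM: "b \<rho> k \<in> carrier M" if "\<rho> \<in> T" "k \<in> J \<rho>" for \<rho> k
    using that bH submodule_subset[OF sub] by (auto simp: Pi_iff)
  have sum: "lincomb M (Sigma T J) (\<lambda>(\<rho>, k). b \<rho> k) a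
      = (\<Oplus>\<rho>\<in>T. lincomb M (J \<rho>) (b \<rho>) (\<lambda>k. a (\<rho>, k)))" for a
    unfolding lincomb_def using T J bM by (subst finsum_Sigma) auto
  have lH: "lincomb M (J \<rho>) (b \<rho>) a = lincomb (M\<lparr>carrier := H \<rho>\<rparr>) (J \<rho>) (b \<rho>) a"
    "lincomb M (J \<rho>) (b \<rho>) a \<in> H \<rho>" if "\<rho> \<in> T" for \<rho> a
  proof -
    show 1: "lincomb M (J \<rho>) (b \<rho>) a = lincomb (M\<lparr>carrier := H \<rho>\<rparr>) (J \<rho>) (b \<rho>) a"
      using lincomb_submodule[OF sub J bH] that by simp
    interpret H: type_module "M\<lparr>carrier := H \<rho>\<rparr>" by (rule submodule_type_module[OF sub[OF that]])
    show "lincomb M (J \<rho>) (b \<rho>) a \<in> H \<rho>"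
      unfolding 1 using H.lincomb_closed[of "b \<rho>" "J \<rho>" a] bH[OF that] by simp
  qed
  have "a (\<rho>, k) = 0" if "lincomb M (Sigma T J) (\<lambda>(\<rho>, k). b \<rho> k) a = \<zero>" "\<rho> \<in> T" "k \<in> J \<rho>" for a \<rho> k
  proof -
    have "lincomb M (J \<rho>) (b \<rho>) (\<lambda>k. a (\<rho>, k)) = \<zero>"
      using that lH by (intro direct_sum_zero[OF ds, of "\<lambda>\<rho>. lincomb M (J \<rho>) (b \<rho>) (\<lambda>k. a (\<rho>, k))" \<rho>])
        (auto simp: sum)
    thus ?thesis using b[OF that(2)] that lH(1) unfolding basis_on_def by fastforce
  qed
  moreover have "\<exists>a. v = lincomb M (Sigma T J) (\<lambda>(\<rho>, k). b \<rho> k) a" if v: "v \<in> carrier M" for v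
  proof -
    obtain w where w: "w \<in> (\<Pi> \<rho>\<in>T. H \<rho>)" "v = (\<Oplus>\<rho>\<in>T. w \<rho>)"
      using direct_sum_obtain[OF ds v] by blast
    have "\<forall>\<rho>. \<exists>a. \<rho> \<in> T \<longrightarrow> w \<rho> = lincomb (M\<lparr>carrier := H \<rho>\<rparr>) (J \<rho>) (b \<rho>) a"
      using b w(1) unfolding basis_on_def by (auto simp: Pi_iff)
    then obtain a where a: "\<And>\<rho>. \<rho> \<in> T \<Longrightarrow> w \<rho> = lincomb (M\<lparr>carrier := H \<rho>\<rparr>) (J \<rho>) (b \<rho>) (a \<rho>)"
      by metis
    have "v = (\<Oplus>\<rho>\<in>T. lincomb M (J \<rho>) (b \<rho>) (\<lambda>k. a \<rho> k))"
      unfolding w(2)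
    proof (intro M.add.finprod_cong' refl)
      fix \<rho> assume "\<rho> \<in> T"
      thus "w \<rho> = lincomb M (J \<rho>) (b \<rho>) (\<lambda>k. a \<rho> k)" using a lH(1) by simp
    qed (auto intro!: lincomb_closed bM)
    also have "\<dots> = lincomb M (Sigma T J) (\<lambda>(\<rho>, k). b \<rho> k) (\<lambda>(\<rho>, k). a \<rho> k)"
      by (simp add: sum)
    finally show ?thesis by blast
  qed
  ultimately show ?thesis
    using T J bM unfolding basis_on_def by auto
qed

end

section \<open>Laurent series and polar parts\<close>

lemma theta_fls_nth [simp]: "fls_nth (theta_fls f) n = of_int n * fls_nth f n"
  by (simp add: theta_fls_def fls_X_times_conv_shift)

lemma theta_fls_add: "theta_fls (f + g) = theta_fls f + theta_fls g"
  by (simp add: theta_fls_def algebra_simps)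

lemma theta_fls_diff: "theta_fls (f - g) = theta_fls f - theta_fls g"
  by (simp add: theta_fls_def algebra_simps)

lemma theta_fls_mult: "theta_fls (f * g) = theta_fls f * g + f * theta_fls g"
  by (simp add: theta_fls_def algebra_simps)

lemma theta_fls_zero [simp]: "theta_fls 0 = 0"
  by (simp add: theta_fls_def)

lemma theta_fls_const [simp]: "theta_fls (fls_const c) = 0"
  by (simp add: theta_fls_def)

lemma fls_nth_sum: "fls_nth (\<Sum>i\<in>I. f i) n = (\<Sum>i\<in>I. fls_nth (f i) n)"
  by (induction I rule: infinite_finite_induct) simp_all

lemma theta_fls_sum: "theta_fls (\<Sum>i\<in>I. f i) = (\<Sum>i\<in>I. theta_fls (f i))"
  by (induction I rule: infinite_finite_induct) (simp_all add: theta_fls_add)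

lemma theta_fls_power_Suc:
  "theta_fls (f ^ Suc n) = of_nat (Suc n) * f ^ n * theta_fls (f :: 'r::comm_ring_1 fls)"
proof (induction n)
  case (Suc n)
  have "theta_fls (f ^ Suc (Suc n)) = theta_fls f * f ^ Suc n + f * theta_fls (f ^ Suc n)"
    by (simp add: theta_fls_mult)
  thus ?case unfolding Suc.IH by (simp add: algebra_simps)
qed simp

lemma theta_fls_X_intpow: "theta_fls (fls_X_intpow k) = fls_const (of_int k) * fls_X_intpow k"
  by (rule fls_eqI) simp

text \<open>
  The pole of \<open>f\<close> is decisive: the leading term of \<open>f * a\<close> has a smaller exponent than all terms of
  \<open>c * a\<close> and of a derivative of \<open>a\<close>, so nothing can cancel it. Of the derivation only the property
  that it creates no new lower terms enters, because the lemma is applied over ramified extensions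
  \<open>C((x\<^sub>s))\<close>.
\<close>

lemma irregular_no_horizontal:
  fixes a f \<delta>a :: "'k::idom fls"
  assumes f: "f \<in> polar_parts" "f \<noteq> 0"
    and \<delta>a: "\<And>n. n < fls_subdegree a \<Longrightarrow> fls_nth \<delta>a n = 0"
    and eq: "\<delta>a + (fls_const c + f) * a = 0"
  shows "a = 0"
proof (rule ccontr)
  assume a: "a \<noteq> 0"
  have neg: "fls_subdegree f < 0"
    using f nth_fls_subdegree_nonzero[of f] unfolding polar_parts_def mem_Collect_eq by (meson not_le)
  have "fls_nth (f * a) (fls_subdegree f + fls_subdegree a)
      = fls_nth f (fls_subdegree f) * fls_nth a (fls_subdegree a)"
    by (simp add: fls_times_nth(1))
  moreover have "fls_nth (\<delta>a + (fls_const c + f) * a) (fls_subdegree f + fls_subdegree a)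
      = fls_nth (f * a) (fls_subdegree f + fls_subdegree a)"
    using neg \<delta>a by (simp add: distrib_right)
  ultimately show False
    using eq a f(2) by (simp add: nth_fls_subdegree_nonzero)
qed

section \<open>Congruences modulo powers of \<open>t\<close>\<close>

definition t_power :: "nat \<Rightarrow> 'c::comm_ring_1 fps fls" where
  "t_power m = fls_const (fps_X ^ m)"

lemma t_power_power: "t_power 1 ^ m = t_power m"
  by (simp add: t_power_def fls_const_power)

lemma t_power_dvd_iff:
  "t_power m dvd a \<longleftrightarrow> (\<forall>n. \<forall>k<m. fps_nth (fls_nth a n) k = 0)" for a :: "'c::comm_ring_1 fps fls"
proof
  assume "t_power m dvd a"
  thus "\<forall>n. \<forall>k<m. fps_nth (fls_nth a n) k = 0" by (auto simp: t_power_def fps_X_power_mult_nth)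
next
  assume *: "\<forall>n. \<forall>k<m. fps_nth (fls_nth a n) k = 0"
  define b where "b = Abs_fls (\<lambda>n. fps_shift m (fls_nth a n))"
  have b: "fls_nth b n = fps_shift m (fls_nth a n)" for n
    unfolding b_def by (intro nth_Abs_fls_lower_bound[of "fls_subdegree a"]) auto
  have "a = t_power m * b"
    using * by (intro fls_eqI fps_ext) (auto simp: b t_power_def fps_X_power_mult_nth)
  thus "t_power m dvd a" by simp
qed

lemma t_power_dvd_theta: "t_power m dvd a \<Longrightarrow> t_power m dvd theta_fls a"
  by (simp add: t_power_dvd_iff fps_of_int[symmetric] del: fps_of_int)

lemma t_power_dvd_all_imp_zero:
  assumes "\<And>l. t_power (Suc l) dvd a"
  shows "a = (0 :: 'c::comm_ring_1 fps fls)"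
proof (intro fls_eqI fps_ext)
  fix n k
  show "fps_nth (fls_nth a n) k = fps_nth (fls_nth 0 n) k"
    using assms[of k] by (simp add: t_power_dvd_iff)
qed

definition t_coeff :: "nat \<Rightarrow> 'c::comm_ring_1 fps fls \<Rightarrow> 'c fls" where
  "t_coeff k a = Abs_fls (\<lambda>n. fps_nth (fls_nth a n) k)"

lemma fls_nth_t_coeff [simp]: "fls_nth (t_coeff k a) n = fps_nth (fls_nth a n) k"
  unfolding t_coeff_def by (intro nth_Abs_fls_lower_bound[of "fls_subdegree a"]) auto

text \<open>Modulo \<open>t\<^sup>l\<^sup>+\<^sup>1\<close> the powers \<open>1, t, \<dots>, t\<^sup>l\<close> generate \<open>R((x))\<close> over \<open>C((x))\<close>. Hence statements about a
  reduction which are linear over \<open>C((x))\<close> have to be checked only on coefficients that do not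
  involve \<open>x\<close>.\<close>

lemma t_expansion:
  "t_power (Suc l) dvd a - (\<Sum>k\<le>l. fls_map_const (t_coeff k a) * t_power k)"
  for a :: "'c::comm_ring_1 fps fls"
proof -
  have "fps_nth (fls_nth (\<Sum>k\<le>l. fls_map_const (t_coeff k a) * t_power k) n) m = fps_nth (fls_nth a n) m"
    if "m < Suc l" for n m
  proof -
    have "fps_nth (fls_nth (\<Sum>k\<le>l. fls_map_const (t_coeff k a) * t_power k) n) m
        = (\<Sum>k\<le>l. if m = k then fps_nth (fls_nth a n) k else 0)"
      unfolding fls_nth_sum fps_sum_nth by (intro sum.cong) (auto simp: t_power_def fls_nth_fls_map_const)
    thus ?thesis using that by (simp add: sum.delta)
  qed
  thus ?thesis by (simp add: t_power_dvd_iff)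
qed

lemma fls_map_const_simps:
  "fls_map_const (f + g) = fls_map_const f + fls_map_const g"
  "fls_map_const (fls_const c) = fls_const (fps_const c)"
  "fls_map_const (fls_X ^ n) = fls_X ^ n"
  "theta_fls (fls_map_const f) = fls_map_const (theta_fls f)"
  by (auto intro!: fls_eqI fps_ext simp: fls_nth_fls_map_const fls_X_power_conv_shift_1
      simp flip: fps_of_int)

lemma t_coeff_polar: "f \<in> polar_parts \<Longrightarrow> t_coeff k f \<in> polar_parts"
  by (simp add: polar_parts_def)

text \<open>
  A gauge transformation which removes from the polar part \<open>f\<close> everything divisible by \<open>t\<close>. Since \<open>f\<close>
  has no constant term in \<open>x\<close>, its part divisible by \<open>t\<close> has a \<open>\<theta>\<close>-primitive \<open>-g\<close>, which is again divisible
  by \<open>t\<close>, and \<open>exp g\<close> is the wanted transformation. Modulo \<open>t\<^sup>l\<^sup>+\<^sup>1\<close> the exponential series is the finite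
  sum \<open>u l\<close>. These sums need not converge in \<open>R((x))\<close>, as the pole orders of the powers of \<open>g\<close> grow.
\<close>

lemma gauge_exists:
  fixes f :: "'c::field_char_0 fps fls"
  assumes f: "f \<in> polar_parts"
  obtains u :: "nat \<Rightarrow> 'c fps fls" where
    "\<And>l. t_power (Suc l) dvd u (Suc l) - u l"
    "\<And>l. t_power (Suc l) dvd theta_fls (u l) + (f - fls_map_const (t_coeff 0 f)) * u l"
    "\<And>l. \<exists>u'. t_power (Suc l) dvd u l * u' - 1"
proof -
  define h where "h = fls_map_const (t_coeff 0 f) - f"
  have h: "fps_nth (fls_nth h n) 0 = 0" "n \<ge> 0 \<Longrightarrow> fls_nth h n = 0" for n
    using f by (auto simp: h_def fls_nth_fls_map_const polar_parts_def)
  \<comment> \<open>Division by the exponents; the exponent \<open>0\<close> does no harm, as there \<open>h\<close> vanishes.\<close>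
  define g where "g = Abs_fls (\<lambda>n. fps_const (inverse (of_int n)) * fls_nth h n)"
  have g: "fls_nth g n = fps_const (inverse (of_int n)) * fls_nth h n" for n
    unfolding g_def by (intro nth_Abs_fls_lower_bound[of "fls_subdegree h"]) auto
  have theta_g: "theta_fls g = h"
  proof (rule fls_eqI)
    fix n :: int
    have "of_int n = fps_const (of_int n :: 'c)" by (simp add: fps_of_int)
    hence "fls_nth (theta_fls g) n = fps_const (of_int n * inverse (of_int n)) * fls_nth h n"
      by (simp add: g mult.assoc[symmetric])
    thus "fls_nth (theta_fls g) n = fls_nth h n" using h(2)[of n] by (cases "n = 0") auto
  qed
  have "t_power 1 dvd g" unfolding t_power_dvd_iff by (auto simp: g h)
  then obtain g' where g': "g = t_power 1 * g'" by auto
  have g_pow: "t_power k dvd g ^ k" for k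
    by (simp only: g' power_mult_distrib t_power_power dvd_triv_left)
  define q where "q k = (fls_const (fps_const (inverse (fact k))) :: 'c fps fls)" for k
  have q_Suc: "of_nat (Suc k) * q (Suc k) = q k" for k
  proof -
    have "of_nat (Suc k) * q (Suc k) = fls_const (fps_const (of_nat (Suc k) * inverse (fact (Suc k))))"
      by (simp add: q_def fls_of_nat fls_const_mult_const fps_of_nat[symmetric] fps_const_mult[symmetric]
          del: fps_const_mult fps_of_nat of_nat_Suc)
    also have "of_nat (Suc k) * inverse (fact (Suc k)) = (inverse (fact k) :: 'c)"
      by (simp add: field_simps del: of_nat_Suc)
    finally show ?thesis by (simp add: q_def)
  qed
  define u where "u l = (\<Sum>k\<le>l. q k * g ^ k)" for l
  have 1: "t_power (Suc l) dvd u (Suc l) - u l" for l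
    unfolding u_def using g_pow[of "Suc l"] by (simp add: dvd_mult)
  have theta_u: "theta_fls (u (Suc l)) = h * u l" for l
  proof -
    have "theta_fls (u (Suc l)) = theta_fls (q 0) + (\<Sum>k\<le>l. theta_fls (q (Suc k) * g ^ Suc k))"
      unfolding u_def theta_fls_sum by (subst sum.atMost_Suc_shift) simp
    also have "\<dots> = (\<Sum>k\<le>l. (of_nat (Suc k) * q (Suc k)) * g ^ k * h)"
      by (simp only: theta_fls_mult theta_fls_power_Suc theta_g q_def theta_fls_const) (simp add: mult_ac)
    also have "\<dots> = h * u l"
      by (simp only: q_Suc) (simp add: u_def sum_distrib_left mult_ac)
    finally show ?thesis .
  qed
  have 2: "t_power (Suc l) dvd theta_fls (u l) + (f - fls_map_const (t_coeff 0 f)) * u l" for l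
  proof -
    have "theta_fls (u l) + (f - fls_map_const (t_coeff 0 f)) * u l = - theta_fls (u (Suc l) - u l)"
      by (simp add: theta_fls_diff theta_u h_def algebra_simps)
    thus ?thesis using t_power_dvd_theta[OF 1[of l]] by simp
  qed
  \<comment> \<open>A series congruent to \<open>1\<close> modulo \<open>t\<close> is inverted by a finite geometric sum.\<close>
  have 3: "\<exists>u'. t_power (Suc l) dvd u l * u' - 1" for l
  proof -
    have "t_power 1 dvd 1 - u l"
    proof -
      have "1 - u l = - (\<Sum>k\<in>{..l} - {0}. q k * g ^ k)"
        by (simp add: u_def sum_diff1 q_def)
      moreover have "t_power 1 dvd q k * g ^ k" if "k \<in> {..l} - {0}" for k
        using that \<open>t_power 1 dvd g\<close> by (intro dvd_mult dvd_trans[OF _ dvd_power]) auto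
      ultimately show ?thesis by (simp only: dvd_minus_iff) (rule dvd_sum)
    qed
    then obtain z where z: "1 - u l = t_power 1 * z" by auto
    have "u l * (\<Sum>k<Suc l. (1 - u l) ^ k) - 1 = - ((1 - u l) ^ Suc l)"
      using one_diff_power_eq[of "1 - u l" "Suc l"] by (simp add: algebra_simps)
    also have "\<dots> = t_power (Suc l) * - (z ^ Suc l)"
      unfolding z by (simp only: power_mult_distrib t_power_power mult_minus_right)
    finally show ?thesis by (metis dvd_triv_left)
  qed
  show thesis using that 1 2 3 by blast
qed

text \<open>Completeness of \<open>R[[x]]\<close>: the coefficients of \<open>t\<^sup>k\<close> are constant from the \<open>k\<close>-th term of the sequence on.\<close>

lemma fps_limit_t:
  fixes a :: "nat \<Rightarrow> 'c::comm_ring_1 fps fps"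
  assumes a: "\<And>l. t_power (Suc l) dvd fps_to_fls (a (Suc l)) - fps_to_fls (a l)"
  obtains b where "\<And>l. t_power (Suc l) dvd fps_to_fls b - fps_to_fls (a l)"
proof -
  define b where "b = Abs_fps (\<lambda>n. Abs_fps (\<lambda>k. fps_nth (fps_nth (a k) n) k))"
  have stable: "fps_nth (fps_nth (a (Suc l)) n) k = fps_nth (fps_nth (a l) n) k" if "k \<le> l" for l n k
    using a[of l, unfolded t_power_dvd_iff, rule_format, of k "int n"] that by simp
  have diag: "fps_nth (fps_nth (a (k + m)) n) k = fps_nth (fps_nth (a k) n) k" for m n k
    by (induction m) (simp_all add: stable)
  have "t_power (Suc l) dvd fps_to_fls b - fps_to_fls (a l)" for l
    unfolding t_power_dvd_iff
  proof (intro allI impI)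
    fix n :: int and k assume "k < Suc l"
    then obtain m where "l = k + m" using le_Suc_ex less_Suc_eq_le by blast
    thus "fps_nth (fls_nth (fps_to_fls b - fps_to_fls (a l)) n) k = 0"
      using diag[of k m "nat n"] by (simp add: b_def)
  qed
  thus thesis by (rule that)
qed

section \<open>Extension of scalars to ramified Laurent series\<close>

lemma fls_times_nth_finite:
  fixes f g :: "'c::comm_ring_1 fls"
  assumes S: "finite S" and z: "\<And>p. p \<notin> S \<Longrightarrow> fls_nth f p * fls_nth g (n - p) = 0"
  shows "fls_nth (f * g) n = (\<Sum>p\<in>S. fls_nth f p * fls_nth g (n - p))"
proof -
  have "fls_nth (f * g) n = (\<Sum>p=fls_subdegree f..n - fls_subdegree g. fls_nth f p * fls_nth g (n - p))"
    by (rule fls_times_nth(2))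
  also have "\<dots> = (\<Sum>p\<in>S \<union> {fls_subdegree f..n - fls_subdegree g}. fls_nth f p * fls_nth g (n - p))"
    using S by (intro sum.mono_neutral_left) (auto simp: not_le)
  also have "\<dots> = (\<Sum>p\<in>S. fls_nth f p * fls_nth g (n - p))"
    using S z by (intro sum.mono_neutral_right) auto
  finally show ?thesis .
qed

lemma xs_component_add:
  "s \<ge> 1 \<Longrightarrow> xs_component s (g + h) d = xs_component s g d + xs_component s h (d :: int)"
  for g :: "'c::comm_ring_1 fls"
  by (rule fls_eqI) (simp add: fls_nth_xs_component)

text \<open>The terms of the Cauchy product are sorted by the residue modulo \<open>s\<close> of the exponent of \<open>x\<^sub>s\<close> in the
  first factor: by division with remainder every exponent is \<open>s q + (k - j)\<close> for a unique \<open>j < s\<close>.\<close>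

lemma xs_component_mult:
  fixes g h :: "'c::comm_ring_1 fls" and i k :: int
  assumes s: "s \<ge> 1"
  shows "xs_component s (g * h) (k - i)
    = (\<Sum>j<s. xs_component s g (k - int j) * xs_component s h (int j - i))"
proof (rule fls_eqI)
  fix m
  define n where "n = int s * m + (k - i)"
  define K where "K = \<bar>fls_subdegree g\<bar> + \<bar>n - fls_subdegree h\<bar> + \<bar>k\<bar> + int s"
  define p where "p = (\<lambda>(j, q). int s * q + (k - int j))"
  define S where "S = {..<s} \<times> {-K..K}"
  have inj: "inj_on p S"
  proof (rule inj_onI, clarify)
    fix j q j' q' assume *: "(j, q) \<in> S" "(j', q') \<in> S" "p (j, q) = p (j', q')"
    have "int s * (q - q') = int j - int j'" using *(3) by (simp add: p_def algebra_simps)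
    moreover have "\<bar>int j - int j'\<bar> < int s" using *(1,2) by (auto simp: S_def)
    ultimately have "int s * \<bar>q - q'\<bar> < int s * 1" by (metis abs_mult abs_of_nat mult.right_neutral)
    hence "q = q'" by (simp only: mult_less_cancel_left) auto
    thus "j = j' \<and> q = q'" using \<open>int s * (q - q') = int j - int j'\<close> by simp
  qed
  have out: "fls_nth g (p (j, q)) * fls_nth h (n - p (j, q)) = 0" if "j < s" "q \<notin> {-K..K}" for j q
  proof -
    have "\<bar>q\<bar> \<le> int s * \<bar>q\<bar>" using s by (simp add: mult_le_cancel_right1)
    hence "\<bar>q\<bar> \<le> \<bar>int s * q\<bar>" by (simp add: abs_mult)
    hence "p (j, q) < fls_subdegree g \<or> n - p (j, q) < fls_subdegree h"
      using that by (auto simp: p_def K_def)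
    thus ?thesis by auto
  qed
  have surj: "\<exists>j q. j < s \<and> p' = p (j, q)" for p'
  proof (intro exI conjI)
    show "nat ((k - p') mod int s) < s" using s by (simp add: nat_less_iff)
    show "p' = p (nat ((k - p') mod int s), - ((k - p') div int s))"
    proof -
      have "int s * ((k - p') div int s) + (k - p') mod int s = k - p'" by simp
      moreover have "int (nat ((k - p') mod int s)) = (k - p') mod int s" using s by simp
      ultimately show ?thesis unfolding p_def prod.case mult_minus_right by linarith
    qed
  qed
  have "fls_nth (g * h) n = (\<Sum>p\<in>p ` S. fls_nth g p * fls_nth h (n - p))"
  proof (rule fls_times_nth_finite)
    fix p' assume "p' \<notin> p ` S"
    moreover obtain j q where "j < s" "p' = p (j, q)" using surj by blast
    ultimately have "q \<notin> {-K..K}" by (auto simp: S_def)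
    thus "fls_nth g p' * fls_nth h (n - p') = 0" using out \<open>j < s\<close> \<open>p' = p (j, q)\<close> by simp
  qed (simp add: S_def)
  also have "\<dots> = (\<Sum>(j, q)\<in>S. fls_nth g (p (j, q)) * fls_nth h (n - p (j, q)))"
    by (subst sum.reindex[OF inj]) (simp add: case_prod_unfold)
  also have "\<dots> = (\<Sum>j<s. \<Sum>q\<in>{-K..K}. fls_nth g (p (j, q)) * fls_nth h (n - p (j, q)))"
    unfolding S_def by (rule sum.cartesian_product[symmetric])
  also have "\<dots> = (\<Sum>j<s. fls_nth (xs_component s g (k - int j) * xs_component s h (int j - i)) m)"
  proof (intro sum.cong refl)
    fix j assume j: "j \<in> {..<s}"
    have eq: "fls_nth (xs_component s g (k - int j)) q * fls_nth (xs_component s h (int j - i)) (m - q)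
        = fls_nth g (p (j, q)) * fls_nth h (n - p (j, q))" for q
      using s by (simp add: fls_nth_xs_component p_def n_def algebra_simps)
    show "(\<Sum>q\<in>{-K..K}. fls_nth g (p (j, q)) * fls_nth h (n - p (j, q)))
        = fls_nth (xs_component s g (k - int j) * xs_component s h (int j - i)) m"
      using out j by (subst fls_times_nth_finite[of "{-K..K}"]) (auto simp: eq)
  qed
  also have "\<dots> = fls_nth (\<Sum>j<s. xs_component s g (k - int j) * xs_component s h (int j - i)) m"
    by (simp add: fls_nth_sum)
  finally show "fls_nth (xs_component s (g * h) (k - i)) m
      = fls_nth (\<Sum>j<s. xs_component s g (k - int j) * xs_component s h (int j - i)) m"
    using s by (simp add: fls_nth_xs_component n_def)
qed

lemma xs_component_compose_power:
  assumes "s \<ge> 1" "i < s" "k < s"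
  shows "xs_component s (fls_compose_power g s) (int k - int i) = (if i = k then g else 0)"
proof (rule fls_eqI)
  fix m
  have "int s dvd int s * m + (int k - int i) \<longleftrightarrow> int s dvd int k - int i"
    by (metis dvd_add_right_iff dvd_triv_left)
  also have "\<dots> \<longleftrightarrow> i = k"
    using assms dvd_imp_le_int[of "int k - int i" "int s"]
    by (cases "i = k") (auto simp: abs_if split: if_splits)
  finally show "fls_nth (xs_component s (fls_compose_power g s) (int k - int i)) m
      = fls_nth (if i = k then g else 0) m"
    using assms by (simp add: fls_nth_xs_component fls_nth_compose_power)
qed

text \<open>The derivation \<open>s\<^sup>-\<^sup>1 x\<^sub>s d/dx\<^sub>s\<close> of \<open>C((x\<^sub>s))\<close>, which extends \<open>\<theta>\<close>.\<close>

definition theta_xs :: "nat \<Rightarrow> 'c::field fls \<Rightarrow> 'c fls" where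
  "theta_xs s g = fls_const (1 / of_nat s) * theta_fls g"

text \<open>Both sides are \<open>(m + k/s)\<close> times the coefficient in question; this is what the Leibniz rule for the
  extended connection comes down to.\<close>

lemma xs_component_theta:
  fixes g :: "'c::field_char_0 fls"
  assumes "s \<ge> 1"
  shows "theta_fls (xs_component s g (int k - int i)) + fls_const (of_nat k / of_nat s) * xs_component s g (int k - int i)
    = xs_component s (theta_xs s g) (int k - int i) + xs_component s g (int k - int i) * fls_const (of_nat i / of_nat s)"
  by (rule fls_eqI) (use assms in \<open>simp add: fls_nth_xs_component theta_xs_def field_simps\<close>)

lemma (in type_module) add_exchange:
  assumes "x \<in> carrier M" "y \<in> carrier M" "z \<in> carrier M" "u \<in> carrier M" "w \<in> carrier M"
    and "x \<oplus>\<^bsub>M\<^esub> z = u \<oplus>\<^bsub>M\<^esub> w"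
  shows "x \<oplus>\<^bsub>M\<^esub> y \<oplus>\<^bsub>M\<^esub> z = u \<oplus>\<^bsub>M\<^esub> (y \<oplus>\<^bsub>M\<^esub> w)"
proof -
  have "x \<oplus>\<^bsub>M\<^esub> y \<oplus>\<^bsub>M\<^esub> z = y \<oplus>\<^bsub>M\<^esub> (x \<oplus>\<^bsub>M\<^esub> z)"
    using assms(1-3) by (simp add: M.a_ac)
  also have "\<dots> = u \<oplus>\<^bsub>M\<^esub> (y \<oplus>\<^bsub>M\<^esub> w)"
    unfolding assms(6) using assms(2,4,5) by (rule M.a_lcomm)
  finally show ?thesis .
qed

lemma (in type_module) diff_scale_additive:
  assumes T: "T \<in> carrier M \<rightarrow> carrier M"
    and add: "\<And>v w. v \<in> carrier M \<Longrightarrow> w \<in> carrier M \<Longrightarrow> T (v \<oplus> w) = T v \<oplus> T w"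
  shows "(\<lambda>u. T u \<ominus> f \<odot> u) \<in> carrier M \<rightarrow> carrier M"
    and "v \<in> carrier M \<Longrightarrow> w \<in> carrier M \<Longrightarrow> T (v \<oplus> w) \<ominus> f \<odot> (v \<oplus> w)
      = (T v \<ominus> f \<odot> v) \<oplus> (T w \<ominus> f \<odot> w)"
proof -
  show "(\<lambda>u. T u \<ominus> f \<odot> u) \<in> carrier M \<rightarrow> carrier M" using T by auto
  assume "v \<in> carrier M" "w \<in> carrier M"
  moreover from this have "T v \<in> carrier M" "T w \<in> carrier M" using T by auto
  ultimately show "T (v \<oplus> w) \<ominus> f \<odot> (v \<oplus> w)
      = (T v \<ominus> f \<odot> v) \<oplus> (T w \<ominus> f \<odot> w)"
    by (simp add: add scale_add_right a_minus_def M.minus_add M.a_ac)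
qed

lemma (in type_module) lincomb_basis_add:
  assumes "b \<in> J \<rightarrow> carrier M" "b' \<in> J \<rightarrow> carrier M"
  shows "lincomb M J (\<lambda>j. b j \<oplus> b' j) a = lincomb M J b a \<oplus> lincomb M J b' a"
proof -
  have "lincomb M J (\<lambda>j. b j \<oplus> b' j) a = (\<Oplus>j\<in>J. a j \<odot> b j \<oplus> a j \<odot> b' j)"
    unfolding lincomb_def using assms by (intro finsum_cong') (auto simp: scale_add_right Pi_iff)
  also have "\<dots> = lincomb M J b a \<oplus> lincomb M J b' a"
    unfolding lincomb_def using assms by (intro finsum_addf) auto
  finally show ?thesis .
qed

lemma (in type_module) lincomb_basis_scale:
  assumes "b \<in> J \<rightarrow> carrier M"
  shows "lincomb M J (\<lambda>j. f j \<odot> b j) a = lincomb M J b (\<lambda>j. a j * f j)"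
  unfolding lincomb_def using assms by (intro finsum_cong') (auto simp: scale_mult Pi_iff)

lemma base_change_simps:
  "carrier (base_change s M) = {..<s} \<rightarrow>\<^sub>E carrier M"
  "\<zero>\<^bsub>base_change s M\<^esub> = (\<lambda>i\<in>{..<s}. \<zero>\<^bsub>M\<^esub>)"
  "v \<oplus>\<^bsub>base_change s M\<^esub> w = (\<lambda>i\<in>{..<s}. v i \<oplus>\<^bsub>M\<^esub> w i)"
  "g \<odot>\<^bsub>base_change s M\<^esub> v
    = (\<lambda>k\<in>{..<s}. lincomb M {..<s} v (\<lambda>i. xs_component s g (int k - int i)))"
  by (simp_all add: base_change_def lincomb_def)

lemma base_change_module:
  fixes M :: "('c::field fls, 'm) module"
  assumes M: "is_module M" and s: "s \<ge> 1"
  shows "is_module (base_change s M)"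
proof -
  interpret type_module M by (rule type_module.intro[OF M])
  have ag: "abelian_group (base_change s M)"
  proof (rule abelian_groupI)
    fix x assume x: "x \<in> carrier (base_change s M)"
    show "\<exists>y\<in>carrier (base_change s M). y \<oplus>\<^bsub>base_change s M\<^esub> x = \<zero>\<^bsub>base_change s M\<^esub>"
      using x by (intro bexI[of _ "\<lambda>i\<in>{..<s}. \<ominus>\<^bsub>M\<^esub> x i"])
        (auto simp: base_change_simps PiE_iff M.l_neg intro!: restrict_ext)
  next
    fix x y z
    assume "x \<in> carrier (base_change s M)" "y \<in> carrier (base_change s M)" "z \<in> carrier (base_change s M)"
    thus "x \<oplus>\<^bsub>base_change s M\<^esub> y \<oplus>\<^bsub>base_change s M\<^esub> z = x \<oplus>\<^bsub>base_change s M\<^esub> (y \<oplus>\<^bsub>base_change s M\<^esub> z)"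
      by (auto simp: base_change_simps PiE_iff intro!: restrict_ext M.a_assoc)
  next
    fix x y
    assume "x \<in> carrier (base_change s M)" "y \<in> carrier (base_change s M)"
    thus "x \<oplus>\<^bsub>base_change s M\<^esub> y = y \<oplus>\<^bsub>base_change s M\<^esub> x"
      by (auto simp: base_change_simps PiE_iff intro!: restrict_ext M.a_comm)
  qed (auto simp: base_change_simps PiE_iff extensional_def)
  show ?thesis
  proof (rule moduleI, rule cring_from_type_algebra, rule ag)
    fix a b :: "'c fls" and x assume x: "x \<in> carrier (base_change s M)"
    hence xc: "x \<in> {..<s} \<rightarrow> carrier M" by (auto simp: base_change_simps)
    show "(a \<oplus>\<^bsub>ring_of_type_algebra\<^esub> b) \<odot>\<^bsub>base_change s M\<^esub> x
        = a \<odot>\<^bsub>base_change s M\<^esub> x \<oplus>\<^bsub>base_change s M\<^esub> b \<odot>\<^bsub>base_change s M\<^esub> x"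
      using xc s by (auto simp: base_change_simps xs_component_add lincomb_add intro!: restrict_ext)
    show "a \<odot>\<^bsub>base_change s M\<^esub> x \<in> carrier (base_change s M)"
      using xc by (auto simp: base_change_simps)
    show "(a \<otimes>\<^bsub>ring_of_type_algebra\<^esub> b) \<odot>\<^bsub>base_change s M\<^esub> x
        = a \<odot>\<^bsub>base_change s M\<^esub> (b \<odot>\<^bsub>base_change s M\<^esub> x)"
      unfolding base_change_simps(4)
    proof (rule restrict_ext)
      fix k assume "k \<in> {..<s}"
      have "lincomb M {..<s} (\<lambda>k\<in>{..<s}. lincomb M {..<s} x (\<lambda>i. xs_component s b (int k - int i)))
            (\<lambda>i. xs_component s a (int k - int i))
          = (\<Oplus>\<^bsub>M\<^esub>j\<in>{..<s}. lincomb M {..<s} x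
              (\<lambda>i. xs_component s a (int k - int j) * xs_component s b (int j - int i)))"
        unfolding lincomb_def[of M "{..<s}" "restrict _ _"]
        using xc by (intro finsum_cong') (auto simp: lincomb_scale)
      also have "\<dots> = lincomb M {..<s} x (\<lambda>i. xs_component s (a * b) (int k - int i))"
        using xc s by (subst lincomb_sum) (auto simp: xs_component_mult)
      finally show "lincomb M {..<s} x (\<lambda>i. xs_component s (a \<otimes>\<^bsub>ring_of_type_algebra\<^esub> b) (int k - int i))
          = lincomb M {..<s} (\<lambda>k\<in>{..<s}. lincomb M {..<s} x (\<lambda>i. xs_component s b (int k - int i)))
            (\<lambda>i. xs_component s a (int k - int i))" by simp
    qed
    have "lincomb M {..<s} x (\<lambda>i. xs_component s 1 (int k - int i)) = x k" if "k < s" for k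
    proof -
      have "lincomb M {..<s} x (\<lambda>i. xs_component s 1 (int k - int i))
          = lincomb M {..<s} x (\<lambda>i. if i = k then 1 else 0)"
        using s that xc xs_component_compose_power[of s _ k "1 :: 'c fls"]
        by (intro lincomb_cong) (auto simp del: One_nat_def)
      thus ?thesis using that xc by (simp add: lincomb_single Pi_iff)
    qed
    thus "\<one>\<^bsub>ring_of_type_algebra\<^esub> \<odot>\<^bsub>base_change s M\<^esub> x = x"
      using x by (auto simp: base_change_simps PiE_iff extensional_def fun_eq_iff)
    fix y assume "y \<in> carrier (base_change s M)"
    hence yc: "y \<in> {..<s} \<rightarrow> carrier M" by (auto simp: base_change_simps)
    have "lincomb M {..<s} (\<lambda>i\<in>{..<s}. x i \<oplus>\<^bsub>M\<^esub> y i) f = lincomb M {..<s} x f \<oplus>\<^bsub>M\<^esub> lincomb M {..<s} y f" for f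
    proof -
      have "lincomb M {..<s} (\<lambda>i\<in>{..<s}. x i \<oplus>\<^bsub>M\<^esub> y i) f = lincomb M {..<s} (\<lambda>i. x i \<oplus>\<^bsub>M\<^esub> y i) f"
        unfolding lincomb_def using xc yc by (intro finsum_cong') (auto simp: Pi_iff)
      thus ?thesis using lincomb_basis_add[OF xc yc] by simp
    qed
    thus "a \<odot>\<^bsub>base_change s M\<^esub> (x \<oplus>\<^bsub>base_change s M\<^esub> y)
        = a \<odot>\<^bsub>base_change s M\<^esub> x \<oplus>\<^bsub>base_change s M\<^esub> a \<odot>\<^bsub>base_change s M\<^esub> y"
      by (auto simp: base_change_simps intro!: restrict_ext)
  qed
qed

lemma base_change_Leibniz:
  fixes M :: "('c::field_char_0 fls, 'm) module"
  assumes M: "is_module M" and s: "s \<ge> 1"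
    and T: "T \<in> carrier M \<rightarrow> carrier M"
    and add: "\<And>v w. v \<in> carrier M \<Longrightarrow> w \<in> carrier M \<Longrightarrow> T (v \<oplus>\<^bsub>M\<^esub> w) = T v \<oplus>\<^bsub>M\<^esub> T w"
    and leib: "\<And>f v. v \<in> carrier M \<Longrightarrow> T (f \<odot>\<^bsub>M\<^esub> v) = theta_fls f \<odot>\<^bsub>M\<^esub> v \<oplus>\<^bsub>M\<^esub> f \<odot>\<^bsub>M\<^esub> T v"
  shows "base_change_connection s M T \<in> carrier (base_change s M) \<rightarrow> carrier (base_change s M)"
    and "\<And>v w. v \<in> carrier (base_change s M) \<Longrightarrow> w \<in> carrier (base_change s M) \<Longrightarrow>
      base_change_connection s M T (v \<oplus>\<^bsub>base_change s M\<^esub> w)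
      = base_change_connection s M T v \<oplus>\<^bsub>base_change s M\<^esub> base_change_connection s M T w"
    and "\<And>f v. v \<in> carrier (base_change s M) \<Longrightarrow>
      base_change_connection s M T (f \<odot>\<^bsub>base_change s M\<^esub> v)
      = theta_xs s f \<odot>\<^bsub>base_change s M\<^esub> v
        \<oplus>\<^bsub>base_change s M\<^esub> f \<odot>\<^bsub>base_change s M\<^esub> base_change_connection s M T v"
proof -
  interpret type_module M by (rule type_module.intro[OF M])
  show "base_change_connection s M T \<in> carrier (base_change s M) \<rightarrow> carrier (base_change s M)"
    using T by (auto simp: base_change_simps base_change_connection_def Pi_iff PiE_iff)
next
  interpret type_module M by (rule type_module.intro[OF M])
  fix v w assume "v \<in> carrier (base_change s M)" "w \<in> carrier (base_change s M)"
  thus "base_change_connection s M T (v \<oplus>\<^bsub>base_change s M\<^esub> w)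
      = base_change_connection s M T v \<oplus>\<^bsub>base_change s M\<^esub> base_change_connection s M T w"
    using T by (auto simp: base_change_simps base_change_connection_def PiE_iff Pi_iff add scale_add_right
      M.a_ac intro!: restrict_ext)
next
  interpret type_module M by (rule type_module.intro[OF M])
  fix f :: "'c fls" and v assume "v \<in> carrier (base_change s M)"
  hence v: "v \<in> {..<s} \<rightarrow> carrier M" by (auto simp: base_change_simps)
  have Tv: "(\<lambda>i. T (v i)) \<in> {..<s} \<rightarrow> carrier M" using T v by (auto simp: Pi_iff)
  define q where "q i = fls_const (of_nat i / of_nat s :: 'c)" for i
  define F where "F = (\<lambda>k i. xs_component s f (int k - int i))"
  have "T (lincomb M {..<s} v (F k)) \<oplus>\<^bsub>M\<^esub> q k \<odot>\<^bsub>M\<^esub> lincomb M {..<s} v (F k)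
      = lincomb M {..<s} v (\<lambda>i. xs_component s (theta_xs s f) (int k - int i))
        \<oplus>\<^bsub>M\<^esub> lincomb M {..<s} (\<lambda>i\<in>{..<s}. T (v i) \<oplus>\<^bsub>M\<^esub> q i \<odot>\<^bsub>M\<^esub> v i) (F k)" for k
  proof -
    have "T (lincomb M {..<s} v (F k)) = (\<Oplus>\<^bsub>M\<^esub>i\<in>{..<s}. T (F k i \<odot>\<^bsub>M\<^esub> v i))"
      unfolding lincomb_def using T add v by (intro additive_finsum) auto
    also have "\<dots> = (\<Oplus>\<^bsub>M\<^esub>i\<in>{..<s}. theta_fls (F k i) \<odot>\<^bsub>M\<^esub> v i \<oplus>\<^bsub>M\<^esub> F k i \<odot>\<^bsub>M\<^esub> T (v i))"
      using v Tv by (intro finsum_cong') (auto simp: leib Pi_iff)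
    also have "\<dots> = lincomb M {..<s} v (\<lambda>i. theta_fls (F k i)) \<oplus>\<^bsub>M\<^esub> lincomb M {..<s} (\<lambda>i. T (v i)) (F k)"
      unfolding lincomb_def using v Tv by (intro finsum_addf) (auto simp: Pi_iff)
    finally have 1: "T (lincomb M {..<s} v (F k)) = \<dots>" .
    have 2: "lincomb M {..<s} (\<lambda>i\<in>{..<s}. T (v i) \<oplus>\<^bsub>M\<^esub> q i \<odot>\<^bsub>M\<^esub> v i) (F k)
        = lincomb M {..<s} (\<lambda>i. T (v i) \<oplus>\<^bsub>M\<^esub> q i \<odot>\<^bsub>M\<^esub> v i) (F k)"
      unfolding lincomb_def using v Tv by (intro finsum_cong') (auto simp: Pi_iff)
    have 3: "\<dots> = lincomb M {..<s} (\<lambda>i. T (v i)) (F k) \<oplus>\<^bsub>M\<^esub> lincomb M {..<s} v (\<lambda>i. F k i * q i)"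
      using v Tv by (subst lincomb_basis_add) (auto simp: lincomb_basis_scale Pi_iff)
    have 4: "lincomb M {..<s} v (\<lambda>i. theta_fls (F k i)) \<oplus>\<^bsub>M\<^esub> q k \<odot>\<^bsub>M\<^esub> lincomb M {..<s} v (F k)
        = lincomb M {..<s} v (\<lambda>i. xs_component s (theta_xs s f) (int k - int i))
          \<oplus>\<^bsub>M\<^esub> lincomb M {..<s} v (\<lambda>i. F k i * q i)"
      using v s by (simp add: lincomb_scale lincomb_add F_def q_def xs_component_theta)
    show ?thesis unfolding 1 2 3 using v Tv by (intro add_exchange 4) auto
  qed
  thus "base_change_connection s M T (f \<odot>\<^bsub>base_change s M\<^esub> v)
      = theta_xs s f \<odot>\<^bsub>base_change s M\<^esub> v
        \<oplus>\<^bsub>base_change s M\<^esub> f \<odot>\<^bsub>base_change s M\<^esub> base_change_connection s M T v"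
    by (auto simp: base_change_simps base_change_connection_def F_def q_def intro!: restrict_ext)
qed

section \<open>Uniqueness of the polar part\<close>

text \<open>All that matters about a matrix \<open>diag(J\<^sup>\<flat>(c + f\<^sub>1), \<dots>, J\<^sup>\<flat>(c + f\<^sub>m))\<close> is this: the non-zero entries off
  the diagonal are just below it, and they join indices with the same polar part.\<close>

lemma diag_block_Jflat:
  assumes "list_all2 (\<lambda>B f. f \<in> polar_parts \<and> is_Jflat (dim_row B) (c + f) B) Bs fs"
  shows "dim_col (diag_block_mat Bs) = dim_row (diag_block_mat Bs) \<and>
    (\<exists>\<phi>. \<forall>i<dim_row (diag_block_mat Bs). \<phi> i \<in> polar_parts \<and> diag_block_mat Bs $$ (i, i) = c + \<phi> i \<and>
      (\<forall>j<dim_row (diag_block_mat Bs). j \<noteq> i \<longrightarrow> diag_block_mat Bs $$ (i, j) \<noteq> 0 \<longrightarrow>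
        i = Suc j \<and> \<phi> i = \<phi> j \<and> diag_block_mat Bs $$ (i, j) = 1))"
  using assms
proof (induction rule: list_all2_induct)
  case (Cons B Bs f fs)
  define D where "D = diag_block_mat Bs"
  define n where "n = dim_row B"
  have sq: "dim_col D = dim_row D" using Cons.IH by (simp add: D_def)
  obtain \<phi> where \<phi>: "\<And>i. i < dim_row D \<Longrightarrow> \<phi> i \<in> polar_parts \<and> D $$ (i, i) = c + \<phi> i \<and>
      (\<forall>j<dim_row D. j \<noteq> i \<longrightarrow> D $$ (i, j) \<noteq> 0 \<longrightarrow> i = Suc j \<and> \<phi> i = \<phi> j \<and> D $$ (i, j) = 1)"
    using Cons.IH unfolding D_def[symmetric] by blast
  have B: "f \<in> polar_parts" "is_Jflat n (c + f) B" using Cons.hyps by (auto simp: n_def)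
  hence col: "dim_col B = n" by (auto simp: is_Jflat_def n_def)
  have E: "diag_block_mat (B # Bs) = four_block_mat B (0\<^sub>m n (dim_row D)) (0\<^sub>m (dim_row D) n) D"
    by (simp add: Let_def D_def[symmetric] sq col n_def[symmetric])
  define \<psi> where "\<psi> i = (if i < n then f else \<phi> (i - n))" for i
  have "\<psi> i \<in> polar_parts \<and> diag_block_mat (B # Bs) $$ (i, i) = c + \<psi> i \<and>
      (\<forall>j<n + dim_row D. j \<noteq> i \<longrightarrow> diag_block_mat (B # Bs) $$ (i, j) \<noteq> 0 \<longrightarrow>
        i = Suc j \<and> \<psi> i = \<psi> j \<and> diag_block_mat (B # Bs) $$ (i, j) = 1)" if i: "i < n + dim_row D" for i
  proof (cases "i < n")
    case True
    show ?thesis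
      using True i B unfolding E
      by (auto simp: \<psi>_def col n_def[symmetric] sq is_Jflat_def split: if_splits)
  next
    case False
    have d: "i - n < dim_row D" using False i by simp
    have off: "i = Suc j \<and> \<phi> (i - n) = \<phi> (j - n) \<and> D $$ (i - n, j - n) = 1"
      if "n \<le> j" "j < n + dim_row D" "j \<noteq> i" "D $$ (i - n, j - n) \<noteq> 0" for j
    proof -
      have "j - n < dim_row D" "j - n \<noteq> i - n" using that False by auto
      thus ?thesis using \<phi>[OF d] that False by auto
    qed
    show ?thesis
      using False i \<phi>[OF d] off unfolding E
      by (auto simp: \<psi>_def col n_def[symmetric] sq split: if_splits)
  qed
  moreover have "dim_row (diag_block_mat (B # Bs)) = n + dim_row D"
    "dim_col (diag_block_mat (B # Bs)) = n + dim_row D"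
    unfolding E by (simp_all add: sq col n_def)
  ultimately show ?case by (metis (no_types, lifting))
qed simp

lemma log_basis_exists:
  assumes "has_log_basis M Drs D" and M: "is_module M"
  shows "\<exists>r e A \<phi> c. basis_on M {..<r} e \<and>
    (\<forall>i<r. Drs (e i) = lincomb M {..<r} e (\<lambda>j. A j i) \<and>
      D (e i) = lincomb M {..<r} e (\<lambda>j. A j i + (if j = i then \<phi> i else 0)) \<and>
      \<phi> i \<in> polar_parts \<and> A i i = fls_const c \<and>
      (\<forall>j<r. j \<noteq> i \<longrightarrow> A j i \<noteq> 0 \<longrightarrow> j = Suc i \<and> \<phi> j = \<phi> i \<and> A j i = 1))"
proof -
  interpret type_module M by (rule type_module.intro[OF M])
  obtain c r e A fs Bs where
    e: "is_basis M r e" and A: "has_matrix M Drs r e A" "is_Jflat r (fls_const c) A"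
    and B: "has_matrix M D r e (diag_block_mat Bs)"
      "list_all2 (\<lambda>B f. f \<in> polar_parts \<and> is_Jflat (dim_row B) (fls_const c + f) B) Bs fs"
    and off: "\<forall>i<r. \<forall>j<r. i \<noteq> j \<longrightarrow> A $$ (i, j) = diag_block_mat Bs $$ (i, j)"
    using assms(1) unfolding has_log_basis_def by blast
  have r: "dim_row (diag_block_mat Bs) = r" using B(1) by (auto simp: has_matrix_def)
  obtain \<phi> where \<phi>: "\<And>i. i < r \<Longrightarrow> \<phi> i \<in> polar_parts \<and> diag_block_mat Bs $$ (i, i) = fls_const c + \<phi> i \<and>
      (\<forall>j<r. j \<noteq> i \<longrightarrow> diag_block_mat Bs $$ (i, j) \<noteq> 0 \<longrightarrow>
        i = Suc j \<and> \<phi> i = \<phi> j \<and> diag_block_mat Bs $$ (i, j) = 1)"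
    using diag_block_Jflat[OF B(2)] unfolding r by blast
  have eM: "e \<in> {..<r} \<rightarrow> carrier M" using e by (simp add: is_basis_def)
  show ?thesis
  proof (intro exI[of _ r] exI[of _ e] exI[of _ "\<lambda>j i. A $$ (j, i)"] exI[of _ \<phi>] exI[of _ c] conjI allI impI)
    show "basis_on M {..<r} e" by (rule is_basis_imp_basis_on[OF e])
    fix i assume i: "i < r"
    show "Drs (e i) = lincomb M {..<r} e (\<lambda>j. A $$ (j, i))"
      using A(1) i by (simp add: has_matrix_def lincomb_def)
    have "D (e i) = lincomb M {..<r} e (\<lambda>j. diag_block_mat Bs $$ (j, i))"
      using B(1) i by (simp add: has_matrix_def lincomb_def)
    also have "\<dots> = lincomb M {..<r} e (\<lambda>j. A $$ (j, i) + (if j = i then \<phi> i else 0))"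
      using eM off \<phi> A(2) i by (intro lincomb_cong) (auto simp: is_Jflat_def)
    finally show "D (e i) = lincomb M {..<r} e (\<lambda>j. A $$ (j, i) + (if j = i then \<phi> i else 0))" .
    show "\<phi> i \<in> polar_parts" "A $$ (i, i) = fls_const c" using \<phi> A(2) i by (auto simp: is_Jflat_def)
    fix j assume "j < r" "j \<noteq> i" "A $$ (j, i) \<noteq> 0"
    thus "j = Suc i" "\<phi> j = \<phi> i" "A $$ (j, i) = 1" using i off \<phi>[of j] by auto
  qed
qed

lemma polar_parts_diff: "f \<in> polar_parts \<Longrightarrow> g \<in> polar_parts \<Longrightarrow> f - g \<in> polar_parts"
  by (simp add: polar_parts_def)

text \<open>Suppose that \<open>w = (D - c - f) v\<close> belongs to the eigenspace of \<open>P\<close> for \<open>f\<close>. In the basis of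
  \<open>C((x\<^sub>s)) \<otimes> M\<close> given by the logarithmic decomposition, \<open>P\<close> is diagonal with entries \<open>\<phi>\<^sub>j\<close> and \<open>D\<close> is lower
  triangular. At a coordinate with \<open>\<phi>\<^sub>j \<noteq> f\<close> the vector \<open>w\<close> vanishes, and the coordinates of \<open>v\<close> that feed
  into it have the same polar part \<open>\<phi>\<^sub>j\<close> and vanish by induction. What remains is a rank one equation
  with the polar part \<open>\<phi>\<^sub>j - f \<noteq> 0\<close>, which has no solution except \<open>0\<close>. So \<open>v\<close> lies in the eigenspace, too.\<close>

lemma log_basis_eigenspace:
  fixes M :: "('c::field_char_0 fls, 'm) module"
  assumes M: "is_module M" and s: "s \<ge> 1"
    and Drs: "Drs \<in> carrier M \<rightarrow> carrier M"
      "\<And>v w. v \<in> carrier M \<Longrightarrow> w \<in> carrier M \<Longrightarrow> Drs (v \<oplus>\<^bsub>M\<^esub> w) = Drs v \<oplus>\<^bsub>M\<^esub> Drs w"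
      "\<And>f v. v \<in> carrier M \<Longrightarrow> Drs (f \<odot>\<^bsub>M\<^esub> v) = theta_fls f \<odot>\<^bsub>M\<^esub> v \<oplus>\<^bsub>M\<^esub> f \<odot>\<^bsub>M\<^esub> Drs v"
    and P: "linear_map M M P"
    and D: "\<And>v. v \<in> carrier M \<Longrightarrow> D v = Drs v \<oplus>\<^bsub>M\<^esub> P v"
    and lb: "has_log_basis (base_change s M) (base_change_connection s M Drs) (base_change_connection s M D)"
    and f: "f \<in> polar_parts" and v: "v \<in> carrier M" and w: "w \<in> carrier M"
    and vw: "D v = w \<oplus>\<^bsub>M\<^esub> (fls_const c + f) \<odot>\<^bsub>M\<^esub> v" and Pw: "P w = f \<odot>\<^bsub>M\<^esub> w"
  shows "P v = f \<odot>\<^bsub>M\<^esub> v"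
proof -
  interpret type_module M by (rule type_module.intro[OF M])
  define B where "B = base_change s M"
  interpret B: type_module B unfolding B_def by (intro type_module.intro base_change_module M s)
  note simps = base_change_simps[of s M, folded B_def]
  \<comment> \<open>The canonical maps \<open>v \<mapsto> 1 \<otimes> v\<close> and \<open>C((x)) \<rightarrow> C((x\<^sub>s))\<close>.\<close>
  define \<iota> where "\<iota> v = (\<lambda>i\<in>{..<s}. if i = 0 then v else \<zero>\<^bsub>M\<^esub>)" for v
  define em where "em g = fls_compose_power g s" for g :: "'c fls"
  have P': "P \<in> carrier M \<rightarrow> carrier M" "P (v \<oplus>\<^bsub>M\<^esub> w) = P v \<oplus>\<^bsub>M\<^esub> P w" "P (g \<odot>\<^bsub>M\<^esub> v) = g \<odot>\<^bsub>M\<^esub> P v"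
    if "v \<in> carrier M" "w \<in> carrier M" for v w g
    using P that by (auto simp: linear_map_def)
  have D': "D \<in> carrier M \<rightarrow> carrier M" using P'(1) Drs(1) v by (auto simp: D Pi_iff)
  have D_add: "D (v \<oplus>\<^bsub>M\<^esub> w) = D v \<oplus>\<^bsub>M\<^esub> D w" if "v \<in> carrier M" "w \<in> carrier M" for v w
    using that P'(1)[OF that] Drs(1) by (simp add: D Drs P' M.a_ac Pi_iff)
  have D_leib: "D (g \<odot>\<^bsub>M\<^esub> v) = theta_fls g \<odot>\<^bsub>M\<^esub> v \<oplus>\<^bsub>M\<^esub> g \<odot>\<^bsub>M\<^esub> D v" if "v \<in> carrier M" for v g
    using that P'(1)[OF that that] Drs(1) by (simp add: D Drs P' M.a_ac Pi_iff scale_add_right)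
  note bc = base_change_Leibniz[OF M s, folded B_def]
  have \<iota>B: "\<iota> v \<in> carrier B" if "v \<in> carrier M" for v using that by (auto simp: simps \<iota>_def)
  have \<iota>_add: "\<iota> (v \<oplus>\<^bsub>M\<^esub> w) = \<iota> v \<oplus>\<^bsub>B\<^esub> \<iota> w" if "v \<in> carrier M" "w \<in> carrier M" for v w
    using that by (auto simp: simps \<iota>_def intro!: restrict_ext)
  have \<iota>_scale: "\<iota> (g \<odot>\<^bsub>M\<^esub> v) = em g \<odot>\<^bsub>B\<^esub> \<iota> v" if v: "v \<in> carrier M" for v g
  proof -
    have \<iota>M: "\<iota> v \<in> {..<s} \<rightarrow> carrier M" using v by (auto simp: \<iota>_def)
    have "lincomb M {..<s} (\<iota> v) (\<lambda>i. xs_component s (em g) (int k - int i)) = \<iota> (g \<odot>\<^bsub>M\<^esub> v) k" if k: "k < s" for k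
    proof -
      have "lincomb M {..<s} (\<iota> v) (\<lambda>i. xs_component s (em g) (int k - int i))
          = lincomb M {..<s} (\<iota> v) (\<lambda>i. if i = k then g else 0)"
        using \<iota>M s k by (intro lincomb_cong) (auto simp: em_def xs_component_compose_power)
      thus ?thesis using \<iota>M k v by (auto simp: lincomb_single \<iota>_def)
    qed
    thus ?thesis by (auto simp: simps \<iota>_def intro!: restrict_ext)
  qed
  have \<iota>_conn: "base_change_connection s M T (\<iota> v) = \<iota> (T v)"
    if T: "T \<in> carrier M \<rightarrow> carrier M" "\<And>v w. v \<in> carrier M \<Longrightarrow> w \<in> carrier M \<Longrightarrow> T (v \<oplus>\<^bsub>M\<^esub> w) = T v \<oplus>\<^bsub>M\<^esub> T w"
      and v: "v \<in> carrier M" for T v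
  proof -
    have "T \<zero>\<^bsub>M\<^esub> = \<zero>\<^bsub>M\<^esub>" using additive_finsum[OF T, of "{}" "\<lambda>_. v"] by simp
    moreover have "T v \<in> carrier M" using v T(1) by auto
    ultimately show ?thesis using v by (auto simp: base_change_connection_def \<iota>_def intro!: restrict_ext)
  qed
  have \<iota>_inj: "v = w" if "\<iota> v = \<iota> w" for v w
    using s fun_cong[OF that, of 0] by (simp add: \<iota>_def)
  have B_mod: "is_module B" by (rule B.is_module)
  obtain r e A \<phi> c' where e: "basis_on B {..<r} e"
    and eA: "\<forall>i<r. base_change_connection s M Drs (e i) = lincomb B {..<r} e (\<lambda>j. A j i) \<and>
      base_change_connection s M D (e i) = lincomb B {..<r} e (\<lambda>j. A j i + (if j = i then \<phi> i else 0)) \<and>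
      \<phi> i \<in> polar_parts \<and> A i i = fls_const c' \<and>
      (\<forall>j<r. j \<noteq> i \<longrightarrow> A j i \<noteq> 0 \<longrightarrow> j = Suc i \<and> \<phi> j = \<phi> i \<and> A j i = 1)"
    using log_basis_exists[OF lb[folded B_def] B_mod] by (elim exE conjE) (rule that)
  have A: "\<And>i. i < r \<Longrightarrow> base_change_connection s M Drs (e i) = lincomb B {..<r} e (\<lambda>j. A j i)"
    "\<And>i. i < r \<Longrightarrow> base_change_connection s M D (e i) = lincomb B {..<r} e (\<lambda>j. A j i + (if j = i then \<phi> i else 0))"
    and \<phi>: "\<And>i. i < r \<Longrightarrow> \<phi> i \<in> polar_parts"
    and Ad: "\<And>i. i < r \<Longrightarrow> A i i = fls_const c'"
    and Ao: "\<And>i j. i < r \<Longrightarrow> j < r \<Longrightarrow> j \<noteq> i \<Longrightarrow> A j i \<noteq> 0 \<Longrightarrow> j = Suc i \<and> \<phi> j = \<phi> i \<and> A j i = 1"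
    using eA by auto
  have eB: "e \<in> {..<r} \<rightarrow> carrier B" using e by (simp add: basis_on_def)
  have coord: "\<exists>a. \<iota> v = lincomb B {..<r} e a" if "v \<in> carrier M" for v
    using e \<iota>B[OF that] by (auto simp: basis_on_def)
  have Drs_co: "\<iota> (Drs v) = lincomb B {..<r} e (\<lambda>j. theta_xs s (a j) + (\<Sum>i<r. A j i * a i))"
    and D_co: "\<iota> (D v) = lincomb B {..<r} e (\<lambda>j. theta_xs s (a j) + (\<Sum>i<r. A j i * a i) + \<phi> j * a j)"
    if v: "v \<in> carrier M" and a: "\<iota> v = lincomb B {..<r} e a" for v a
  proof -
    show "\<iota> (Drs v) = lincomb B {..<r} e (\<lambda>j. theta_xs s (a j) + (\<Sum>i<r. A j i * a i))"
    proof -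
      have "\<iota> (Drs v) = base_change_connection s M Drs (lincomb B {..<r} e a)"
        using \<iota>_conn[OF Drs(1,2) v] a by simp
      also have "\<dots> = lincomb B {..<r} e (\<lambda>j. theta_xs s (a j) + (\<Sum>i<r. A j i * a i))"
        by (rule B.connection_lincomb[OF bc[OF Drs]]) (use eB A in auto)
      finally show ?thesis .
    qed
    have "\<iota> (D v) = base_change_connection s M D (lincomb B {..<r} e a)"
      using \<iota>_conn[OF D' D_add v] a by simp
    also have "\<dots> = lincomb B {..<r} e (\<lambda>j. theta_xs s (a j) + (\<Sum>i<r. (A j i + (if j = i then \<phi> i else 0)) * a i))"
      by (rule B.connection_lincomb[OF bc[OF D' D_add D_leib]]) (use eB A in auto)
    also have "\<dots> = lincomb B {..<r} e (\<lambda>j. theta_xs s (a j) + (\<Sum>i<r. A j i * a i) + \<phi> j * a j)"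
    proof (intro B.lincomb_cong eB)
      fix j assume j: "j \<in> {..<r}"
      have "(\<Sum>i<r. (A j i + (if j = i then \<phi> i else 0)) * a i)
          = (\<Sum>i<r. A j i * a i) + (\<Sum>i<r. if j = i then \<phi> i * a i else 0)"
        unfolding sum.distrib[symmetric] by (intro sum.cong) (auto simp: distrib_right)
      thus "theta_xs s (a j) + (\<Sum>i<r. (A j i + (if j = i then \<phi> i else 0)) * a i)
          = theta_xs s (a j) + (\<Sum>i<r. A j i * a i) + \<phi> j * a j" using j by simp
    qed
    finally show "\<iota> (D v) = \<dots>" .
  qed
  have P_co: "\<iota> (P v) = lincomb B {..<r} e (\<lambda>j. \<phi> j * a j)"
    if v: "v \<in> carrier M" and a: "\<iota> v = lincomb B {..<r} e a" for v a
  proof -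
    have Pv: "P v \<in> carrier M" "Drs v \<in> carrier M" using P'(1) Drs(1) v by auto
    have "\<iota> (Drs v) \<oplus>\<^bsub>B\<^esub> \<iota> (P v) = \<iota> (D v)" using Pv v by (simp add: \<iota>_add D)
    also have "\<dots> = \<iota> (Drs v) \<oplus>\<^bsub>B\<^esub> lincomb B {..<r} e (\<lambda>j. \<phi> j * a j)"
      unfolding D_co[OF v a] Drs_co[OF v a] using eB by (simp add: B.lincomb_add)
    finally have "\<iota> (Drs v) \<oplus>\<^bsub>B\<^esub> \<iota> (P v) = \<iota> (Drs v) \<oplus>\<^bsub>B\<^esub> lincomb B {..<r} e (\<lambda>j. \<phi> j * a j)" .
    thus ?thesis
      by (rule B.M.add.l_cancel) (use \<iota>B[OF Pv(1)] \<iota>B[OF Pv(2)] eB in auto)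
  qed
  obtain a where a: "\<iota> v = lincomb B {..<r} e a" using coord v by blast
  obtain a' where a': "\<iota> w = lincomb B {..<r} e a'" using coord w by blast
  have w0: "\<phi> j * a' j = em f * a' j" if "j < r" for j
  proof (rule B.basis_on_unique[OF e])
    have "\<iota> (P w) = em f \<odot>\<^bsub>B\<^esub> \<iota> w" unfolding Pw using w by (rule \<iota>_scale)
    thus "lincomb B {..<r} e (\<lambda>j. \<phi> j * a' j) = lincomb B {..<r} e (\<lambda>j. em f * a' j)"
      using P_co[OF w a'] a' eB by (simp add: B.lincomb_scale)
  qed (use that in auto)
  have em_c: "em (fls_const c + f) = fls_const c + em f"
    using s by (intro fls_eqI) (auto simp: em_def fls_nth_compose_power)
  have em_polar: "em f \<in> polar_parts"
    using s f by (auto simp: em_def polar_parts_def fls_nth_compose_power pos_imp_zdiv_nonneg_iff)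
  have main: "theta_xs s (a j) + (\<Sum>i<r. A j i * a i) + \<phi> j * a j = a' j + (fls_const c + em f) * a j"
    if "j < r" for j
  proof (rule B.basis_on_unique[OF e])
    have "\<iota> (D v) = \<iota> w \<oplus>\<^bsub>B\<^esub> em (fls_const c + f) \<odot>\<^bsub>B\<^esub> \<iota> v"
      unfolding vw using v w by (simp add: \<iota>_add \<iota>_scale)
    thus "lincomb B {..<r} e (\<lambda>j. theta_xs s (a j) + (\<Sum>i<r. A j i * a i) + \<phi> j * a j)
        = lincomb B {..<r} e (\<lambda>j. a' j + (fls_const c + em f) * a j)"
      unfolding D_co[OF v a] a a' em_c using eB by (simp add: B.lincomb_scale B.lincomb_add)
  qed (use that in auto)
  have a0: "j < r \<Longrightarrow> \<phi> j \<noteq> em f \<Longrightarrow> a j = 0" for j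
  proof (induction j rule: less_induct)
    case (less j)
    have "A j i * a i = 0" if "i < r" "i \<noteq> j" for i
      using Ao[of i j] less that by (cases "A j i = 0") auto
    hence "(\<Sum>i<r. A j i * a i) = (\<Sum>i<r. if i = j then A j j * a j else 0)"
      by (intro sum.cong) auto
    hence "(\<Sum>i<r. A j i * a i) = fls_const c' * a j" using less Ad by simp
    moreover have "a' j = 0" using w0[of j] less by simp
    ultimately have "theta_xs s (a j) + (fls_const (c' - c) + (\<phi> j - em f)) * a j = 0"
      using main[of j] less by (simp add: algebra_simps flip: fls_minus_const)
    thus "a j = 0"
      using less \<phi> em_polar
      by (intro irregular_no_horizontal[of "\<phi> j - em f" "a j" "theta_xs s (a j)"])
        (auto intro: polar_parts_diff simp: theta_xs_def)
  qed
  have "\<iota> (P v) = lincomb B {..<r} e (\<lambda>j. em f * a j)"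
    unfolding P_co[OF v a] using a0 eB by (intro B.lincomb_cong) auto
  also have "\<dots> = \<iota> (f \<odot>\<^bsub>M\<^esub> v)"
    using v eB by (simp add: \<iota>_scale a B.lincomb_scale)
  finally show ?thesis by (rule \<iota>_inj)
qed

text \<open>
  The isotypical components are stable under \<open>P\<close> and \<open>D\<close>, so that the previous lemma can be applied to
  each component separately. It determines \<open>P\<close>: a generalized eigenvector of \<open>D\<close> for \<open>c + f\<close> is an
  eigenvector of \<open>P\<close> for \<open>f\<close>, by induction on the exponent that kills it.
\<close>

lemma log_decomposition_alg_eigenspace:
  fixes M :: "('c::field_char_0 fls, 'm) module"
  assumes ld: "log_decomposition_alg \<Lambda> \<iota> act M D Drs P"
    and f: "f \<in> polar_parts" and v: "v \<in> carrier M" and w: "w \<in> carrier M"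
    and vw: "D v = w \<oplus>\<^bsub>M\<^esub> (fls_const c + f) \<odot>\<^bsub>M\<^esub> v" and Pw: "P w = f \<odot>\<^bsub>M\<^esub> w"
  shows "P v = f \<odot>\<^bsub>M\<^esub> v"
proof -
  have D: "\<And>v. v \<in> carrier M \<Longrightarrow> D v = Drs v \<oplus>\<^bsub>M\<^esub> P v" and "MC_rs M Drs" and P: "linear_map M M P"
    using ld by (auto simp: log_decomposition_alg_def)
  hence MC: "connection fls_const theta_fls M Drs" by (auto simp: MC_rs_def MC_def)
  hence M: "is_module M" by (simp add: connection_def)
  interpret type_module M by (rule type_module.intro[OF M])
  obtain s S N T where s: "is_Turrittin_index M D s"
    and Lev: "Levelt_decomposition M Drs S N"
    and ds: "internal_direct_sum M T (isotypical_component M S)"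
    and comp: "\<forall>\<rho>\<in>T. P ` isotypical_component M S \<rho> \<subseteq> isotypical_component M S \<rho> \<and>
      has_log_basis (base_change s (M\<lparr>carrier := isotypical_component M S \<rho>\<rparr>))
        (base_change_connection s M Drs) (base_change_connection s M D)"
    using ld unfolding log_decomposition_alg_def by (elim conjE exE) (rule that)
  have s1: "s \<ge> 1"
  proof -
    obtain S N where "\<exists>s\<ge>1. diagonalizable (base_change s M) (base_change_connection s M S)"
      and "s = (LEAST s. s \<ge> 1 \<and> diagonalizable (base_change s M) (base_change_connection s M S))"
      using s unfolding is_Turrittin_index_def Levelt_decomposition_def by blast
    thus ?thesis by (metis (mono_tags, lifting) LeastI_ex)
  qed
  define H where "H = isotypical_component M S"
  note ds = ds[folded H_def] and comp = comp[folded H_def]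
  have PT: "\<And>\<rho>. \<rho> \<in> T \<Longrightarrow> P ` H \<rho> \<subseteq> H \<rho>"
    and lb: "\<And>\<rho>. \<rho> \<in> T \<Longrightarrow> has_log_basis (base_change s (M\<lparr>carrier := H \<rho>\<rparr>))
      (base_change_connection s M Drs) (base_change_connection s M D)"
    using comp by auto
  have T: "finite T" and sub: "\<And>\<rho>. \<rho> \<in> T \<Longrightarrow> is_submodule (H \<rho>) M"
    using ds by (auto simp: internal_direct_sum_def)
  have P': "P \<in> carrier M \<rightarrow> carrier M" "\<And>v w. v \<in> carrier M \<Longrightarrow> w \<in> carrier M \<Longrightarrow> P (v \<oplus>\<^bsub>M\<^esub> w) = P v \<oplus>\<^bsub>M\<^esub> P w"
    "\<And>g v. v \<in> carrier M \<Longrightarrow> P (g \<odot>\<^bsub>M\<^esub> v) = g \<odot>\<^bsub>M\<^esub> P v"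
    using P by (auto simp: linear_map_def)
  have Drs: "Drs \<in> carrier M \<rightarrow> carrier M"
      "\<And>v w. v \<in> carrier M \<Longrightarrow> w \<in> carrier M \<Longrightarrow> Drs (v \<oplus>\<^bsub>M\<^esub> w) = Drs v \<oplus>\<^bsub>M\<^esub> Drs w"
      "\<And>f v. v \<in> carrier M \<Longrightarrow> Drs (f \<odot>\<^bsub>M\<^esub> v) = theta_fls f \<odot>\<^bsub>M\<^esub> v \<oplus>\<^bsub>M\<^esub> f \<odot>\<^bsub>M\<^esub> Drs v"
    using MC by (auto simp: connection_def)
  have SN: "\<And>v. v \<in> carrier M \<Longrightarrow> Drs v = S v \<oplus>\<^bsub>M\<^esub> N v" "\<And>v. v \<in> carrier M \<Longrightarrow> S (N v) = N (S v)"
    and N: "N \<in> carrier M \<rightarrow> carrier M" "\<And>v w. v \<in> carrier M \<Longrightarrow> w \<in> carrier M \<Longrightarrow> N (v \<oplus>\<^bsub>M\<^esub> w) = N v \<oplus>\<^bsub>M\<^esub> N w"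
      "\<And>g v. v \<in> carrier M \<Longrightarrow> N (g \<odot>\<^bsub>M\<^esub> v) = g \<odot>\<^bsub>M\<^esub> N v"
    using Lev by (auto simp: Levelt_decomposition_def linear_map_def)
  \<comment> \<open>The nilpotent part commutes with the semisimple one, hence preserves its isotypical components.\<close>
  have DrsH: "Drs v \<in> H \<rho>" if \<rho>: "\<rho> \<in> T" and v: "v \<in> H \<rho>" for \<rho> v
  proof -
    note sub\<rho> = sub[OF \<rho>]
    have HM: "H \<rho> \<subseteq> carrier M" by (rule submodule_subset[OF sub\<rho>])
    have SH: "S v \<in> H \<rho>" if "v \<in> H \<rho>" for v
      using that unfolding H_def isotypical_component_def subconnection_generated_def by blast
    have GH: "v \<in> H \<rho>" if "v \<in> carrier M" "f \<in> \<rho>" "S v = f \<odot>\<^bsub>M\<^esub> v" for v f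
      using that unfolding H_def isotypical_component_def subconnection_generated_def by blast
    define K where "K = {v \<in> H \<rho>. N v \<in> H \<rho>}"
    have N0: "N \<zero>\<^bsub>M\<^esub> = \<zero>\<^bsub>M\<^esub>" using additive_finsum[OF N(1,2), of "{}" "\<lambda>_. v"] by simp
    have K_scale: "g \<odot>\<^bsub>M\<^esub> v \<in> K" if "v \<in> K" for g v
      using that HM by (auto simp: K_def N subsetD intro!: submodule_scale_closed[OF sub\<rho>])
    have "is_submodule K M"
    proof (rule submoduleI)
      fix v assume "v \<in> K"
      thus "\<ominus>\<^bsub>M\<^esub> v \<in> K" using K_scale[of v "-1"] HM scale_minus_left[of v 1] by (auto simp: K_def)
    next
      fix v w assume "v \<in> K" "w \<in> K"
      thus "v \<oplus>\<^bsub>M\<^esub> w \<in> K" using HM submoduleE(5)[OF sub\<rho>] by (auto simp: K_def N subsetD)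
    qed (use HM N0 submodule_zero[OF sub\<rho>] K_scale in \<open>auto simp: K_def\<close>)
    moreover have "S ` K \<subseteq> K"
    proof clarify
      fix v assume v: "v \<in> K"
      have "N (S v) = S (N v)" using v HM by (auto simp: K_def SN subsetD)
      thus "S v \<in> K" using v SH by (auto simp: K_def)
    qed
    moreover have "{v \<in> carrier M. \<exists>f\<in>\<rho>. S v = f \<odot>\<^bsub>M\<^esub> v} \<subseteq> K"
    proof clarify
      fix v f assume v: "v \<in> carrier M" "f \<in> \<rho>" "S v = f \<odot>\<^bsub>M\<^esub> v"
      have "S (N v) = f \<odot>\<^bsub>M\<^esub> N v" using v by (simp add: SN N)
      hence "N v \<in> H \<rho>" using v N(1) by (intro GH[of _ f]) auto
      thus "v \<in> K" using v GH by (auto simp: K_def)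
    qed
    ultimately have "H \<rho> \<subseteq> K"
      unfolding H_def isotypical_component_def subconnection_generated_def by blast
    hence "S v \<in> H \<rho>" "N v \<in> H \<rho>" using v SH by (auto simp: K_def)
    thus ?thesis using v HM submoduleE(5)[OF sub\<rho>] by (auto simp: SN subsetD)
  qed
  have D': "D \<in> carrier M \<rightarrow> carrier M" using P'(1) Drs(1) by (auto simp: D Pi_iff)
  have D_add: "D (v \<oplus>\<^bsub>M\<^esub> w) = D v \<oplus>\<^bsub>M\<^esub> D w" if "v \<in> carrier M" "w \<in> carrier M" for v w
    using that P'(1) Drs(1) by (simp add: D Drs P' M.a_ac Pi_iff)
  define Z where "Z = (\<lambda>u. D u \<ominus>\<^bsub>M\<^esub> (fls_const c + f) \<odot>\<^bsub>M\<^esub> u)"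
  define Y where "Y = (\<lambda>u. P u \<ominus>\<^bsub>M\<^esub> f \<odot>\<^bsub>M\<^esub> u)"
  have Z: "Z \<in> carrier M \<rightarrow> carrier M"
      "\<And>v w. v \<in> carrier M \<Longrightarrow> w \<in> carrier M \<Longrightarrow> Z (v \<oplus>\<^bsub>M\<^esub> w) = Z v \<oplus>\<^bsub>M\<^esub> Z w"
    unfolding Z_def by (rule diff_scale_additive[OF D' D_add]; assumption)+
  have Y: "Y \<in> carrier M \<rightarrow> carrier M"
      "\<And>v w. v \<in> carrier M \<Longrightarrow> w \<in> carrier M \<Longrightarrow> Y (v \<oplus>\<^bsub>M\<^esub> w) = Y v \<oplus>\<^bsub>M\<^esub> Y w"
    unfolding Y_def by (rule diff_scale_additive[OF P'(1,2)]; assumption)+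
  obtain u where u: "u \<in> (\<Pi> \<rho>\<in>T. H \<rho>)" "v = (\<Oplus>\<^bsub>M\<^esub>\<rho>\<in>T. u \<rho>)"
    using direct_sum_obtain[OF ds v] by blast
  have uM: "u \<in> T \<rightarrow> carrier M" using u(1) submodule_subset[OF sub] by (auto simp: Pi_iff)
  have ZM: "(\<lambda>\<rho>. Z (u \<rho>)) \<in> T \<rightarrow> carrier M" using Z(1) uM by (auto simp: Pi_iff)
  have "Z v = w" unfolding Z_def vw using v w by (simp add: a_minus_def M.a_assoc M.r_neg)
  hence w_sum: "w = (\<Oplus>\<^bsub>M\<^esub>\<rho>\<in>T. Z (u \<rho>))"
    unfolding u(2) using additive_finsum[OF Z T uM] by simp
  have "Y w = \<zero>\<^bsub>M\<^esub>" unfolding Y_def Pw using w by (simp add: minus_self)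
  hence Y_sum: "(\<Oplus>\<^bsub>M\<^esub>\<rho>\<in>T. Y (Z (u \<rho>))) = \<zero>\<^bsub>M\<^esub>"
    unfolding w_sum using additive_finsum[OF Y T ZM] by simp
  have Pu: "Y (u \<rho>) = \<zero>\<^bsub>M\<^esub>" if \<rho>: "\<rho> \<in> T" for \<rho>
  proof -
    note sub\<rho> = sub[OF \<rho>]
    interpret H: type_module "M\<lparr>carrier := H \<rho>\<rparr>" by (rule submodule_type_module[OF sub\<rho>])
    have HM: "H \<rho> \<subseteq> carrier M" by (rule submodule_subset[OF sub\<rho>])
    have PH: "P v \<in> H \<rho>" if "v \<in> H \<rho>" for v using PT[OF \<rho>] that by blast
    have ZH: "Z v \<in> H \<rho>" and YH: "Y v \<in> H \<rho>" if "\<rho> \<in> T" "v \<in> H \<rho>" for v \<rho>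
    proof -
      have "D v \<in> H \<rho>" using D[of v] that submodule_subset[OF sub] DrsH[of \<rho> v] PT[of \<rho>] submoduleE(5)[OF sub]
        by (auto simp: subset_iff image_subset_iff)
      thus "Z v \<in> H \<rho>" unfolding Z_def
        using that by (intro submodule_diff_closed[OF sub] submodule_scale_closed[OF sub])
      show "Y v \<in> H \<rho>" unfolding Y_def
        using that PT[of \<rho>] by (intro submodule_diff_closed[OF sub] submodule_scale_closed[OF sub]) auto
    qed
    have u\<rho>: "u \<rho> \<in> H \<rho>" using u(1) \<rho> by auto
    have YZ: "Y (Z (u \<rho>)) = \<zero>\<^bsub>M\<^esub>"
      using u(1) ZH YH \<rho> by (intro direct_sum_zero[OF ds _ Y_sum]) (auto simp: Pi_iff)
    have 1: "P (Z (u \<rho>)) = f \<odot>\<^bsub>M\<^esub> Z (u \<rho>)"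
    proof (rule minus_eq_zeroD)
      have zM: "Z (u \<rho>) \<in> carrier M" using funcset_mem[OF ZM \<rho>] .
      show "P (Z (u \<rho>)) \<in> carrier M" using P'(1) zM by (rule funcset_mem)
      show "f \<odot>\<^bsub>M\<^esub> Z (u \<rho>) \<in> carrier M" using zM by simp
      show "P (Z (u \<rho>)) \<ominus>\<^bsub>M\<^esub> f \<odot>\<^bsub>M\<^esub> Z (u \<rho>) = \<zero>\<^bsub>M\<^esub>" using YZ by (simp add: Y_def)
    qed
    have 2: "D (u \<rho>) = Z (u \<rho>) \<oplus>\<^bsub>M\<^esub> (fls_const c + f) \<odot>\<^bsub>M\<^esub> u \<rho>"
      using D' uM \<rho> unfolding Z_def by (simp add: a_minus_def M.a_assoc M.l_neg Pi_iff)
    have bc: "base_change_connection s (M\<lparr>carrier := H \<rho>\<rparr>) T' = base_change_connection s M T'" for T'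
      by (simp add: base_change_connection_def fun_eq_iff)
    have "P (u \<rho>) = f \<odot>\<^bsub>M\<lparr>carrier := H \<rho>\<rparr>\<^esub> u \<rho>"
      by (rule log_basis_eigenspace[OF H.is_module s1 _ _ _ _ _ lb[OF \<rho>, folded bc] f])
        (use HM DrsH[OF \<rho>] PH Drs P' D u\<rho> ZH \<rho> 1 2 in \<open>auto simp: linear_map_def subset_iff\<close>)
    thus ?thesis using uM \<rho> unfolding Y_def by (simp add: minus_self Pi_iff)
  qed
  have "Y v = (\<Oplus>\<^bsub>M\<^esub>\<rho>\<in>T. Y (u \<rho>))" unfolding u(2) by (rule additive_finsum[OF Y T uM])
  also have "\<dots> = \<zero>\<^bsub>M\<^esub>" using Pu by (intro M.add.finprod_one_eqI) auto
  finally have "P v \<ominus>\<^bsub>M\<^esub> f \<odot>\<^bsub>M\<^esub> v = \<zero>\<^bsub>M\<^esub>" unfolding Y_def .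
  thus ?thesis by (rule minus_eq_zeroD[OF funcset_mem[OF P'(1) v] scale_closed[OF v]])
qed

section \<open>Quotient modules\<close>

context type_module
begin

lemma abelian_subgroup_submodule: "is_submodule K M \<Longrightarrow> abelian_subgroup K M"
  by (intro abelian_subgroupI3 additive_subgroup.intro submodule.axioms(1) M.abelian_group_axioms)

lemma coset_eq_iff:
  assumes K: "is_submodule K M" and "v \<in> carrier M" "w \<in> carrier M"
  shows "K +> v = K +> w \<longleftrightarrow> v \<ominus> w \<in> K"
proof -
  interpret K: abelian_subgroup K M by (rule abelian_subgroup_submodule[OF K])
  show ?thesis
    using assms K.a_rcos_module[of w v] K.a_repr_independence'[of v w] K.a_rcos_self[of v]
    by (auto simp: a_minus_def)
qed

lemma quotient_carrier: "is_submodule K M \<Longrightarrow>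
    carrier (quotient_module M K) = (\<lambda>v. K +> v) ` carrier M"
  by (auto simp: quotient_module_def A_RCOSETS_def')

lemma quotient_add:
  assumes K: "is_submodule K M" and "v \<in> carrier M" "w \<in> carrier M"
  shows "(K +> v) \<oplus>\<^bsub>quotient_module M K\<^esub> (K +> w) = K +> (v \<oplus> w)"
proof -
  interpret K: abelian_subgroup K M by (rule abelian_subgroup_submodule[OF K])
  show ?thesis using assms K.a_rcos_sum by (simp add: quotient_module_def)
qed

lemma quotient_zero:
  assumes K: "is_submodule K M"
  shows "\<zero>\<^bsub>quotient_module M K\<^esub> = K +> \<zero>"
  using submodule_subset[OF K] by (simp add: quotient_module_def)

lemma coset_map_coset:
  assumes K: "is_submodule K M" and K': "is_submodule K' M" and v: "v \<in> carrier M"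
    and T: "T \<in> carrier M \<rightarrow> carrier M"
    and add: "\<And>v w. v \<in> carrier M \<Longrightarrow> w \<in> carrier M \<Longrightarrow> T (v \<oplus> w) = T v \<oplus> T w"
    and TK: "\<And>k. k \<in> K \<Longrightarrow> T k \<in> K'"
  shows "coset_map M K' T (K +> v) = K' +> T v"
proof -
  interpret K: abelian_subgroup K M by (rule abelian_subgroup_submodule[OF K])
  have "K' +> T w = K' +> T v" if w: "w \<in> K +> v" for w
  proof -
    obtain k where k: "k \<in> K" "w = k \<oplus> v" using w by (auto simp: a_r_coset_def')
    have kM: "k \<in> carrier M" using k submodule_subset[OF K] by blast
    have TM: "T k \<in> carrier M" "T v \<in> carrier M" using T kM v by auto
    have "T w \<ominus> T v = T k"
      using TM kM v by (simp add: k add a_minus_def M.a_assoc M.r_neg)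
    thus ?thesis using TM kM v k TK by (subst coset_eq_iff[OF K']) (auto simp: k(2) add)
  qed
  moreover have "v \<in> K +> v" using v by (rule K.a_rcos_self)
  ultimately show ?thesis unfolding coset_map_def by blast
qed

lemma quotient_scale:
  assumes K: "is_submodule K M" and "v \<in> carrier M"
  shows "f \<odot>\<^bsub>quotient_module M K\<^esub> (K +> v) = K +> (f \<odot> v)"
  using coset_map_coset[OF K K assms(2), of "(\<odot>) f"] submodule_scale_closed[OF K]
  by (simp add: quotient_module_def scale_add_right)

end

section \<open>Reductions in twisted coordinates\<close>

text \<open>The transformation is chosen as a function of the polar part alone. Basis vectors that are joined by
  an entry off the diagonal have the same polar part, hence are rescaled by the same factor, and the
  entry survives.\<close>

definition gauge :: "'c::field_char_0 fps fls \<Rightarrow> nat \<Rightarrow> 'c fps fls" where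
  "gauge f = (SOME u. \<forall>l. t_power (Suc l) dvd u (Suc l) - u l \<and>
    t_power (Suc l) dvd theta_fls (u l) + (f - fls_map_const (t_coeff 0 f)) * u l \<and>
    (\<exists>u'. t_power (Suc l) dvd u l * u' - 1))"

lemma gauge:
  assumes "f \<in> polar_parts"
  shows "t_power (Suc l) dvd gauge f (Suc l) - gauge f l"
    and "t_power (Suc l) dvd theta_fls (gauge f l) + (f - fls_map_const (t_coeff 0 f)) * gauge f l"
    and "\<exists>u'. t_power (Suc l) dvd gauge f l * u' - 1"
proof -
  have "\<exists>u. \<forall>l. t_power (Suc l) dvd u (Suc l) - u l \<and>
    t_power (Suc l) dvd theta_fls (u l) + (f - fls_map_const (t_coeff 0 f)) * u l \<and>
    (\<exists>u'. t_power (Suc l) dvd u l * u' - 1)"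
    using gauge_exists[OF assms] by metis
  from someI_ex[OF this]
  show "t_power (Suc l) dvd gauge f (Suc l) - gauge f l"
    and "t_power (Suc l) dvd theta_fls (gauge f l) + (f - fls_map_const (t_coeff 0 f)) * gauge f l"
    and "\<exists>u'. t_power (Suc l) dvd gauge f l * u' - 1"
    unfolding gauge_def by blast+
qed

text \<open>What a TLJ-form with logarithmic decomposition provides: a basis in which the regular-singular part
  has a constant matrix \<open>A\<close>, triangular with respect to \<open>rank\<close>, and the whole connection has the matrix
  \<open>A + diag \<phi>\<close>, where \<open>A\<close> commutes with \<open>diag \<phi>\<close>.\<close>

locale adapted_basis =
  fixes E :: "('c::field_char_0 fps fls, 'e) module" and D Drs :: "'e \<Rightarrow> 'e"
    and J :: "'i set" and b :: "'i \<Rightarrow> 'e" and A :: "'i \<Rightarrow> 'i \<Rightarrow> 'c fps"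
    and \<phi> :: "'i \<Rightarrow> 'c fps fls" and rank :: "'i \<Rightarrow> nat"
  assumes MC_Drs: "MC E Drs" and MC_D: "MC E D"
    and basis: "basis_on E J b"
    and Drs_b: "\<And>i. i \<in> J \<Longrightarrow> Drs (b i) = lincomb E J b (\<lambda>j. fls_const (A j i))"
    and D_b: "\<And>i. i \<in> J \<Longrightarrow> D (b i) = lincomb E J b (\<lambda>j. fls_const (A j i) + (if j = i then \<phi> i else 0))"
    and polar: "\<And>i. i \<in> J \<Longrightarrow> \<phi> i \<in> polar_parts"
    and A_off: "\<And>i j. i \<in> J \<Longrightarrow> j \<in> J \<Longrightarrow> j \<noteq> i \<Longrightarrow> A j i \<noteq> 0 \<Longrightarrow> rank i < rank j \<and> \<phi> j = \<phi> i"
begin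

sublocale E: type_module E
  using MC_D by (intro type_module.intro) (simp add: MC_def connection_def)

lemma J: "finite J" and b: "b \<in> J \<rightarrow> carrier E"
  using basis by (auto simp: basis_on_def)

lemma
  shows D_closed: "D \<in> carrier E \<rightarrow> carrier E"
    and D_add: "\<And>v w. v \<in> carrier E \<Longrightarrow> w \<in> carrier E \<Longrightarrow> D (v \<oplus>\<^bsub>E\<^esub> w) = D v \<oplus>\<^bsub>E\<^esub> D w"
    and D_leib: "\<And>f v. v \<in> carrier E \<Longrightarrow> D (f \<odot>\<^bsub>E\<^esub> v) = theta_fls f \<odot>\<^bsub>E\<^esub> v \<oplus>\<^bsub>E\<^esub> f \<odot>\<^bsub>E\<^esub> D v"
    and Drs_closed: "Drs \<in> carrier E \<rightarrow> carrier E"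
    and Drs_add: "\<And>v w. v \<in> carrier E \<Longrightarrow> w \<in> carrier E \<Longrightarrow> Drs (v \<oplus>\<^bsub>E\<^esub> w) = Drs v \<oplus>\<^bsub>E\<^esub> Drs w"
    and Drs_leib: "\<And>f v. v \<in> carrier E \<Longrightarrow> Drs (f \<odot>\<^bsub>E\<^esub> v) = theta_fls f \<odot>\<^bsub>E\<^esub> v \<oplus>\<^bsub>E\<^esub> f \<odot>\<^bsub>E\<^esub> Drs v"
  using MC_D MC_Drs by (auto simp: MC_def connection_def)

lemma red_kernel_iff:
  assumes "v \<in> carrier E"
  shows "v \<in> red_kernel E l \<longleftrightarrow> (\<exists>z\<in>carrier E. v = t_power (Suc l) \<odot>\<^bsub>E\<^esub> z)"
  by (auto simp: red_kernel_def t_power_def)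

lemma red_kernel_submodule: "is_submodule (red_kernel E l) E"
proof (rule E.submoduleI)
  fix v assume "v \<in> red_kernel E l"
  then obtain z where z: "z \<in> carrier E" "v = t_power (Suc l) \<odot>\<^bsub>E\<^esub> z" by (auto simp: red_kernel_def t_power_def)
  show "\<ominus>\<^bsub>E\<^esub> v \<in> red_kernel E l"
    using z E.smult_r_minus[of "t_power (Suc l)" z]
    by (auto simp: red_kernel_iff intro!: bexI[of _ "\<ominus>\<^bsub>E\<^esub> z"])
next
  fix v w assume "v \<in> red_kernel E l" "w \<in> red_kernel E l"
  then obtain z y where z: "z \<in> carrier E" "v = t_power (Suc l) \<odot>\<^bsub>E\<^esub> z"
    "y \<in> carrier E" "w = t_power (Suc l) \<odot>\<^bsub>E\<^esub> y" by (auto simp: red_kernel_def t_power_def)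
  thus "v \<oplus>\<^bsub>E\<^esub> w \<in> red_kernel E l"
    by (auto simp: red_kernel_iff E.scale_add_right intro!: bexI[of _ "z \<oplus>\<^bsub>E\<^esub> y"])
next
  fix f v assume "v \<in> red_kernel E l"
  then obtain z where z: "z \<in> carrier E" "v = t_power (Suc l) \<odot>\<^bsub>E\<^esub> z" by (auto simp: red_kernel_def t_power_def)
  thus "f \<odot>\<^bsub>E\<^esub> v \<in> red_kernel E l"
    by (auto simp: red_kernel_iff E.scale_mult[symmetric] mult.commute intro!: bexI[of _ "f \<odot>\<^bsub>E\<^esub> z"])
qed (auto simp: red_kernel_def intro!: image_eqI[of _ _ "\<zero>\<^bsub>E\<^esub>"])

lemma lincomb_red_kernel: "lincomb E J b a \<in> red_kernel E l \<longleftrightarrow> (\<forall>j\<in>J. t_power (Suc l) dvd a j)"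
proof
  assume "lincomb E J b a \<in> red_kernel E l"
  then obtain z where z: "z \<in> carrier E" "lincomb E J b a = t_power (Suc l) \<odot>\<^bsub>E\<^esub> z"
    using b by (auto simp: red_kernel_iff)
  obtain c where "z = lincomb E J b c" using z(1) basis by (auto simp: basis_on_def)
  hence "lincomb E J b a = lincomb E J b (\<lambda>j. t_power (Suc l) * c j)"
    using z b J by (simp add: E.lincomb_scale)
  from E.basis_on_unique[OF basis this] show "\<forall>j\<in>J. t_power (Suc l) dvd a j" by auto
next
  assume "\<forall>j\<in>J. t_power (Suc l) dvd a j"
  hence "\<forall>j\<in>J. \<exists>c. a j = t_power (Suc l) * c" by (auto simp: dvd_def)
  then obtain c where "\<forall>j\<in>J. a j = t_power (Suc l) * c j" by metis
  hence "lincomb E J b a = t_power (Suc l) \<odot>\<^bsub>E\<^esub> lincomb E J b c"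
    using b J by (simp add: E.lincomb_scale cong: E.lincomb_cong)
  thus "lincomb E J b a \<in> red_kernel E l" using b by (auto simp: red_kernel_iff)
qed

text \<open>Coordinates with respect to the basis \<open>b\<close> multiplied by the gauge factors. They are coordinates only
  modulo \<open>t\<^sup>l\<^sup>+\<^sup>1\<close>, since the factors are units only modulo \<open>t\<^sup>l\<^sup>+\<^sup>1\<close>.\<close>

definition twist :: "nat \<Rightarrow> ('i \<Rightarrow> 'c fps fls) \<Rightarrow> 'e" where
  "twist l a = lincomb E J b (\<lambda>j. a j * gauge (\<phi> j) l)"

definition vec :: "nat \<Rightarrow> ('i \<Rightarrow> 'c fps fls) \<Rightarrow> 'e set" where
  "vec l a = red_kernel E l +>\<^bsub>E\<^esub> twist l a"

lemma twist_closed [simp]: "twist l a \<in> carrier E"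
  unfolding twist_def using b by simp

lemma vec_closed [simp]: "vec l a \<in> carrier (reduction E l)"
  by (auto simp: reduction_def E.quotient_carrier[OF red_kernel_submodule] vec_def)

lemma coset_lincomb_eq_iff:
  "red_kernel E l +>\<^bsub>E\<^esub> lincomb E J b a = red_kernel E l +>\<^bsub>E\<^esub> lincomb E J b a' \<longleftrightarrow>
    (\<forall>j\<in>J. t_power (Suc l) dvd a j - a' j)"
  using b by (subst E.coset_eq_iff[OF red_kernel_submodule])
    (auto simp: E.lincomb_diff lincomb_red_kernel)

lemma vec_eq_iff: "vec l a = vec l a' \<longleftrightarrow> (\<forall>j\<in>J. t_power (Suc l) dvd a j - a' j)"
proof -
  have "t_power (Suc l) dvd a j * gauge (\<phi> j) l - a' j * gauge (\<phi> j) l \<longleftrightarrow> t_power (Suc l) dvd a j - a' j"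
    if j: "j \<in> J" for j
  proof
    obtain u' where u': "t_power (Suc l) dvd gauge (\<phi> j) l * u' - 1"
      using gauge(3)[OF polar[OF j], of l] by blast
    assume "t_power (Suc l) dvd a j * gauge (\<phi> j) l - a' j * gauge (\<phi> j) l"
    hence "t_power (Suc l) dvd (a j * gauge (\<phi> j) l - a' j * gauge (\<phi> j) l) * u'
        - (a j - a' j) * (gauge (\<phi> j) l * u' - 1)"
      by (rule dvd_diff[OF dvd_mult2 dvd_mult[OF u']])
    also have "(a j * gauge (\<phi> j) l - a' j * gauge (\<phi> j) l) * u'
        - (a j - a' j) * (gauge (\<phi> j) l * u' - 1) = a j - a' j" by (simp add: algebra_simps)
    finally show "t_power (Suc l) dvd a j - a' j" .
  next
    assume "t_power (Suc l) dvd a j - a' j"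
    hence "t_power (Suc l) dvd (a j - a' j) * gauge (\<phi> j) l" by (rule dvd_mult2)
    thus "t_power (Suc l) dvd a j * gauge (\<phi> j) l - a' j * gauge (\<phi> j) l" by (simp add: algebra_simps)
  qed
  thus ?thesis unfolding vec_def twist_def coset_lincomb_eq_iff by blast
qed

lemma vec_cong: "(\<And>j. j \<in> J \<Longrightarrow> a j = a' j) \<Longrightarrow> vec l a = vec l a'"
  by (simp add: vec_eq_iff)

lemma vec_surj:
  assumes "Y \<in> carrier (reduction E l)"
  obtains a where "Y = vec l a"
proof -
  obtain v where v: "v \<in> carrier E" "Y = red_kernel E l +>\<^bsub>E\<^esub> v"
    using assms by (auto simp: reduction_def E.quotient_carrier[OF red_kernel_submodule])
  obtain c where c: "v = lincomb E J b c" using v(1) basis by (auto simp: basis_on_def)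
  have "\<forall>j. \<exists>u'. j \<in> J \<longrightarrow> t_power (Suc l) dvd gauge (\<phi> j) l * u' - 1" using gauge(3)[OF polar, of _ l] by blast
  then obtain u' where u': "\<And>j. j \<in> J \<Longrightarrow> t_power (Suc l) dvd gauge (\<phi> j) l * u' j - 1" by metis
  have "t_power (Suc l) dvd c j - c j * u' j * gauge (\<phi> j) l" if "j \<in> J" for j
  proof -
    have "t_power (Suc l) dvd - c j * (gauge (\<phi> j) l * u' j - 1)" using u'[OF that] by (rule dvd_mult)
    thus ?thesis by (simp add: algebra_simps)
  qed
  hence "Y = vec l (\<lambda>j. c j * u' j)"
    unfolding v c vec_def twist_def coset_lincomb_eq_iff by blast
  thus thesis by (rule that)
qed

lemma vec_add: "vec l a \<oplus>\<^bsub>reduction E l\<^esub> vec l a' = vec l (\<lambda>j. a j + a' j)"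
  unfolding vec_def reduction_def
  by (subst E.quotient_add[OF red_kernel_submodule])
    (use b in \<open>auto simp: twist_def E.lincomb_add distrib_right\<close>)

lemma vec_scale: "f \<odot>\<^bsub>reduction E l\<^esub> vec l a = vec l (\<lambda>j. f * a j)"
  unfolding vec_def reduction_def
  by (subst E.quotient_scale[OF red_kernel_submodule])
    (use b J in \<open>auto simp: twist_def E.lincomb_scale mult.assoc\<close>)

lemma vec_zero: "(\<And>j. j \<in> J \<Longrightarrow> a j = 0) \<Longrightarrow> vec l a = \<zero>\<^bsub>reduction E l\<^esub>"
  unfolding vec_def reduction_def E.quotient_zero[OF red_kernel_submodule] twist_def
  using b by (subst E.lincomb_zero) auto

lemma transition_coset: "v \<in> carrier E \<Longrightarrow>
    transition E l (red_kernel E (Suc l) +>\<^bsub>E\<^esub> v) = red_kernel E l +>\<^bsub>E\<^esub> v"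
  unfolding transition_def
proof (rule E.coset_map_coset[OF red_kernel_submodule red_kernel_submodule])
  fix k assume "k \<in> red_kernel E (Suc l)"
  then obtain z where "z \<in> carrier E" "k = t_power (Suc (Suc l)) \<odot>\<^bsub>E\<^esub> z"
    by (auto simp: red_kernel_def t_power_def)
  moreover have "t_power (Suc (Suc l)) = t_power (Suc l) * (t_power 1 :: 'c fps fls)"
    by (simp add: t_power_def fls_const_mult_const mult_ac)
  ultimately show "k \<in> red_kernel E l"
    by (auto simp: red_kernel_iff E.scale_mult intro!: bexI[of _ "t_power 1 \<odot>\<^bsub>E\<^esub> z"])
qed auto

lemma vec_transition: "transition E l (vec (Suc l) a) = vec l a"
proof -
  have "t_power (Suc l) dvd a j * gauge (\<phi> j) (Suc l) - a j * gauge (\<phi> j) l" if "j \<in> J" for j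
    using dvd_mult[OF gauge(1)[OF polar[OF that]], of l "a j"] by (simp add: algebra_simps)
  thus ?thesis unfolding vec_def transition_coset[OF twist_closed]
    by (auto simp: twist_def coset_lincomb_eq_iff)
qed

lemma Drs_lincomb: "Drs (lincomb E J b a) = lincomb E J b (\<lambda>j. theta_fls (a j) + (\<Sum>i\<in>J. fls_const (A j i) * a i))"
  by (rule E.connection_lincomb[OF Drs_closed Drs_add Drs_leib J b Drs_b])

abbreviation f0 :: "'i \<Rightarrow> 'c fls" where "f0 j \<equiv> t_coeff 0 (\<phi> j)"

text \<open>The effect of the gauge factors: the polar parts \<open>\<phi> j\<close> are replaced by their values \<open>f0 j\<close> at \<open>t = 0\<close>,
  while the constant matrix \<open>A\<close> does not change.\<close>

lemma D_vec: "reduction_connection E D l (vec l a)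
    = vec l (\<lambda>j. theta_fls (a j) + fls_map_const (f0 j) * a j + (\<Sum>i\<in>J. fls_const (A j i) * a i))"
proof -
  let ?u = "\<lambda>j. gauge (\<phi> j) l"
  have "reduction_connection E D l (vec l a) = red_kernel E l +>\<^bsub>E\<^esub> D (twist l a)"
    unfolding reduction_connection_def vec_def
  proof (rule E.coset_map_coset[OF red_kernel_submodule red_kernel_submodule _ D_closed D_add])
    fix k assume "k \<in> red_kernel E l"
    then obtain z where z: "z \<in> carrier E" "k = t_power (Suc l) \<odot>\<^bsub>E\<^esub> z"
      by (auto simp: red_kernel_def t_power_def)
    moreover have "D z \<in> carrier E" using D_closed z by auto
    ultimately have "D k = t_power (Suc l) \<odot>\<^bsub>E\<^esub> D z" by (simp add: D_leib t_power_def)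
    thus "D k \<in> red_kernel E l" using \<open>D z \<in> carrier E\<close> by (auto simp: red_kernel_iff)
  qed auto
  also have "D (twist l a) = lincomb E J b (\<lambda>j. theta_fls (a j * ?u j)
      + (\<Sum>i\<in>J. (fls_const (A j i) + (if j = i then \<phi> i else 0)) * (a i * ?u i)))"
    unfolding twist_def by (rule E.connection_lincomb[OF D_closed D_add D_leib J b D_b])
  also have "red_kernel E l +>\<^bsub>E\<^esub> \<dots>
      = vec l (\<lambda>j. theta_fls (a j) + fls_map_const (f0 j) * a j + (\<Sum>i\<in>J. fls_const (A j i) * a i))"
    unfolding vec_def twist_def coset_lincomb_eq_iff
  proof
    fix j assume j: "j \<in> J"
    have "(\<Sum>i\<in>J. (fls_const (A j i) + (if j = i then \<phi> i else 0)) * (a i * ?u i))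
        = (\<Sum>i\<in>J. fls_const (A j i) * a i * ?u j + (if j = i then \<phi> j * a j * ?u j else 0))"
    proof (intro sum.cong refl)
      fix i assume i: "i \<in> J"
      have "A j i = 0 \<or> \<phi> i = \<phi> j" using A_off[OF i j] by (cases "j = i"; cases "A j i = 0") auto
      thus "(fls_const (A j i) + (if j = i then \<phi> i else 0)) * (a i * ?u i)
          = fls_const (A j i) * a i * ?u j + (if j = i then \<phi> j * a j * ?u j else 0)"
        by (auto simp: algebra_simps)
    qed
    also have "\<dots> = (\<Sum>i\<in>J. fls_const (A j i) * a i) * ?u j + \<phi> j * a j * ?u j"
      using j J by (simp add: sum.distrib sum_distrib_right)
    finally have "theta_fls (a j * ?u j) + (\<Sum>i\<in>J. (fls_const (A j i) + (if j = i then \<phi> i else 0)) * (a i * ?u i))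
        - (theta_fls (a j) + fls_map_const (f0 j) * a j + (\<Sum>i\<in>J. fls_const (A j i) * a i)) * ?u j
        = a j * (theta_fls (?u j) + (\<phi> j - fls_map_const (f0 j)) * ?u j)"
      by (simp add: theta_fls_mult algebra_simps)
    thus "t_power (Suc l) dvd theta_fls (a j * ?u j)
        + (\<Sum>i\<in>J. (fls_const (A j i) + (if j = i then \<phi> i else 0)) * (a i * ?u i))
        - (theta_fls (a j) + fls_map_const (f0 j) * a j + (\<Sum>i\<in>J. fls_const (A j i) * a i)) * ?u j"
      using gauge(2)[OF polar[OF j]] by simp
  qed
  finally show ?thesis .
qed

definition single :: "nat \<Rightarrow> 'i \<Rightarrow> 'c fps fls \<Rightarrow> 'e set" where
  "single l j a = vec l (\<lambda>i. if i = j then a else 0)"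

lemma single_closed [simp]: "single l j a \<in> carrier (reduction E l)"
  by (simp add: single_def)

lemma vec_mem:
  assumes zero: "\<zero>\<^bsub>reduction E l\<^esub> \<in> U"
    and add: "\<And>v w. v \<in> U \<Longrightarrow> w \<in> U \<Longrightarrow> v \<oplus>\<^bsub>reduction E l\<^esub> w \<in> U"
    and c: "\<And>i. i \<in> J \<Longrightarrow> single l i (c i) \<in> U"
  shows "vec l c \<in> U"
proof -
  have "vec l (\<lambda>i. if i \<in> I then c i else 0) \<in> U" if "I \<subseteq> J" for I
    using finite_subset[OF that J] that
  proof (induction I)
    case empty
    show ?case using zero by (simp add: vec_zero)
  next
    case (insert x I)
    have "vec l (\<lambda>i. if i \<in> insert x I then c i else 0)
        = single l x (c x) \<oplus>\<^bsub>reduction E l\<^esub> vec l (\<lambda>i. if i \<in> I then c i else 0)"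
      unfolding single_def vec_add using insert by (intro vec_cong) auto
    thus ?case using insert c add by auto
  qed
  from this[of J] have "vec l (\<lambda>i. if i \<in> J then c i else 0) \<in> U" by simp
  thus ?thesis by (subst vec_cong[of _ "\<lambda>i. if i \<in> J then c i else 0"]) auto
qed

text \<open>
  Applied to a basis vector times a power of \<open>t\<close>, the matrix \<open>A - A\<^sub>j\<^sub>j(0)\<close> raises the power of \<open>t\<close> or
  the rank, and both are bounded. So the basis vectors and their multiples lie in a set \<open>U\<close> as soon as
  a vector lies in \<open>U\<close> whenever its image under this nilpotent matrix does. The predicate \<open>Q\<close> confines
  the induction to a part of the basis that the matrix preserves.
\<close>

lemma single_induct:
  assumes zero: "\<zero>\<^bsub>reduction E l\<^esub> \<in> U"
    and add: "\<And>v w. v \<in> U \<Longrightarrow> w \<in> U \<Longrightarrow> v \<oplus>\<^bsub>reduction E l\<^esub> w \<in> U"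
    and step: "\<And>j r. j \<in> J \<Longrightarrow> Q j \<Longrightarrow>
      vec l (\<lambda>i. fls_const (A i j * r - (if i = j then fps_const (fps_nth (A j j) 0) * r else 0))) \<in> U \<Longrightarrow>
      single l j (fls_const r) \<in> U"
    and Q: "\<And>i j. i \<in> J \<Longrightarrow> j \<in> J \<Longrightarrow> i \<noteq> j \<Longrightarrow> A i j \<noteq> 0 \<Longrightarrow> Q j \<Longrightarrow> Q i"
    and scale: "\<And>k v. v \<in> U \<Longrightarrow> fls_map_const (t_coeff k a) \<odot>\<^bsub>reduction E l\<^esub> v \<in> U"
    and j: "j \<in> J" "Q j"
  shows "single l j a \<in> U"
proof -
  define N where "N = Suc (Max (rank ` J))"
  have rank_N: "rank i < N" if "i \<in> J" for i using that J by (simp add: N_def less_Suc_eq_le)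
  have const: "single l j (fls_const (fps_X ^ k * r)) \<in> U"
    if "(Suc l - k) + (N - rank j) = m" "j \<in> J" "Q j" for m k j r
    using that
  proof (induction m arbitrary: k j r rule: less_induct)
    case (less m)
    show ?case
    proof (cases "k < Suc l")
      case False
      hence "single l j (fls_const (fps_X ^ k * r)) = vec l (\<lambda>_. 0)"
        unfolding single_def vec_eq_iff t_power_dvd_iff by (auto simp: fps_X_power_mult_nth)
      thus ?thesis using zero by (simp add: vec_zero)
    next
      case True
      have "vec l (\<lambda>i. fls_const (A i j * (fps_X ^ k * r)
          - (if i = j then fps_const (fps_nth (A j j) 0) * (fps_X ^ k * r) else 0))) \<in> U"
      proof (rule vec_mem[OF zero add])
        fix i assume i: "i \<in> J"
        consider "i = j" | "i \<noteq> j" "A i j = 0" | "i \<noteq> j" "A i j \<noteq> 0" by blast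
        thus "single l i (fls_const (A i j * (fps_X ^ k * r)
            - (if i = j then fps_const (fps_nth (A j j) 0) * (fps_X ^ k * r) else 0))) \<in> U"
        proof cases
          case 1
          have "A j j - fps_const (fps_nth (A j j) 0) = fps_X * fps_shift 1 (A j j)"
            by (rule fps_ext) simp
          hence eq: "A j j * (fps_X ^ k * r) - fps_const (fps_nth (A j j) 0) * (fps_X ^ k * r)
              = fps_X ^ Suc k * (fps_shift 1 (A j j) * r)"
            by (simp add: left_diff_distrib[symmetric])
          have "single l j (fls_const (fps_X ^ Suc k * (fps_shift 1 (A j j) * r))) \<in> U"
            using less.prems True by (intro less.IH[OF _ refl]) auto
          thus ?thesis using 1 eq by (simp del: power_Suc)
        next
          case 2
          thus ?thesis using zero by (simp add: single_def vec_zero)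
        next
          case 3
          have "rank j < rank i" using A_off[of j i] 3 less.prems i by auto
          hence "single l i (fls_const (fps_X ^ k * (A i j * r))) \<in> U"
            using less.prems 3 i Q[of i j] rank_N[OF i] by (intro less.IH[OF _ refl]) auto
          thus ?thesis using 3 by (simp add: mult_ac)
        qed
      qed
      thus ?thesis using less.prems by (intro step)
    qed
  qed
  have sing: "single l j (t_power k) \<in> U" for k
    using const[OF refl j, of k 1] by (simp add: t_power_def)
  have "single l j (\<Sum>k<m. fls_map_const (t_coeff k a) * t_power k) \<in> U" for m
  proof (induction m)
    case 0
    show ?case using zero by (simp add: single_def vec_zero)
  next
    case (Suc m)
    have "single l j (\<Sum>k<Suc m. fls_map_const (t_coeff k a) * t_power k)
        = single l j (\<Sum>k<m. fls_map_const (t_coeff k a) * t_power k)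
          \<oplus>\<^bsub>reduction E l\<^esub> fls_map_const (t_coeff m a) \<odot>\<^bsub>reduction E l\<^esub> single l j (t_power m)"
      unfolding single_def vec_scale vec_add by (intro vec_cong) auto
    thus ?case using Suc sing add scale by auto
  qed
  moreover have "single l j a = single l j (\<Sum>k<Suc l. fls_map_const (t_coeff k a) * t_power k)"
    using t_expansion[of l a] unfolding single_def vec_eq_iff by (auto simp: lessThan_Suc_atMost)
  ultimately show ?thesis by (simp del: sum.lessThan_Suc)
qed

end

context adapted_basis
begin

section \<open>The regular-singular part of a reduction\<close>

lemma reduction_C_simps:
  "carrier (reduction_C E l) = carrier (reduction E l)"
  "\<zero>\<^bsub>reduction_C E l\<^esub> = \<zero>\<^bsub>reduction E l\<^esub>"
  "v \<oplus>\<^bsub>reduction_C E l\<^esub> w = v \<oplus>\<^bsub>reduction E l\<^esub> w"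
  "g \<odot>\<^bsub>reduction_C E l\<^esub> v = fls_map_const g \<odot>\<^bsub>reduction E l\<^esub> v"
  by (simp_all add: reduction_C_def restrict_scalars_def)

lemma vec_add_C: "vec l a \<oplus>\<^bsub>reduction_C E l\<^esub> vec l a' = vec l (\<lambda>j. a j + a' j)"
  by (simp add: reduction_C_simps vec_add)

lemma vec_scale_C: "g \<odot>\<^bsub>reduction_C E l\<^esub> vec l a = vec l (\<lambda>j. fls_map_const g * a j)"
  by (simp add: reduction_C_simps vec_scale)

text \<open>The eigenvectors of \<open>P_red\<close> for \<open>f0 j\<close> form a set \<open>U\<close> to which the induction above applies: by the
  eigenspace lemma, \<open>v \<in> U\<close> follows from \<open>(D - c - f0 j) v \<in> U\<close>, where \<open>c = A\<^sub>i\<^sub>i(0)\<close>.\<close>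

lemma P_red_single:
  assumes ld: "log_decomposition_red E D l Drs_red P_red" and j: "j \<in> J"
  shows "P_red (single l j a) = single l j (fls_map_const (f0 j) * a)"
proof -
  let ?M = "reduction_C E l"
  note ld' = ld[unfolded log_decomposition_red_def]
  have P: "linear_map ?M ?M P_red" and Drs: "MC_rs ?M Drs_red"
    using ld' by (auto simp: log_decomposition_alg_def)
  interpret M: type_module ?M
    using Drs by (intro type_module.intro) (simp add: MC_rs_def MC_def connection_def)
  have P': "P_red (v \<oplus>\<^bsub>?M\<^esub> w) = P_red v \<oplus>\<^bsub>?M\<^esub> P_red w" "P_red (g \<odot>\<^bsub>?M\<^esub> v) = g \<odot>\<^bsub>?M\<^esub> P_red v"
    if "v \<in> carrier ?M" "w \<in> carrier ?M" for v w g
    using P that by (auto simp: linear_map_def)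
  have Pc: "P_red \<in> carrier ?M \<rightarrow> carrier ?M" using P by (simp add: linear_map_def)
  define U where "U = {v \<in> carrier ?M. P_red v = f0 j \<odot>\<^bsub>?M\<^esub> v}"
  have U_scale: "g \<odot>\<^bsub>?M\<^esub> v \<in> U" if "v \<in> U" for g v
  proof -
    have v: "v \<in> carrier ?M" "P_red v = f0 j \<odot>\<^bsub>?M\<^esub> v" using that by (auto simp: U_def)
    thus ?thesis by (auto simp: U_def P' M.scale_mult[symmetric] mult.commute)
  qed
  have "single l j a \<in> U"
  proof (rule single_induct[where Q = "\<lambda>i. \<phi> i = \<phi> j"])
    have "P_red \<zero>\<^bsub>?M\<^esub> = \<zero>\<^bsub>?M\<^esub>"
      using M.additive_finsum[OF Pc P'(1), of "{}" "\<lambda>_. \<zero>\<^bsub>?M\<^esub>"] by simp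
    thus "\<zero>\<^bsub>reduction E l\<^esub> \<in> U" by (simp add: U_def reduction_C_simps(2)[symmetric])
    fix v w assume "v \<in> U" "w \<in> U"
    hence "v \<oplus>\<^bsub>?M\<^esub> w \<in> U" by (auto simp: U_def P' M.scale_add_right)
    thus "v \<oplus>\<^bsub>reduction E l\<^esub> w \<in> U" by (simp add: reduction_C_simps)
  next
    fix k v assume "v \<in> U"
    thus "fls_map_const (t_coeff k a) \<odot>\<^bsub>reduction E l\<^esub> v \<in> U"
      using U_scale[of v "t_coeff k a"] by (simp add: reduction_C_simps)
  next
    fix i r assume i: "i \<in> J" "\<phi> i = \<phi> j"
    let ?w = "vec l (\<lambda>k. fls_const (A k i * r - (if k = i then fps_const (fps_nth (A i i) 0) * r else 0)))"
    assume w: "?w \<in> U"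
    have eq: "reduction_connection E D l (single l i (fls_const r))
        = ?w \<oplus>\<^bsub>?M\<^esub> (fls_const (fps_nth (A i i) 0) + f0 j) \<odot>\<^bsub>?M\<^esub> single l i (fls_const r)"
      unfolding single_def vec_add_C vec_scale_C D_vec
    proof (rule vec_cong)
      fix k assume "k \<in> J"
      have "(\<Sum>m\<in>J. fls_const (A k m) * (if m = i then fls_const r else 0)) = fls_const (A k i) * fls_const r"
        using J i by (simp add: if_distrib cong: if_cong)
      thus "theta_fls (if k = i then fls_const r else 0) + fls_map_const (f0 k) * (if k = i then fls_const r else 0)
          + (\<Sum>m\<in>J. fls_const (A k m) * (if m = i then fls_const r else 0))
          = fls_const (A k i * r - (if k = i then fps_const (fps_nth (A i i) 0) * r else 0))
          + fls_map_const (fls_const (fps_nth (A i i) 0) + f0 j) * (if k = i then fls_const r else 0)"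
        using i(2) by (simp add: fls_map_const_simps fls_const_mult_const fls_plus_const algebra_simps)
    qed
    have "P_red (single l i (fls_const r)) = f0 j \<odot>\<^bsub>?M\<^esub> single l i (fls_const r)"
      by (rule log_decomposition_alg_eigenspace[OF ld' t_coeff_polar[OF polar[OF j]] _ _ eq])
        (use w in \<open>auto simp: U_def reduction_C_simps(1)\<close>)
    thus "single l i (fls_const r) \<in> U" by (simp add: U_def reduction_C_simps(1))
  qed (use j A_off in auto)
  thus ?thesis by (auto simp: U_def single_def vec_scale_C intro!: vec_cong)
qed

lemma P_red_vec:
  assumes ld: "log_decomposition_red E D l Drs_red P_red"
  shows "P_red (vec l a) = vec l (\<lambda>j. fls_map_const (f0 j) * a j)"
proof -
  let ?M = "reduction_C E l"
  have P: "linear_map ?M ?M P_red" and Drs: "MC_rs ?M Drs_red"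
    using ld by (auto simp: log_decomposition_red_def log_decomposition_alg_def)
  interpret M: type_module ?M
    using Drs by (intro type_module.intro) (simp add: MC_rs_def MC_def connection_def)
  have P': "P_red (v \<oplus>\<^bsub>?M\<^esub> w) = P_red v \<oplus>\<^bsub>?M\<^esub> P_red w"
    if "v \<in> carrier ?M" "w \<in> carrier ?M" for v w
    using P that by (auto simp: linear_map_def)
  have Pc: "P_red \<in> carrier ?M \<rightarrow> carrier ?M" using P by (simp add: linear_map_def)
  have *: "P_red (vec l (\<lambda>i. if i \<in> I then a i else 0)) = vec l (\<lambda>i. if i \<in> I then fls_map_const (f0 i) * a i else 0)"
    if "I \<subseteq> J" for I
    using finite_subset[OF that J] that
  proof (induction I)
    case empty
    have "P_red \<zero>\<^bsub>?M\<^esub> = \<zero>\<^bsub>?M\<^esub>"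
      using M.additive_finsum[OF Pc P', of "{}" "\<lambda>_. \<zero>\<^bsub>?M\<^esub>"] by simp
    thus ?case by (simp add: vec_zero reduction_C_simps)
  next
    case (insert x I)
    have "vec l (\<lambda>i. if i \<in> insert x I then a i else 0) = single l x (a x) \<oplus>\<^bsub>?M\<^esub> vec l (\<lambda>i. if i \<in> I then a i else 0)"
      unfolding single_def vec_add_C using insert by (intro vec_cong) auto
    hence "P_red (vec l (\<lambda>i. if i \<in> insert x I then a i else 0))
        = single l x (fls_map_const (f0 x) * a x) \<oplus>\<^bsub>?M\<^esub> vec l (\<lambda>i. if i \<in> I then fls_map_const (f0 i) * a i else 0)"
      using insert by (simp add: P' P_red_single[OF ld] reduction_C_simps(1))
    also have "\<dots> = vec l (\<lambda>i. if i \<in> insert x I then fls_map_const (f0 i) * a i else 0)"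
      unfolding single_def vec_add_C using insert by (intro vec_cong) auto
    finally show ?case .
  qed
  have "vec l a = vec l (\<lambda>i. if i \<in> J then a i else 0)" by (intro vec_cong) simp
  also have "P_red \<dots> = vec l (\<lambda>i. if i \<in> J then fls_map_const (f0 i) * a i else 0)" by (rule *) simp
  also have "\<dots> = vec l (\<lambda>j. fls_map_const (f0 j) * a j)" by (intro vec_cong) simp
  finally show ?thesis .
qed

text \<open>Although \<open>Drs_red\<close> is not the reduction of \<open>Drs\<close>, it has the same constant matrix as \<open>Drs\<close>, with respect
  to the twisted basis.\<close>

lemma Drs_red_vec:
  assumes ld: "log_decomposition_red E D l Drs_red P_red"
  shows "Drs_red (vec l a) = vec l (\<lambda>j. theta_fls (a j) + (\<Sum>i\<in>J. fls_const (A j i) * a i))"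
proof -
  let ?M = "reduction_C E l"
  have Drs: "MC_rs ?M Drs_red"
    and sum: "reduction_connection E D l (vec l a) = Drs_red (vec l a) \<oplus>\<^bsub>?M\<^esub> P_red (vec l a)"
    using ld by (auto simp: log_decomposition_red_def log_decomposition_alg_def reduction_C_simps(1))
  have "Drs_red (vec l a) \<in> carrier ?M"
    using Drs by (auto simp: MC_rs_def MC_def connection_def reduction_C_simps(1))
  then obtain c where c: "Drs_red (vec l a) = vec l c"
    using vec_surj by (auto simp: reduction_C_simps(1))
  show ?thesis
    using sum unfolding c P_red_vec[OF ld] D_vec vec_add_C vec_eq_iff
  proof (intro ballI)
    fix j assume "j \<in> J" and *: "\<forall>j\<in>J. t_power (Suc l) dvd theta_fls (a j) + fls_map_const (f0 j) * a j
      + (\<Sum>i\<in>J. fls_const (A j i) * a i) - (c j + fls_map_const (f0 j) * a j)"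
    hence "t_power (Suc l) dvd - (theta_fls (a j) + fls_map_const (f0 j) * a j
      + (\<Sum>i\<in>J. fls_const (A j i) * a i) - (c j + fls_map_const (f0 j) * a j))" by (simp only: dvd_minus_iff)
    thus "t_power (Suc l) dvd c j - (theta_fls (a j) + (\<Sum>i\<in>J. fls_const (A j i) * a i))"
      by (simp add: algebra_simps)
  qed
qed

end

section \<open>Eigenvalues of residues\<close>

lemma linear_dependence:
  fixes c :: "'k \<Rightarrow> nat \<Rightarrow> 'a::field"
  assumes "finite S" "card S > n"
  shows "\<exists>d. (\<exists>k\<in>S. d k \<noteq> 0) \<and> (\<forall>i<n. (\<Sum>k\<in>S. d k * c k i) = 0)"
  using assms
proof (induction n arbitrary: S c)
  case 0
  then obtain k where "k \<in> S" by fastforce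
  thus ?case by (intro exI[of _ "\<lambda>_. 1"]) auto
next
  case (Suc n)
  show ?case
  proof (cases "\<forall>k\<in>S. c k n = 0")
    case True
    thus ?thesis using Suc.IH[of S] Suc.prems by (auto simp: less_Suc_eq)
  next
    case False
    then obtain k0 where k0: "k0 \<in> S" "c k0 n \<noteq> 0" by blast
    define S' where "S' = S - {k0}"
    have S': "finite S'" "card S' > n" "k0 \<notin> S'" using Suc.prems k0 by (auto simp: S'_def)
    have ins: "S = insert k0 S'" using k0 by (auto simp: S'_def)
    \<comment> \<open>Eliminate the last coordinate with the pivot \<open>k0\<close>.\<close>
    obtain d where d: "\<exists>k\<in>S'. d k \<noteq> 0"
      "\<And>i. i < n \<Longrightarrow> (\<Sum>k\<in>S'. d k * (c k i - c k n / c k0 n * c k0 i)) = 0"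
      using Suc.IH[OF S'(1,2), of "\<lambda>k i. c k i - c k n / c k0 n * c k0 i"] by blast
    define x where "x = - (\<Sum>k\<in>S'. d k * (c k n / c k0 n))"
    have *: "(\<Sum>k\<in>S. (d(k0 := x)) k * c k i) = (\<Sum>k\<in>S'. d k * (c k i - c k n / c k0 n * c k0 i))" for i
    proof -
      have "(\<Sum>k\<in>S'. (d(k0 := x)) k * c k i) = (\<Sum>k\<in>S'. d k * c k i)"
        using S'(3) by (intro sum.cong) auto
      hence "(\<Sum>k\<in>S. (d(k0 := x)) k * c k i) = x * c k0 i + (\<Sum>k\<in>S'. d k * c k i)"
        unfolding ins using S' by simp
      also have "\<dots> = (\<Sum>k\<in>S'. d k * (c k i - c k n / c k0 n * c k0 i))"
        unfolding x_def by (simp add: sum_distrib_left right_diff_distrib sum_subtractf mult_ac)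
      finally show ?thesis .
    qed
    have "(\<Sum>k\<in>S. (d(k0 := x)) k * c k i) = 0" if "i < Suc n" for i
      unfolding * using d(2)[of i] that k0(2) by (cases "i = n") (auto simp: less_Suc_eq)
    moreover have "\<exists>k\<in>S. (d(k0 := x)) k \<noteq> 0" using d(1) S'(3) ins by (metis fun_upd_other insertI2)
    ultimately show ?thesis by blast
  qed
qed

definition (in type_module) poly_apply :: "('a::zero \<Rightarrow> 'k) \<Rightarrow> ('m \<Rightarrow> 'm) \<Rightarrow> 'a poly \<Rightarrow> 'm \<Rightarrow> 'm" where
  "poly_apply \<kappa> T p = fold_coeffs (\<lambda>a f v. \<kappa> a \<odot>\<^bsub>M\<^esub> v \<oplus>\<^bsub>M\<^esub> f (T v)) p (\<lambda>v. \<zero>\<^bsub>M\<^esub>)"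

text \<open>A consequence of the theorem of Cayley and Hamilton for the residue of \<open>T\<close>, the map that it induces on
  \<open>L/xL\<close>. This space is of finite dimension over \<open>C\<close>, so \<open>v\<close> is killed by a non-zero polynomial
  in the residue. The polynomial splits, and a linear factor \<open>X - a\<close> can be dropped unless \<open>a\<close> is an
  eigenvalue of the residue.\<close>

lemma annihilating_product:
  fixes L :: "('c::alg_closed_field fps, 'l) module"
  assumes L: "is_module L" and fg: "finitely_generated L"
    and T: "T \<in> carrier L \<rightarrow> carrier L"
    and add: "\<And>v w. v \<in> carrier L \<Longrightarrow> w \<in> carrier L \<Longrightarrow> T (v \<oplus>\<^bsub>L\<^esub> w) = T v \<oplus>\<^bsub>L\<^esub> T w"
    and leib: "\<And>f v. v \<in> carrier L \<Longrightarrow> T (f \<odot>\<^bsub>L\<^esub> v) = theta_fps f \<odot>\<^bsub>L\<^esub> v \<oplus>\<^bsub>L\<^esub> f \<odot>\<^bsub>L\<^esub> T v"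
    and eig: "\<And>a v w. v \<in> carrier L \<Longrightarrow> v \<notin> (\<lambda>v. fps_X \<odot>\<^bsub>L\<^esub> v) ` carrier L \<Longrightarrow>
      w \<in> (\<lambda>v. fps_X \<odot>\<^bsub>L\<^esub> v) ` carrier L \<Longrightarrow> T v = fps_const a \<odot>\<^bsub>L\<^esub> v \<oplus>\<^bsub>L\<^esub> w \<Longrightarrow> a \<in> \<tau>"
    and v: "v \<in> carrier L"
  shows "\<exists>cs. set cs \<subseteq> \<tau> \<and>
    fold (\<lambda>c u. T u \<oplus>\<^bsub>L\<^esub> fps_const (- c) \<odot>\<^bsub>L\<^esub> u) cs v \<in> (\<lambda>v. fps_X \<odot>\<^bsub>L\<^esub> v) ` carrier L"
proof -
  interpret type_module L by (rule type_module.intro[OF L])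
  let ?XL = "(\<lambda>v. fps_X \<odot>\<^bsub>L\<^esub> v) ` carrier L"
  let ?p = "poly_apply fps_const T"
  have T_closed: "T v \<in> carrier L" if "v \<in> carrier L" for v using T that by auto
  have T_const: "T (fps_const a \<odot>\<^bsub>L\<^esub> v) = fps_const a \<odot>\<^bsub>L\<^esub> T v" if "v \<in> carrier L" for a v
    using that T_closed by (simp add: leib theta_fps_def)
  have p_0: "?p 0 v = \<zero>\<^bsub>L\<^esub>" for v by (simp add: poly_apply_def)
  have p_pCons: "?p (pCons a p) v = fps_const a \<odot>\<^bsub>L\<^esub> v \<oplus>\<^bsub>L\<^esub> ?p p (T v)" if "v \<in> carrier L" for a p v
    using that by (cases "p = 0 \<and> a = 0") (auto simp: poly_apply_def)
  have p_closed: "v \<in> carrier L \<Longrightarrow> ?p p v \<in> carrier L" for p v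
    by (induction p arbitrary: v) (simp_all add: p_0 p_pCons T_closed)
  have p_add: "v \<in> carrier L \<Longrightarrow> ?p (p + q) v = ?p p v \<oplus>\<^bsub>L\<^esub> ?p q v" for p q v
    by (induction p q arbitrary: v rule: poly_induct2)
      (simp_all add: p_0 p_pCons T_closed p_closed fps_const_add[symmetric] scale_add_left M.a_ac del: fps_const_add)
  have p_smult: "v \<in> carrier L \<Longrightarrow> ?p (smult c p) v = fps_const c \<odot>\<^bsub>L\<^esub> ?p p v" for c p v
    by (induction p arbitrary: v)
      (simp_all add: p_0 p_pCons T_closed p_closed fps_const_mult[symmetric] scale_mult scale_add_right del: fps_const_mult)
  have p_T: "v \<in> carrier L \<Longrightarrow> T (?p p v) = ?p p (T v)" for p v
  proof (induction p arbitrary: v)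
    case 0
    have "T \<zero>\<^bsub>L\<^esub> = \<zero>\<^bsub>L\<^esub>" using additive_finsum[OF T add, of "{}" "\<lambda>_. v"] by simp
    thus ?case by (simp add: p_0)
  next
    case (pCons a p)
    thus ?case by (simp add: p_pCons T_closed p_closed add T_const)
  qed
  have p_addv: "v \<in> carrier L \<Longrightarrow> w \<in> carrier L \<Longrightarrow> ?p p (v \<oplus>\<^bsub>L\<^esub> w) = ?p p v \<oplus>\<^bsub>L\<^esub> ?p p w" for p v w
    by (induction p arbitrary: v w)
      (simp_all add: p_0 p_pCons T_closed p_closed add scale_add_right M.a_ac)
  have p_scalev: "v \<in> carrier L \<Longrightarrow> ?p p (fps_const c \<odot>\<^bsub>L\<^esub> v) = fps_const c \<odot>\<^bsub>L\<^esub> ?p p v" for c p v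
    by (induction p arbitrary: v)
      (simp_all add: p_0 p_pCons T_closed p_closed T_const scale_mult[symmetric] scale_add_right mult.commute)
  have p_linear: "?p ([:-a, 1:] * q) v = T (?p q v) \<oplus>\<^bsub>L\<^esub> fps_const (-a) \<odot>\<^bsub>L\<^esub> ?p q v"
    if "v \<in> carrier L" for a q v
  proof -
    have "[:-a, 1:] * q = smult (-a) q + pCons 0 q" by simp
    thus ?thesis using that
      by (simp add: p_add p_smult p_pCons p_T T_closed p_closed M.a_comm del: smult_minus_left)
  qed
  have ann: "\<exists>cs. set cs \<subseteq> \<tau> \<and> fold (\<lambda>c u. T u \<oplus>\<^bsub>L\<^esub> fps_const (- c) \<odot>\<^bsub>L\<^esub> u) cs v \<in> ?XL"
    if "v \<in> carrier L" "p \<noteq> 0" "?p p v \<in> ?XL" for p v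
    using that
  proof (induction "degree p" arbitrary: p v)
    case 0
    then obtain a where a: "p = [:a:]" "a \<noteq> 0" by (metis degree_eq_zeroE pCons_0_0)
    obtain w where w: "w \<in> carrier L" "fps_const a \<odot>\<^bsub>L\<^esub> v = fps_X \<odot>\<^bsub>L\<^esub> w"
      using 0 a by (auto simp: p_pCons p_0)
    have "v = fps_const (inverse a) \<odot>\<^bsub>L\<^esub> (fps_const a \<odot>\<^bsub>L\<^esub> v)"
      using a 0 by (simp add: scale_mult[symmetric])
    also have "\<dots> = fps_X \<odot>\<^bsub>L\<^esub> (fps_const (inverse a) \<odot>\<^bsub>L\<^esub> w)"
      using w by (simp add: scale_mult[symmetric] mult.commute)
    finally have "v \<in> ?XL" using w by auto
    thus ?case by (intro exI[of _ "[]"]) simp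
  next
    case (Suc n)
    obtain a where "poly p a = 0" using alg_closed_imp_poly_has_root[of p] Suc by auto
    then obtain q where q: "p = [:-a, 1:] * q" by (metis dvd_def poly_eq_0_iff_dvd)
    have q0: "q \<noteq> 0" using q Suc.prems by auto
    have "degree p = degree [:-a, 1:] + degree q" unfolding q using q0 by (intro degree_mult_eq) auto
    hence deg: "degree q = n" using Suc.hyps(2) by simp
    show ?case
    proof (cases "?p q v \<in> ?XL")
      case True
      thus ?thesis using Suc.hyps(1)[OF deg[symmetric] Suc.prems(1) q0] by blast
    next
      case False
      have in_XL: "T (?p q v) \<oplus>\<^bsub>L\<^esub> fps_const (-a) \<odot>\<^bsub>L\<^esub> ?p q v \<in> ?XL"
        using Suc.prems p_linear[of v a q] q by simp
      have "T (?p q v) = fps_const a \<odot>\<^bsub>L\<^esub> ?p q v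
          \<oplus>\<^bsub>L\<^esub> (T (?p q v) \<oplus>\<^bsub>L\<^esub> fps_const (-a) \<odot>\<^bsub>L\<^esub> ?p q v)"
        using Suc.prems(1) scale_minus_left[of "?p q v" "fps_const a"]
        by (simp add: p_closed T_closed M.a_lcomm[of "fps_const a \<odot>\<^bsub>L\<^esub> ?p q v"] M.r_neg)
      hence a: "a \<in> \<tau>" using False in_XL p_closed[OF Suc.prems(1)] by (intro eig[of "?p q v"]) auto
      let ?v = "T v \<oplus>\<^bsub>L\<^esub> fps_const (-a) \<odot>\<^bsub>L\<^esub> v"
      have "?p q ?v = T (?p q v) \<oplus>\<^bsub>L\<^esub> fps_const (-a) \<odot>\<^bsub>L\<^esub> ?p q v"
        using Suc.prems(1) by (simp add: p_addv p_scalev p_T T_closed p_closed)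
      hence "\<exists>cs. set cs \<subseteq> \<tau> \<and> fold (\<lambda>c u. T u \<oplus>\<^bsub>L\<^esub> fps_const (- c) \<odot>\<^bsub>L\<^esub> u) cs ?v \<in> ?XL"
        using in_XL Suc.prems(1) by (intro Suc.hyps(1)[OF deg[symmetric] _ q0]) (auto simp: T_closed)
      then obtain cs where "set cs \<subseteq> \<tau>" "fold (\<lambda>c u. T u \<oplus>\<^bsub>L\<^esub> fps_const (- c) \<odot>\<^bsub>L\<^esub> u) cs ?v \<in> ?XL" by blast
      thus ?thesis using a by (intro exI[of _ "a # cs"]) auto
    qed
  qed
  obtain n :: nat and e where e: "e \<in> {..<n} \<rightarrow> carrier L"
    and gen: "\<And>v. v \<in> carrier L \<Longrightarrow> \<exists>a. v = lincomb L {..<n} e a"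
    using fg unfolding finitely_generated_def lincomb_def by blast
  have Tk: "w \<in> carrier L \<Longrightarrow> (T ^^ k) w \<in> carrier L" for k w by (induction k) (auto simp: T_closed)
  have "\<forall>k. \<exists>c. (T ^^ k) v = lincomb L {..<n} e c" using gen Tk[OF v] by blast
  then obtain c where c: "\<And>k. (T ^^ k) v = lincomb L {..<n} e (c k)" by metis
  obtain d where d: "\<exists>k\<in>{..n}. d k \<noteq> 0" "\<And>i. i < n \<Longrightarrow> (\<Sum>k\<in>{..n}. d k * fps_nth (c k i) 0) = 0"
    using linear_dependence[of "{..n}" n "\<lambda>k i. fps_nth (c k i) 0"] by auto
  have shift: "f = fps_X * fps_shift 1 f" if "fps_nth f 0 = 0" for f :: "'c fps"
    using that by (intro fps_ext) simp
  define p where "p = (\<Sum>k\<in>{..n}. Polynomial.monom (d k) k)"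
  have p_monom: "w \<in> carrier L \<Longrightarrow> ?p (Polynomial.monom a k) w = fps_const a \<odot>\<^bsub>L\<^esub> (T ^^ k) w" for a k w
    by (induction k arbitrary: w) (simp_all add: p_0 p_pCons monom_0 monom_Suc T_closed Tk funpow_swap1)
  have "?p (\<Sum>k\<in>S. Polynomial.monom (d k) k) v = lincomb L {..<n} e (\<lambda>i. \<Sum>k\<in>S. fps_const (d k) * c k i)"
    if "finite S" for S
    using that
  proof induction
    case empty
    show ?case using e by (simp add: p_0 lincomb_zero)
  next
    case (insert k S)
    thus ?case using e v by (simp add: p_add p_monom c lincomb_scale lincomb_add)
  qed
  hence p_eq: "?p p v = lincomb L {..<n} e (\<lambda>i. \<Sum>k\<in>{..n}. fps_const (d k) * c k i)"
    unfolding p_def by simp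
  also have "\<dots> = lincomb L {..<n} e (\<lambda>i. fps_X * fps_shift 1 (\<Sum>k\<in>{..n}. fps_const (d k) * c k i))"
  proof (intro lincomb_cong e)
    fix i assume "i \<in> {..<n}"
    hence "fps_nth (\<Sum>k\<in>{..n}. fps_const (d k) * c k i) 0 = 0" using d(2) by (simp add: fps_sum_nth)
    thus "(\<Sum>k\<in>{..n}. fps_const (d k) * c k i) = fps_X * fps_shift 1 (\<Sum>k\<in>{..n}. fps_const (d k) * c k i)"
      by (rule shift)
  qed
  also have "\<dots> = fps_X \<odot>\<^bsub>L\<^esub> lincomb L {..<n} e (\<lambda>i. fps_shift 1 (\<Sum>k\<in>{..n}. fps_const (d k) * c k i))"
    using e by (simp add: lincomb_scale)
  finally have "?p p v \<in> ?XL" using e by auto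
  moreover have "p \<noteq> 0"
  proof
    assume "p = 0"
    obtain k where k: "k \<le> n" "d k \<noteq> 0" using d(1) by auto
    have "Polynomial.coeff p k = d k" using k by (simp add: p_def Polynomial.coeff_sum Polynomial.coeff_monom)
    thus False using k \<open>p = 0\<close> by simp
  qed
  ultimately show ?thesis using ann v by blast
qed

section \<open>Deligne-Manin lattices\<close>

lemma representatives_unique:
  fixes a :: "'c::field_char_0"
  assumes "representatives_mod_Ints \<tau>" "a \<in> \<tau>" "a + of_int m \<in> \<tau>"
  shows "m = 0"
proof -
  have "\<exists>!x. x \<in> \<tau> \<and> (a + of_int m) - x \<in> \<int>" using assms(1) by (simp add: representatives_mod_Ints_def)
  moreover have "(a + of_int m) - a \<in> \<int>" "(a + of_int m) - (a + of_int m) \<in> \<int>" by simp_all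
  ultimately have "a = a + of_int m" using assms(2,3) by blast
  thus ?thesis by simp
qed

lemma fps_mult_low:
  fixes g x :: "'c::comm_ring_1 fps"
  shows "(\<And>k. k \<le> l \<Longrightarrow> fps_nth x k = 0) \<Longrightarrow> k \<le> l \<Longrightarrow> fps_nth (g * x) k = 0"
  by (simp add: fps_mult_nth)

lemma fps_unit_mult_low:
  fixes g x :: "'c::field fps"
  assumes "\<And>k. k \<le> l \<Longrightarrow> fps_nth (g * x) k = 0" "fps_nth g 0 \<noteq> 0" "k \<le> l"
  shows "fps_nth x k = 0"
proof -
  have "fps_nth (inverse g * (g * x)) k = 0" using assms(1,3) by (rule fps_mult_low)
  moreover have "inverse g * (g * x) = x"
    using inverse_mult_eq_1[OF assms(2)] by (simp only: mult.assoc[symmetric] mult_1_left)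
  ultimately show ?thesis by simp
qed

text \<open>The twisted basis spans the only Deligne-Manin lattice \<open>W\<close>.

  Every basis vector is in \<open>W\<close>. By induction it is enough to consider a vector \<open>v\<close> for which
  \<open>(Drs_red - \<kappa>) v\<close> is in \<open>W\<close>, with \<open>\<kappa> \<in> \<tau>\<close>. If \<open>n\<close> is minimal with \<open>x\<^sup>n v \<in> W\<close> and \<open>n > 0\<close>, then
  \<open>x\<^sup>n v\<close> is an eigenvector of the residue of \<open>W\<close> for \<open>\<kappa> + n\<close>, so \<open>\<kappa> + n \<in> \<tau>\<close>, which is impossible.

  Conversely, no element of \<open>W\<close> has a pole in the twisted coordinates. Pole orders on \<open>W\<close> are bounded;
  suppose that there are no terms with exponents below \<open>m < 0\<close>. Then the coefficient at \<open>x\<^sup>m\<close> vanishes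
  on \<open>xW\<close>, and \<open>Drs_red - c\<close> acts on it by \<open>A + m - c\<close>. A product of such operators with \<open>c \<in> \<tau>\<close> maps a
  given element to \<open>xW\<close>, and each \<open>A + m - c\<close> is injective, since it is triangular with diagonal
  entries whose values \<open>\<kappa> + m - c\<close> at \<open>t = 0\<close> are not zero.\<close>

lemma Deligne_Manin_lattice_eq:
  fixes E :: "('c::{alg_closed_field, field_char_0} fps fls, 'e) module"
  assumes ab: "adapted_basis E D Drs J b A \<phi> rank"
    and \<tau>: "representatives_mod_Ints \<tau>"
    and \<kappa>: "\<And>j. j \<in> J \<Longrightarrow> fps_nth (A j j) 0 \<in> \<tau>"
    and ld: "log_decomposition_red E D l Drs_red P_red"
    and dm: "Deligne_Manin_lattice \<tau> (reduction_C E l) Drs_red W"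
  shows "W = {adapted_basis.vec E J b \<phi> l a |a. \<forall>j\<in>J. a j \<in> range fps_to_fls}"
proof -
  interpret adapted_basis E D Drs J b A \<phi> rank by (rule ab)
  let ?R = "reduction E l"
  define L where "L = (restrict_scalars fps_to_fls (reduction_C E l))\<lparr>carrier := W\<rparr>"
  define em where "em f = fls_map_const (fps_to_fls f)" for f :: "'c fps"
  have L_simps: "carrier L = W" "\<zero>\<^bsub>L\<^esub> = \<zero>\<^bsub>?R\<^esub>" "v \<oplus>\<^bsub>L\<^esub> w = v \<oplus>\<^bsub>?R\<^esub> w" "f \<odot>\<^bsub>L\<^esub> v = em f \<odot>\<^bsub>?R\<^esub> v" for v w f
    by (simp_all add: L_def restrict_scalars_def reduction_C_simps em_def)
  have em_X: "em fps_X = fls_X" and em_const: "em (fps_const c) = fls_const (fps_const c)" for c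
    by (auto intro!: fls_eqI fps_ext simp: em_def fls_nth_fls_map_const)
  have vec_add_L: "vec l a \<oplus>\<^bsub>L\<^esub> vec l a' = vec l (\<lambda>j. a j + a' j)"
    and vec_scale_L: "f \<odot>\<^bsub>L\<^esub> vec l a = vec l (\<lambda>j. em f * a j)" for a a' f
    by (simp_all add: L_simps vec_add vec_scale)
  let ?XL = "(\<lambda>v. fps_X \<odot>\<^bsub>L\<^esub> v) ` W"
  have WM: "W \<subseteq> carrier ?R" and lm: "log_model L Drs_red (\<lambda>v. v) (reduction_C E l) Drs_red"
    and eig': "\<forall>a. (\<exists>v\<in>W. v \<notin> ?XL \<and> (\<exists>w\<in>?XL. Drs_red v = fps_const a \<odot>\<^bsub>L\<^esub> v \<oplus>\<^bsub>L\<^esub> w)) \<longrightarrow> a \<in> \<tau>"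
    using dm unfolding Deligne_Manin_lattice_def Let_def L_def[symmetric] by (auto simp: reduction_C_simps(1))
  have eig: "a \<in> \<tau>" if "v \<in> W" "v \<notin> ?XL" "w \<in> ?XL" "Drs_red v = fps_const a \<odot>\<^bsub>L\<^esub> v \<oplus>\<^bsub>L\<^esub> w" for a v w
    using eig' that by blast
  have L_mod: "is_module L" and fg: "finitely_generated L" and Drs_W: "Drs_red \<in> carrier L \<rightarrow> carrier L"
    and Drs_add: "\<And>v w. v \<in> carrier L \<Longrightarrow> w \<in> carrier L \<Longrightarrow> Drs_red (v \<oplus>\<^bsub>L\<^esub> w) = Drs_red v \<oplus>\<^bsub>L\<^esub> Drs_red w"
    and Drs_leib: "\<And>f v. v \<in> carrier L \<Longrightarrow> Drs_red (f \<odot>\<^bsub>L\<^esub> v) = theta_fps f \<odot>\<^bsub>L\<^esub> v \<oplus>\<^bsub>L\<^esub> f \<odot>\<^bsub>L\<^esub> Drs_red v"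
    using lm by (auto simp: log_model_def MC_log_def connection_def)
  have denom: "\<exists>n. fls_X ^ n \<odot>\<^bsub>?R\<^esub> v \<in> W" if "v \<in> carrier ?R" for v
    using lm that by (simp add: log_model_def L_simps(1) reduction_C_simps fls_map_const_simps)
  interpret L: type_module L by (rule type_module.intro[OF L_mod])
  have W_zero: "\<zero>\<^bsub>?R\<^esub> \<in> W" using L.zero_closed by (simp add: L_simps)
  have W_add: "v \<oplus>\<^bsub>?R\<^esub> w \<in> W" if "v \<in> W" "w \<in> W" for v w using L.M.a_closed[of v w] that by (simp add: L_simps)
  have W_scale: "em f \<odot>\<^bsub>?R\<^esub> v \<in> W" if "v \<in> W" for f v using L.scale_closed[of v f] that by (simp add: L_simps)
  have Drs_vec: "Drs_red (vec l a) = vec l (\<lambda>j. theta_fls (a j) + (\<Sum>i\<in>J. fls_const (A j i) * a i))" for a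
    by (rule Drs_red_vec[OF ld])
  have X_cancel: "vec l a = vec l a'" if "vec l (\<lambda>j. fls_X * a j) = vec l (\<lambda>j. fls_X * a' j)" for a a'
    unfolding vec_eq_iff
  proof
    fix j assume "j \<in> J"
    hence "t_power (Suc l) dvd fls_X * a j - fls_X * a' j" using that by (simp add: vec_eq_iff)
    hence "t_power (Suc l) dvd fls_X_inv * (fls_X * a j - fls_X * a' j)" by (rule dvd_mult)
    thus "t_power (Suc l) dvd a j - a' j"
      by (simp add: right_diff_distrib fls_X_inv_times_conv_shift fls_X_times_conv_shift)
  qed
  have incl1: "vec l a \<in> W" if a: "\<forall>j\<in>J. a j \<in> range fps_to_fls" for a
  proof (rule vec_mem[OF W_zero W_add])
    fix i assume i: "i \<in> J"
    then obtain p where p: "a i = fps_to_fls p" using a by auto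
    show "single l i (a i) \<in> W"
    proof (rule single_induct[OF W_zero W_add, where Q = "\<lambda>_. True"])
      fix k v assume "v \<in> W"
      have "t_coeff k (a i) = fps_to_fls (Abs_fps (\<lambda>n. fps_nth (fps_nth p n) k))"
        by (rule fls_eqI) (simp add: p)
      thus "fls_map_const (t_coeff k (a i)) \<odot>\<^bsub>?R\<^esub> v \<in> W"
        using W_scale[OF \<open>v \<in> W\<close>] by (simp add: em_def)
    next
      fix j r assume j: "j \<in> J"
      define \<kappa>0 where "\<kappa>0 = fps_nth (A j j) 0"
      define w where "w = (\<lambda>i. fls_const (A i j * r - (if i = j then fps_const \<kappa>0 * r else 0)))"
      assume "vec l (\<lambda>i. fls_const (A i j * r - (if i = j then fps_const (fps_nth (A j j) 0) * r else 0))) \<in> W"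
      hence w: "vec l w \<in> W" unfolding w_def \<kappa>0_def .
      define y where "y n = (\<lambda>i. if i = j then fls_X ^ n * fls_const r else (0 :: 'c fps fls))" for n :: nat
      have ex: "\<exists>n. vec l (y n) \<in> W"
        using denom[of "single l j (fls_const r)"] by (simp add: single_def vec_scale y_def if_distrib cong: if_cong)
      define n where "n = (LEAST n. vec l (y n) \<in> W)"
      have n: "vec l (y n) \<in> W" unfolding n_def using ex by (rule LeastI_ex)
      have "n = 0"
      proof (rule ccontr)
        assume "n \<noteq> 0"
        then obtain m where m: "n = Suc m" using not0_implies_Suc by blast
        have not: "vec l (y m) \<notin> W" using not_less_Least[of m "\<lambda>n. vec l (y n) \<in> W"] m unfolding n_def by auto
        have "vec l (y n) \<notin> ?XL"
        proof
          assume "vec l (y n) \<in> ?XL"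
          then obtain z where z: "z \<in> W" "vec l (y n) = fps_X \<odot>\<^bsub>L\<^esub> z" by blast
          obtain a' where a': "z = vec l a'" using vec_surj z(1) WM by blast
          have "vec l (\<lambda>j. fls_X * y m j) = vec l (\<lambda>j. fls_X * a' j)"
            using z(2) by (simp add: a' vec_scale_L em_X m y_def mult_ac if_distrib cong: if_cong)
          hence "vec l (y m) = vec l a'" by (rule X_cancel)
          thus False using not z(1) a' by simp
        qed
        moreover have "fps_X \<odot>\<^bsub>L\<^esub> vec l (\<lambda>i. fls_X ^ m * w i) \<in> ?XL"
        proof -
          have "em (fps_X ^ m) = fls_X ^ m"
            by (simp add: em_def fls_map_const_simps fps_to_fls_power)
          hence "vec l (\<lambda>i. fls_X ^ m * w i) \<in> W" using W_scale[OF w, of "fps_X ^ m"] by (simp add: vec_scale)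
          thus ?thesis by blast
        qed
        moreover have "Drs_red (vec l (y n)) = fps_const (\<kappa>0 + of_nat n) \<odot>\<^bsub>L\<^esub> vec l (y n)
            \<oplus>\<^bsub>L\<^esub> (fps_X \<odot>\<^bsub>L\<^esub> vec l (\<lambda>i. fls_X ^ m * w i))"
          unfolding Drs_vec vec_scale_L vec_add_L
        proof (rule vec_cong)
          fix k assume "k \<in> J"
          have 1: "(\<Sum>i\<in>J. fls_const (A k i) * y n i) = fls_X ^ n * fls_const (A k j * r)"
          proof -
            have "(\<Sum>i\<in>J. fls_const (A k i) * y n i)
                = (\<Sum>i\<in>J. if i = j then fls_const (A k j) * (fls_X ^ n * fls_const r) else 0)"
              by (intro sum.cong) (auto simp: y_def)
            also have "\<dots> = fls_X ^ n * (fls_const (A k j) * fls_const r)"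
              using J j by (simp add: mult.left_commute)
            finally show ?thesis by (simp only: fls_const_mult_const)
          qed
          have 2: "theta_fls (y n k) = fls_const (of_nat n) * y n k"
            by (rule fls_eqI) (simp add: y_def fls_X_power_times_conv_shift)
          show "theta_fls (y n k) + (\<Sum>i\<in>J. fls_const (A k i) * y n i)
              = em (fps_const (\<kappa>0 + of_nat n)) * y n k + em fps_X * (fls_X ^ m * w k)"
          proof -
            define K R N where "K = (fls_const (fps_const \<kappa>0) :: 'c fps fls)" and "R = fls_const r"
              and "N = (fls_const (of_nat n) :: 'c fps fls)"
            have w_k: "w k = fls_const (A k j * r) - (if k = j then K * R else 0)"
              by (simp add: w_def K_def R_def fls_minus_const fls_const_mult_const)
            have y_k: "y n k = (if k = j then fls_X * fls_X ^ m * R else 0)"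
              by (simp add: y_def R_def m)
            have c: "fls_const (fps_const (\<kappa>0 + of_nat n)) = K + N"
              by (simp add: K_def N_def fls_plus_const fps_of_nat[symmetric] del: fps_of_nat)
            have X: "fls_X ^ n = fls_X * (fls_X ^ m :: 'c fps fls)" by (simp add: m)
            show ?thesis unfolding 1 2 em_X em_const unfolding w_k c y_k X N_def[symmetric]
              by (cases "k = j") (simp_all add: algebra_simps)
          qed
        qed
        ultimately have "\<kappa>0 + of_nat n \<in> \<tau>" using n by (intro eig)
        thus False using representatives_unique[OF \<tau>, of \<kappa>0 "int n"] \<kappa>[OF j] \<open>n \<noteq> 0\<close> by (simp add: \<kappa>0_def)
      qed
      thus "single l j (fls_const r) \<in> W" using n by (simp add: y_def single_def cong: if_cong)
    qed (use i in auto)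
  qed
  \<comment> \<open>No element of \<open>W\<close> has a term with exponent \<open>m\<close>.\<close>
  define S where "S m \<longleftrightarrow> (\<forall>a. vec l a \<in> W \<longrightarrow> (\<forall>j\<in>J. \<forall>k\<le>l. fps_nth (fls_nth (a j) m) k = 0))" for m
  have vec_eqD: "fps_nth (fls_nth (a j) m) k = fps_nth (fls_nth (a' j) m) k"
    if "vec l a = vec l a'" "j \<in> J" "k \<le> l" for a a' j m k
    using that by (simp add: vec_eq_iff t_power_dvd_iff less_Suc_eq_le)
  have "\<exists>N. \<forall>m<N. S m"
  proof -
    obtain n :: nat and e where e: "e \<in> {..<n} \<rightarrow> carrier L"
      and gen: "\<And>v. v \<in> carrier L \<Longrightarrow> \<exists>a. v = lincomb L {..<n} e a"
      using fg unfolding finitely_generated_def lincomb_def by blast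
    have "\<forall>i. \<exists>c. i < n \<longrightarrow> e i = vec l c" using e WM vec_surj by (metis L_simps(1) Pi_iff lessThan_iff subsetD)
    then obtain c where c: "\<And>i. i < n \<Longrightarrow> e i = vec l (c i)" by metis
    define N where "N = Min (insert 0 ((\<lambda>(i, j). fls_subdegree (c i j)) ` ({..<n} \<times> J)))"
    have N: "N \<le> fls_subdegree (c i j)" if "i < n" "j \<in> J" for i j
      unfolding N_def using that J by (intro Min_le) auto
    have "S m" if m: "m < N" for m
      unfolding S_def
    proof (intro allI impI ballI)
      fix a j k assume a: "vec l a \<in> W" and j: "j \<in> J" and k: "k \<le> l"
      obtain p where p: "vec l a = lincomb L {..<n} e p" using gen[of "vec l a"] a by (auto simp: L_simps)
      have "lincomb L I e p = vec l (\<lambda>j. \<Sum>i\<in>I. em (p i) * c i j)" if "I \<subseteq> {..<n}" for I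
        using finite_subset[OF that finite_lessThan] that
      proof induction
        case empty
        show ?case by (simp add: lincomb_def vec_zero L_simps)
      next
        case (insert x I)
        have "lincomb L (insert x I) e p = p x \<odot>\<^bsub>L\<^esub> e x \<oplus>\<^bsub>L\<^esub> lincomb L I e p"
          unfolding lincomb_def using insert e by (intro L.finsum_insert) (auto simp: Pi_iff subset_iff)
        thus ?case using insert by (simp add: c vec_scale_L vec_add_L)
      qed
      hence "vec l a = vec l (\<lambda>j. \<Sum>i\<in>{..<n}. em (p i) * c i j)" using p by simp
      hence "fps_nth (fls_nth (a j) m) k = fps_nth (fls_nth (\<Sum>i\<in>{..<n}. em (p i) * c i j) m) k"
        using j k by (rule vec_eqD)
      also have "fls_nth (em (p i) * c i j) m = 0" if "i < n" for i
      proof (rule fls_times_nth_eq0)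
        have "fls_subdegree (em (p i)) \<ge> 0"
          by (cases "em (p i) = 0") (auto intro!: fls_subdegree_geI simp: em_def fls_nth_fls_map_const)
        thus "m < fls_subdegree (em (p i)) + fls_subdegree (c i j)" using N[OF that j] m by linarith
      qed
      hence "fls_nth (\<Sum>i\<in>{..<n}. em (p i) * c i j) m = 0" by (simp add: fls_nth_sum)
      finally show "fps_nth (fls_nth (a j) m) k = 0" by simp
    qed
    thus ?thesis by blast
  qed
  then obtain N where N: "\<And>m. m < N \<Longrightarrow> S m" by blast
  have step: "S m" if Sm: "S (m - 1)" and m: "m < 0" for m
    unfolding S_def
  proof (intro allI impI)
    fix a assume a: "vec l a \<in> W"
    have "\<exists>cs. set cs \<subseteq> \<tau> \<and>
        fold (\<lambda>c u. Drs_red u \<oplus>\<^bsub>L\<^esub> fps_const (- c) \<odot>\<^bsub>L\<^esub> u) cs (vec l a) \<in> (\<lambda>v. fps_X \<odot>\<^bsub>L\<^esub> v) ` carrier L"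
      using a by (intro annihilating_product[OF L_mod fg Drs_W Drs_add Drs_leib] eig) (auto simp: L_simps(1))
    then obtain cs where cs: "set cs \<subseteq> \<tau>"
      "fold (\<lambda>c u. Drs_red u \<oplus>\<^bsub>L\<^esub> fps_const (- c) \<odot>\<^bsub>L\<^esub> u) cs (vec l a) \<in> ?XL"
      unfolding L_simps(1) by blast
    show "\<forall>j\<in>J. \<forall>k\<le>l. fps_nth (fls_nth (a j) m) k = 0"
      using cs a
    proof (induction cs arbitrary: a)
      case Nil
      then obtain z where z: "z \<in> W" "vec l a = fps_X \<odot>\<^bsub>L\<^esub> z" by auto
      obtain a' where a': "z = vec l a'" using vec_surj z(1) WM by blast
      have eq: "vec l a = vec l (\<lambda>j. fls_X * a' j)" using z(2) by (simp add: a' vec_scale_L em_X)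
      show ?case
      proof (intro ballI allI impI)
        fix j k assume "j \<in> J" "k \<le> l"
        thus "fps_nth (fls_nth (a j) m) k = 0"
          using vec_eqD[OF eq, of j k m] Sm z(1) a' by (simp add: S_def fls_X_times_conv_shift)
      qed
    next
      case (Cons c cs)
      define a' where "a' = (\<lambda>j. theta_fls (a j) + (\<Sum>i\<in>J. fls_const (A j i) * a i) + em (fps_const (- c)) * a j)"
      have eq: "Drs_red (vec l a) \<oplus>\<^bsub>L\<^esub> fps_const (- c) \<odot>\<^bsub>L\<^esub> vec l a = vec l a'"
        by (simp add: Drs_vec vec_scale_L vec_add_L a'_def)
      have "vec l a' \<in> W"
      proof -
        have "vec l a \<in> carrier L" using Cons.prems by (simp add: L_simps(1))
        hence "Drs_red (vec l a) \<oplus>\<^bsub>L\<^esub> fps_const (- c) \<odot>\<^bsub>L\<^esub> vec l a \<in> carrier L"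
          using funcset_mem[OF Drs_W] by simp
        thus ?thesis by (simp add: eq L_simps(1))
      qed
      hence a'0: "\<forall>j\<in>J. \<forall>k\<le>l. fps_nth (fls_nth (a' j) m) k = 0"
        using Cons.prems eq by (intro Cons.IH) auto
      have "\<forall>k\<le>l. fps_nth (fls_nth (a j) m) k = 0" if "j \<in> J" for j
        using that
      proof (induction "rank j" arbitrary: j rule: less_induct)
        case less
        have c: "c \<in> \<tau>" using Cons.prems by simp
        have "fls_nth (a' j) m = of_int m * fls_nth (a j) m + (\<Sum>i\<in>J. A j i * fls_nth (a i) m) - fps_const c * fls_nth (a j) m"
          by (simp add: a'_def fls_nth_sum em_const del: fps_const_neg) (simp flip: fps_const_neg)
        also have "(\<Sum>i\<in>J. A j i * fls_nth (a i) m) = A j j * fls_nth (a j) m + (\<Sum>i\<in>J - {j}. A j i * fls_nth (a i) m)"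
          using J less.prems by (rule sum.remove)
        finally have eq: "(A j j + fps_const (of_int m - c)) * fls_nth (a j) m
            = fls_nth (a' j) m - (\<Sum>i\<in>J - {j}. A j i * fls_nth (a i) m)"
          by (simp add: algebra_simps fps_of_int[symmetric] fps_const_sub[symmetric] del: fps_of_int fps_const_sub)
        have "fps_nth (A j i * fls_nth (a i) m) k = 0" if "i \<in> J - {j}" "k \<le> l" for i k
        proof (cases "A j i = 0")
          case False
          hence "rank i < rank j" using A_off[of i j] that less.prems by auto
          thus ?thesis using less.hyps[of i] that by (intro fps_mult_low) auto
        qed simp
        hence low: "fps_nth ((A j j + fps_const (of_int m - c)) * fls_nth (a j) m) k = 0" if "k \<le> l" for k
          unfolding eq using a'0 less.prems that by (simp add: fps_sum_nth)
        have "fps_nth (A j j) 0 + (of_int m - c) \<noteq> 0"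
        proof
          assume "fps_nth (A j j) 0 + (of_int m - c) = 0"
          hence "fps_nth (A j j) 0 + of_int m = c" by (simp add: algebra_simps)
          hence "m = 0" using representatives_unique[OF \<tau> \<kappa>[OF less.prems]] c by metis
          thus False using m by simp
        qed
        thus ?case using fps_unit_mult_low[OF low] by simp
      qed
      thus ?case by blast
    qed
  qed
  have S_neg: "S m" if "m < 0" for m
  proof -
    have "\<forall>m<N + int n. m < 0 \<longrightarrow> S m" for n
    proof (induction n)
      case (Suc n)
      show ?case
      proof (intro allI impI)
        fix m assume m: "m < N + int (Suc n)" "m < 0"
        hence "S (m - 1)" using Suc.IH by auto
        thus "S m" using step m(2) by blast
      qed
    qed (use N in auto)
    from this[of "nat (m - N + 1)"] that show ?thesis by auto
  qed
  have incl2: "\<exists>a. v = vec l a \<and> (\<forall>j\<in>J. a j \<in> range fps_to_fls)" if v: "v \<in> W" for v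
  proof -
    obtain a where a: "v = vec l a" using vec_surj v WM by blast
    define a' where "a' j = fps_to_fls (fls_regpart (a j))" for j
    have "v = vec l a'"
      unfolding a vec_eq_iff t_power_dvd_iff
    proof (intro ballI allI impI)
      fix j n k assume "j \<in> J" "k < Suc l"
      thus "fps_nth (fls_nth (a j - a' j) n) k = 0"
        using S_neg[of n] v a by (cases "n < 0") (auto simp: S_def a'_def)
    qed
    thus ?thesis by (auto simp: a'_def)
  qed
  show ?thesis using incl1 incl2 by auto
qed

section \<open>A basis adapted to the logarithmic decomposition\<close>

context type_module
begin

lemma basis_on_unit_scale:
  assumes b: "basis_on M J b" and g: "g * g' = 1"
  shows "basis_on M J (\<lambda>j. g \<odot> b j)"
proof -
  have bM: "b \<in> J \<rightarrow> carrier M" and J: "finite J" using b by (auto simp: basis_on_def)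
  have eq: "lincomb M J (\<lambda>j. g \<odot> b j) a = lincomb M J b (\<lambda>j. a j * g)" for a
    by (rule lincomb_basis_scale[OF bM])
  have "\<exists>a. v = lincomb M J (\<lambda>j. g \<odot> b j) a" if v: "v \<in> carrier M" for v
  proof -
    obtain a where a: "v = lincomb M J b a" using b v by (auto simp: basis_on_def)
    have "v = lincomb M J (\<lambda>j. g \<odot> b j) (\<lambda>j. a j * g')"
      unfolding a eq using g bM by (intro lincomb_cong) (simp_all add: mult.assoc mult.commute[of g' g])
    thus ?thesis by blast
  qed
  moreover have "a j = 0" if "lincomb M J (\<lambda>j. g \<odot> b j) a = \<zero>" "j \<in> J" for a j
  proof -
    have "\<forall>j\<in>J. a j * g = 0" using that(1) b unfolding eq basis_on_def by blast
    hence "a j * g = 0" using that(2) by blast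
    hence "a j * (g * g') = 0" by (simp add: mult.assoc[symmetric])
    thus ?thesis using g by simp
  qed
  ultimately show ?thesis using bM J unfolding basis_on_def by (auto simp: Pi_iff)
qed

lemma lincomb_Sigma_single:
  assumes T: "finite T" and J: "\<And>\<rho>. \<rho> \<in> T \<Longrightarrow> finite (J \<rho>)" and \<rho>: "\<rho> \<in> T"
    and b: "\<And>\<rho> k. \<rho> \<in> T \<Longrightarrow> k \<in> J \<rho> \<Longrightarrow> b \<rho> k \<in> carrier M"
  shows "lincomb M (Sigma T J) (\<lambda>(\<rho>, k). b \<rho> k) (\<lambda>(\<rho>', k). if \<rho>' = \<rho> then a k else 0)
    = lincomb M (J \<rho>) (b \<rho>) a"
proof -
  have "lincomb M (Sigma T J) (\<lambda>(\<rho>, k). b \<rho> k) (\<lambda>(\<rho>', k). if \<rho>' = \<rho> then a k else 0)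
      = (\<Oplus>\<rho>'\<in>T. lincomb M (J \<rho>') (b \<rho>') (\<lambda>k. if \<rho>' = \<rho> then a k else 0))"
    unfolding lincomb_def using T J b by (subst finsum_Sigma) auto
  also have "\<dots> = (\<Oplus>\<rho>'\<in>T. if \<rho> = \<rho>' then lincomb M (J \<rho>') (b \<rho>') a else \<zero>)"
  proof (intro M.add.finprod_cong' refl)
    fix \<rho>' assume \<rho>': "\<rho>' \<in> T"
    hence bJ: "b \<rho>' \<in> J \<rho>' \<rightarrow> carrier M" using b by auto
    show "lincomb M (J \<rho>') (b \<rho>') (\<lambda>k. if \<rho>' = \<rho> then a k else 0)
        = (if \<rho> = \<rho>' then lincomb M (J \<rho>') (b \<rho>') a else \<zero>)"
      using bJ by (cases "\<rho> = \<rho>'") (auto simp: lincomb_zero)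
  qed (use b in \<open>auto intro!: lincomb_closed\<close>)
  also have "\<dots> = lincomb M (J \<rho>) (b \<rho>) a"
    using T \<rho> b by (intro M.add.finprod_singleton) (auto intro!: lincomb_closed)
  finally show ?thesis .
qed

end

text \<open>The bases of the components \<open>E\<^sub>\<rho>\<close> are put together. Multiplication of the basis of \<open>E\<^sub>\<rho>\<close> by \<open>x\<^sup>-\<^sup>m\<close>
  subtracts the integer \<open>m\<close> from the exponent \<open>c\<^sub>\<rho>\<close>, and \<open>m\<close> is chosen such that the value at \<open>t = 0\<close>
  of the new exponent is in \<open>\<tau>\<close>.\<close>

lemma adapted_basis_exists:
  fixes E :: "('c::field_char_0 fps fls, 'e) module"
  assumes \<tau>: "representatives_mod_Ints \<tau>" and MC_D: "MC E D" and ld: "log_decomposition E D Drs P"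
  shows "\<exists>(J :: ('c fps fls set \<times> nat) set) b A \<phi> rank.
    adapted_basis E D Drs J b A \<phi> rank \<and> (\<forall>j\<in>J. fps_nth (A j j) 0 \<in> \<tau>)"
proof -
  interpret type_module E using MC_D by (intro type_module.intro) (simp add: MC_def connection_def)
  have MC_Drs: "MC E Drs" using ld by (simp add: log_decomposition_def MC_rs_def)
  have leib: "D (f \<odot>\<^bsub>E\<^esub> v) = theta_fls f \<odot>\<^bsub>E\<^esub> v \<oplus>\<^bsub>E\<^esub> f \<odot>\<^bsub>E\<^esub> D v"
    "Drs (f \<odot>\<^bsub>E\<^esub> v) = theta_fls f \<odot>\<^bsub>E\<^esub> v \<oplus>\<^bsub>E\<^esub> f \<odot>\<^bsub>E\<^esub> Drs v" if "v \<in> carrier E" for f v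
    using MC_D MC_Drs that by (auto simp: MC_def connection_def)
  obtain T H where TLJ: "TLJ_decomposition E Drs T H"
    and comp: "\<forall>\<rho>\<in>T. P ` H \<rho> \<subseteq> H \<rho> \<and> has_log_basis (E\<lparr>carrier := H \<rho>\<rparr>) Drs D"
    using ld unfolding log_decomposition_def by (elim conjE exE) (rule that)
  have ds: "internal_direct_sum E T H" using TLJ by (simp add: TLJ_decomposition_def)
  have lb: "\<And>\<rho>. \<rho> \<in> T \<Longrightarrow> has_log_basis (E\<lparr>carrier := H \<rho>\<rparr>) Drs D" using comp by simp
  have T: "finite T" and sub: "\<And>\<rho>. \<rho> \<in> T \<Longrightarrow> is_submodule (H \<rho>) E"
    using ds by (auto simp: internal_direct_sum_def)
  define Q where "Q \<rho> r e A \<phi> c \<longleftrightarrow> basis_on (E\<lparr>carrier := H \<rho>\<rparr>) {..<r} e \<and>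
    (\<forall>i<r. Drs (e i) = lincomb (E\<lparr>carrier := H \<rho>\<rparr>) {..<r} e (\<lambda>j. A j i) \<and>
      D (e i) = lincomb (E\<lparr>carrier := H \<rho>\<rparr>) {..<r} e (\<lambda>j. A j i + (if j = i then \<phi> i else 0)) \<and>
      \<phi> i \<in> polar_parts \<and> A i i = fls_const c \<and>
      (\<forall>j<r. j \<noteq> i \<longrightarrow> A j i \<noteq> 0 \<longrightarrow> j = Suc i \<and> \<phi> j = \<phi> i \<and> A j i = 1))" for \<rho> r e A \<phi> c
  have "\<exists>r e A \<phi> c. Q \<rho> r e A \<phi> c" if "\<rho> \<in> T" for \<rho>
    unfolding Q_def by (rule log_basis_exists[OF lb[OF that] type_module.is_module[OF submodule_type_module[OF sub[OF that]]]])
  then obtain r e A \<phi> c where Q: "\<And>\<rho>. \<rho> \<in> T \<Longrightarrow> Q \<rho> (r \<rho>) (e \<rho>) (A \<rho>) (\<phi> \<rho>) (c \<rho>)" by metis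
  have "\<exists>m::int. fps_nth (c \<rho>) 0 - of_int m \<in> \<tau>" for \<rho>
  proof -
    obtain a where a: "a \<in> \<tau>" "fps_nth (c \<rho>) 0 - a \<in> \<int>" using \<tau> unfolding representatives_mod_Ints_def by blast
    then obtain m where "fps_nth (c \<rho>) 0 - a = of_int m" by (auto elim: Ints_cases)
    hence "fps_nth (c \<rho>) 0 - of_int m = a" by (simp add: algebra_simps)
    thus ?thesis using a by metis
  qed
  then obtain m where m: "\<And>\<rho>. fps_nth (c \<rho>) 0 - of_int (m \<rho>) \<in> \<tau>" by metis
  define x where "x \<rho> = (fls_X_intpow (- m \<rho>) :: 'c fps fls)" for \<rho>
  define b where "b \<rho> k = x \<rho> \<odot>\<^bsub>E\<^esub> e \<rho> k" for \<rho> k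
  define B where "B \<rho> j i = (if j = i then c \<rho> - of_int (m \<rho>) else if A \<rho> j i = 0 then 0 else 1)" for \<rho> j i
  let ?J = "Sigma T (\<lambda>\<rho>. {..<r \<rho>})"
  let ?b = "\<lambda>(\<rho>, k). b \<rho> k"
  let ?A = "\<lambda>(\<rho>', j) (\<rho>, i). if \<rho>' = \<rho> then B \<rho> j i else 0"
  let ?\<phi> = "\<lambda>(\<rho>, k). \<phi> \<rho> k"
  have eH: "e \<rho> \<in> {..<r \<rho>} \<rightarrow> H \<rho>" and e: "basis_on (E\<lparr>carrier := H \<rho>\<rparr>) {..<r \<rho>} (e \<rho>)" if "\<rho> \<in> T" for \<rho>
    using Q[OF that] by (auto simp: Q_def basis_on_def)
  have eE: "e \<rho> \<in> {..<r \<rho>} \<rightarrow> carrier E" if "\<rho> \<in> T" for \<rho>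
    using eH[OF that] submodule_subset[OF sub[OF that]] by auto
  have bE: "b \<rho> \<in> {..<r \<rho>} \<rightarrow> carrier E" if "\<rho> \<in> T" for \<rho>
    using eE[OF that] by (auto simp: b_def Pi_iff)
  have "basis_on E ?J ?b"
  proof (rule basis_on_Sigma[OF ds])
    fix \<rho> assume \<rho>: "\<rho> \<in> T"
    interpret H: type_module "E\<lparr>carrier := H \<rho>\<rparr>" by (rule submodule_type_module[OF sub[OF \<rho>]])
    have "x \<rho> * fls_X_intpow (m \<rho>) = 1"
      by (simp only: x_def fls_X_intpow_times_fls_X_intpow) simp
    from H.basis_on_unit_scale[OF e[OF \<rho>] this]
    show "basis_on (E\<lparr>carrier := H \<rho>\<rparr>) {..<r \<rho>} (b \<rho>)" by (simp add: b_def[abs_def])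
  qed
  moreover have conn: "T' (b \<rho> i) = lincomb E ?J ?b (\<lambda>j. fls_const (?A j (\<rho>, i)) + (if j = (\<rho>, i) then g else 0))"
    if \<rho>: "\<rho> \<in> T" and i: "i < r \<rho>"
      and T': "T' (e \<rho> i) = lincomb (E\<lparr>carrier := H \<rho>\<rparr>) {..<r \<rho>} (e \<rho>) (\<lambda>j. A \<rho> j i + (if j = i then g else 0))"
      and leib: "\<And>f v. v \<in> carrier E \<Longrightarrow> T' (f \<odot>\<^bsub>E\<^esub> v) = theta_fls f \<odot>\<^bsub>E\<^esub> v \<oplus>\<^bsub>E\<^esub> f \<odot>\<^bsub>E\<^esub> T' v"
    for \<rho> i T' g
  proof -
    have iE: "e \<rho> i \<in> carrier E" using eE[OF \<rho>] i by auto
    have "T' (b \<rho> i) = theta_fls (x \<rho>) \<odot>\<^bsub>E\<^esub> e \<rho> i \<oplus>\<^bsub>E\<^esub> x \<rho> \<odot>\<^bsub>E\<^esub> T' (e \<rho> i)"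
      unfolding b_def by (rule leib[OF iE])
    also have "x \<rho> \<odot>\<^bsub>E\<^esub> T' (e \<rho> i) = lincomb E {..<r \<rho>} (b \<rho>) (\<lambda>j. A \<rho> j i + (if j = i then g else 0))"
    proof -
      have "x \<rho> \<odot>\<^bsub>E\<^esub> T' (e \<rho> i) = lincomb E {..<r \<rho>} (e \<rho>) (\<lambda>j. x \<rho> * (A \<rho> j i + (if j = i then g else 0)))"
        unfolding T' using eE[OF \<rho>] eH[OF \<rho>] by (simp add: lincomb_submodule[OF sub[OF \<rho>]] lincomb_scale)
      also have "\<dots> = lincomb E {..<r \<rho>} (b \<rho>) (\<lambda>j. A \<rho> j i + (if j = i then g else 0))"
        unfolding b_def[abs_def] by (subst lincomb_basis_scale[OF eE[OF \<rho>]]) (simp add: mult.commute)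
      finally show ?thesis .
    qed
    also have "theta_fls (x \<rho>) \<odot>\<^bsub>E\<^esub> e \<rho> i = lincomb E {..<r \<rho>} (b \<rho>) (\<lambda>j. if j = i then - fls_const (of_int (m \<rho>)) else 0)"
      using iE i bE[OF \<rho>]
      by (simp add: lincomb_single b_def scale_mult[symmetric] x_def theta_fls_X_intpow[of "- m \<rho>", simplified])
    also have "\<dots> \<oplus>\<^bsub>E\<^esub> lincomb E {..<r \<rho>} (b \<rho>) (\<lambda>j. A \<rho> j i + (if j = i then g else 0))
        = lincomb E {..<r \<rho>} (b \<rho>) (\<lambda>j. fls_const (B \<rho> j i) + (if j = i then g else 0))"
      unfolding lincomb_add[OF bE[OF \<rho>]]
    proof (intro lincomb_cong bE[OF \<rho>])
      fix j assume j: "j \<in> {..<r \<rho>}"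
      have "A \<rho> i i = fls_const (c \<rho>)" "j \<noteq> i \<Longrightarrow> A \<rho> j i \<noteq> 0 \<Longrightarrow> A \<rho> j i = 1"
        using Q[OF \<rho>] i j by (auto simp: Q_def)
      thus "(if j = i then - fls_const (of_int (m \<rho>)) else 0) + (A \<rho> j i + (if j = i then g else 0))
          = fls_const (B \<rho> j i) + (if j = i then g else 0)"
        by (auto simp: B_def fls_minus_const[symmetric] simp del: fls_minus_const)
    qed
    also have "\<dots> = lincomb E ?J ?b (\<lambda>(\<rho>', j). if \<rho>' = \<rho> then fls_const (B \<rho> j i) + (if j = i then g else 0) else 0)"
      using T \<rho> bE by (subst lincomb_Sigma_single) auto
    also have "\<dots> = lincomb E ?J ?b (\<lambda>j. fls_const (?A j (\<rho>, i)) + (if j = (\<rho>, i) then g else 0))"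
    proof (rule lincomb_cong)
      show "?b \<in> ?J \<rightarrow> carrier E" using bE by auto
      fix j assume "j \<in> ?J"
      obtain \<rho>' k where "j = (\<rho>', k)" by (cases j)
      thus "(\<lambda>(\<rho>', j). if \<rho>' = \<rho> then fls_const (B \<rho> j i) + (if j = i then g else 0) else 0) j
          = fls_const (?A j (\<rho>, i)) + (if j = (\<rho>, i) then g else 0)" by (cases "\<rho>' = \<rho>") simp_all
    qed
    finally show ?thesis .
  qed
  have "adapted_basis E D Drs ?J ?b ?A ?\<phi> snd"
  proof (unfold_locales, rule MC_Drs, rule MC_D, rule \<open>basis_on E ?J ?b\<close>)
    fix i assume "i \<in> ?J"
    then obtain \<rho> k where i: "i = (\<rho>, k)" "\<rho> \<in> T" "k < r \<rho>" by auto
    have "Drs (e \<rho> k) = lincomb (E\<lparr>carrier := H \<rho>\<rparr>) {..<r \<rho>} (e \<rho>) (\<lambda>j. A \<rho> j k + (if j = k then 0 else 0))"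
      using Q[OF i(2)] i(3) by (simp add: Q_def)
    from conn[OF i(2,3) this leib(2)]
    show "Drs (?b i) = lincomb E ?J ?b (\<lambda>j. fls_const (?A j i))" by (simp add: i(1))
    have "D (e \<rho> k) = lincomb (E\<lparr>carrier := H \<rho>\<rparr>) {..<r \<rho>} (e \<rho>) (\<lambda>j. A \<rho> j k + (if j = k then \<phi> \<rho> k else 0))"
      using Q[OF i(2)] i(3) by (simp add: Q_def)
    from conn[OF i(2,3) this leib(1)]
    show "D (?b i) = lincomb E ?J ?b (\<lambda>j. fls_const (?A j i) + (if j = i then ?\<phi> i else 0))"
      by (simp add: i(1) cong: if_cong)
    show "?\<phi> i \<in> polar_parts" using Q[OF i(2)] i by (simp add: Q_def)
    fix j assume "j \<in> ?J" and j: "j \<noteq> i" "?A j i \<noteq> 0"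
    then obtain n where n: "j = (\<rho>, n)" "n < r \<rho>" "n \<noteq> k" "A \<rho> n k \<noteq> 0"
      using i by (auto simp: B_def split: if_splits)
    thus "snd i < snd j \<and> ?\<phi> j = ?\<phi> i" using Q[OF i(2)] i by (auto simp: Q_def)
  qed
  moreover have "\<forall>j\<in>?J. fps_nth (?A j j) 0 \<in> \<tau>"
    using m by (auto simp: B_def fps_of_int[symmetric] simp del: fps_of_int)
  ultimately show ?thesis by blast
qed

section \<open>Transport of connections\<close>

lemma module_transport:
  assumes M: "is_module M" and bij: "bij_betw h (carrier M) (carrier M')"
    and h_zero: "h \<zero>\<^bsub>M\<^esub> = \<zero>\<^bsub>M'\<^esub>"
    and add: "\<And>v w. v \<in> carrier M \<Longrightarrow> w \<in> carrier M \<Longrightarrow> h (v \<oplus>\<^bsub>M\<^esub> w) = h v \<oplus>\<^bsub>M'\<^esub> h w"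
    and scale: "\<And>f v. v \<in> carrier M \<Longrightarrow> h (f \<odot>\<^bsub>M\<^esub> v) = f \<odot>\<^bsub>M'\<^esub> h v"
  shows "is_module M'"
proof -
  interpret type_module M by (rule type_module.intro[OF M])
  have car: "carrier M' = h ` carrier M" using bij by (simp add: bij_betw_def)
  have ag: "abelian_group M'"
  proof (rule abelian_groupI)
    fix y assume "y \<in> carrier M'"
    then obtain v where v: "v \<in> carrier M" "y = h v" by (auto simp: car)
    show "\<exists>z\<in>carrier M'. z \<oplus>\<^bsub>M'\<^esub> y = \<zero>\<^bsub>M'\<^esub>"
      using v by (intro bexI[of _ "h (\<ominus>\<^bsub>M\<^esub> v)"]) (auto simp: add[symmetric] M.l_neg h_zero car)
  next
    fix x y assume "x \<in> carrier M'" "y \<in> carrier M'"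
    then obtain v w where v: "v \<in> carrier M" "x = h v" "w \<in> carrier M" "y = h w" by (auto simp: car)
    show "x \<oplus>\<^bsub>M'\<^esub> y \<in> carrier M'" "x \<oplus>\<^bsub>M'\<^esub> y = y \<oplus>\<^bsub>M'\<^esub> x"
      using v M.a_comm[of v w] by (auto simp: car add[symmetric])
    fix z assume "z \<in> carrier M'"
    then obtain u where "u \<in> carrier M" "z = h u" by (auto simp: car)
    thus "x \<oplus>\<^bsub>M'\<^esub> y \<oplus>\<^bsub>M'\<^esub> z = x \<oplus>\<^bsub>M'\<^esub> (y \<oplus>\<^bsub>M'\<^esub> z)"
      using v by (simp add: add[symmetric] M.a_assoc)
  next
    show "\<zero>\<^bsub>M'\<^esub> \<in> carrier M'" using h_zero by (metis car imageI M.zero_closed)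
    fix x assume "x \<in> carrier M'"
    then obtain v where v: "v \<in> carrier M" "x = h v" by (auto simp: car)
    thus "\<zero>\<^bsub>M'\<^esub> \<oplus>\<^bsub>M'\<^esub> x = x" using add[of "\<zero>\<^bsub>M\<^esub>" v] by (simp add: h_zero)
  qed
  show ?thesis
    by (rule moduleI, rule cring_from_type_algebra, rule ag)
      (auto simp: car add[symmetric] scale[symmetric] scale_add_left scale_add_right scale_mult)
qed

lemma MC_transport:
  assumes MC: "MC M D" and bij: "bij_betw h (carrier M) (carrier M')"
    and h_zero: "h \<zero>\<^bsub>M\<^esub> = \<zero>\<^bsub>M'\<^esub>"
    and add: "\<And>v w. v \<in> carrier M \<Longrightarrow> w \<in> carrier M \<Longrightarrow> h (v \<oplus>\<^bsub>M\<^esub> w) = h v \<oplus>\<^bsub>M'\<^esub> h w"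
    and scale: "\<And>f v. v \<in> carrier M \<Longrightarrow> h (f \<odot>\<^bsub>M\<^esub> v) = f \<odot>\<^bsub>M'\<^esub> h v"
    and D': "\<And>v. v \<in> carrier M \<Longrightarrow> h (D v) = D' (h v)"
  shows "MC_isomorphic M D M' D'"
proof -
  have M: "is_module M" and fg: "finitely_generated M" and D: "D \<in> carrier M \<rightarrow> carrier M"
    and conn: "connection fls_const theta_fls M D"
    using MC by (auto simp: MC_def connection_def)
  interpret type_module M by (rule type_module.intro[OF M])
  interpret M': type_module M' by (rule type_module.intro[OF module_transport[OF M bij h_zero add scale]])
  have car: "carrier M' = h ` carrier M" using bij by (simp add: bij_betw_def)
  have hM: "h v \<in> carrier M'" if "v \<in> carrier M" for v using that car by blast
  have "finitely_generated M'"
  proof -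
    obtain n :: nat and e where e: "e \<in> {..<n} \<rightarrow> carrier M"
      and gen: "\<And>v. v \<in> carrier M \<Longrightarrow> \<exists>a. v = lincomb M {..<n} e a"
      using fg unfolding finitely_generated_def lincomb_def by blast
    have "h (lincomb M I e a) = lincomb M' I (\<lambda>i. h (e i)) a" if "I \<subseteq> {..<n}" for I a
      using finite_subset[OF that finite_lessThan] that
    proof induction
      case empty
      show ?case by (simp add: lincomb_def h_zero)
    next
      case (insert x I)
      have eI: "\<And>i. i \<in> insert x I \<Longrightarrow> e i \<in> carrier M" using insert.prems e by auto
      have "lincomb M (insert x I) e a = a x \<odot>\<^bsub>M\<^esub> e x \<oplus>\<^bsub>M\<^esub> lincomb M I e a"
        unfolding lincomb_def using insert eI by (intro finsum_insert) auto
      moreover have "lincomb M' (insert x I) (\<lambda>i. h (e i)) a = a x \<odot>\<^bsub>M'\<^esub> h (e x) \<oplus>\<^bsub>M'\<^esub> lincomb M' I (\<lambda>i. h (e i)) a"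
        unfolding lincomb_def using insert eI hM by (intro M'.finsum_insert) auto
      ultimately show ?case using insert eI by (simp add: add scale lincomb_closed Pi_iff)
    qed
    hence h_lin: "h (lincomb M {..<n} e a) = lincomb M' {..<n} (\<lambda>i. h (e i)) a" for a by simp
    show ?thesis unfolding finitely_generated_def
    proof (intro exI[of _ n] exI[of _ "\<lambda>i. h (e i)"] conjI ballI)
      fix w assume "w \<in> carrier M'"
      then obtain v where v: "v \<in> carrier M" "w = h v" by (auto simp: car)
      show "\<exists>a. w = (\<Oplus>\<^bsub>M'\<^esub>i\<in>{..<n}. a i \<odot>\<^bsub>M'\<^esub> h (e i))"
        using gen[OF v(1)] h_lin unfolding v(2) lincomb_def by metis
    qed (use e hM in auto)
  qed
  hence "MC M' D'"
    unfolding MC_def connection_def using M'.is_module conn D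
    by (auto simp: car connection_def D'[symmetric] add[symmetric] scale[symmetric] Pi_iff)
  moreover have "linear_map M M' h" using hM by (auto simp: linear_map_def add scale)
  ultimately show ?thesis unfolding MC_isomorphic_def using MC bij D' by blast
qed

lemma MC_rs_isomorphic:
  fixes M :: "('r::comm_ring_1 fls, 'm) module"
  assumes "MC_rs M D" and iso: "MC_isomorphic M D M' D'"
  shows "MC_rs M' D'"
proof -
  obtain L :: "('r fps, (nat \<Rightarrow> 'r fps) set) module" and DL j where lm: "log_model L DL j M D"
    using assms(1) unfolding MC_rs_def by blast
  obtain h where h: "linear_map M M' h" "bij_betw h (carrier M) (carrier M')" "\<And>v. v \<in> carrier M \<Longrightarrow> h (D v) = D' (h v)"
    and MC': "MC M' D'" and MC: "MC M D"
    using iso unfolding MC_isomorphic_def by blast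
  interpret type_module M using MC by (intro type_module.intro) (simp add: MC_def connection_def)
  interpret M': type_module M' using MC' by (intro type_module.intro) (simp add: MC_def connection_def)
  have car: "carrier M' = h ` carrier M" using h(2) by (simp add: bij_betw_def)
  have scale: "h (f \<odot>\<^bsub>M\<^esub> v) = f \<odot>\<^bsub>M'\<^esub> h v" and add: "w \<in> carrier M \<Longrightarrow> h (v \<oplus>\<^bsub>M\<^esub> w) = h v \<oplus>\<^bsub>M'\<^esub> h w"
    and hM: "h v \<in> carrier M'" if "v \<in> carrier M" for f v w
    using h(1) that by (auto simp: linear_map_def)
  have h_zero: "h \<zero>\<^bsub>M\<^esub> = \<zero>\<^bsub>M'\<^esub>"
    using scale[of "\<zero>\<^bsub>M\<^esub>" 0] hM[of "\<zero>\<^bsub>M\<^esub>"] by simp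
  have jM: "j v \<in> carrier M" if "v \<in> carrier L" for v
    using lm that by (auto simp: log_model_def linear_map_def restrict_scalars_def)
  have "log_model L DL (\<lambda>v. h (j v)) M' D'"
    unfolding log_model_def
  proof (intro conjI ballI impI)
    show "MC_log L DL" using lm by (simp add: log_model_def)
    show "MC M' D'" by (rule MC')
    show "linear_map L (restrict_scalars fps_to_fls M') (\<lambda>v. h (j v))"
      using lm hM jM add scale unfolding log_model_def linear_map_def restrict_scalars_def by auto
    fix v assume v: "v \<in> carrier L"
    show "h (j (DL v)) = D' (h (j v))"
      using lm v h(3)[OF jM[OF v]] by (simp add: log_model_def)
    assume "h (j v) = \<zero>\<^bsub>M'\<^esub>"
    hence "j v = \<zero>\<^bsub>M\<^esub>"
      using h(2) h_zero jM[OF v] unfolding bij_betw_def by (metis inj_onD M.zero_closed)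
    thus "\<exists>n. fps_X ^ n \<odot>\<^bsub>L\<^esub> v = \<zero>\<^bsub>L\<^esub>" using lm v by (simp add: log_model_def)
  next
    fix w assume "w \<in> carrier M'"
    then obtain v where v: "v \<in> carrier M" "w = h v" by (auto simp: car)
    obtain n where "fls_X ^ n \<odot>\<^bsub>M\<^esub> v \<in> j ` carrier L"
      using lm v(1) unfolding log_model_def by blast
    then obtain u where "u \<in> carrier L" "fls_X ^ n \<odot>\<^bsub>M\<^esub> v = j u" by blast
    hence "fls_X ^ n \<odot>\<^bsub>M'\<^esub> w \<in> (\<lambda>v. h (j v)) ` carrier L"
      unfolding v(2) scale[OF v(1), symmetric] by simp
    thus "\<exists>n. fls_X ^ n \<odot>\<^bsub>M'\<^esub> w \<in> (\<lambda>v. h (j v)) ` carrier L" ..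
  qed
  thus ?thesis unfolding MC_rs_def using MC' by blast
qed

section \<open>The limit of the regular-singular parts\<close>

text \<open>
  The isomorphism \<open>h\<close> maps the vector with coordinates \<open>a\<close> in the adapted basis to the family of vectors
  with coordinates \<open>a\<close> in the twisted bases. It commutes with the connections because both are given by
  the same constant matrix. Its image consists of limits of vectors with bounded poles in the twisted
  coordinates, and this is the localization of the limit of the lattices.
\<close>

theorem theorem4p16:
  fixes \<tau> :: "'c::{alg_closed_field, field_char_0} set"
    and E :: "('c fps fls, 'e) module"
    and D Drs P :: "'e \<Rightarrow> 'e"
    and Drs_red P_red :: "nat \<Rightarrow> 'e set \<Rightarrow> 'e set"
    and \<E> :: "nat \<Rightarrow> 'e set set"
  assumes "representatives_mod_Ints \<tau>"
    and "MCo E D"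
    and "admits_TLJ_form E D"
    and "log_decomposition E D Drs P"
    and "\<And>l. log_decomposition_red E D l (Drs_red l) (P_red l)"
    and "\<And>l. Deligne_Manin_lattice \<tau> (reduction_C E l) (Drs_red l) (\<E> l)"
  shows "MC_rs (limit_module E \<E>) (limit_connection Drs_red) \<and>
         MC_isomorphic E Drs (limit_module E \<E>) (limit_connection Drs_red)"
proof -
  have MC_D: "MC E D" using assms(2) by (simp add: MCo_def)
  obtain J :: "('c fps fls set \<times> nat) set" and b A \<phi> rank
    where ab: "adapted_basis E D Drs J b A \<phi> rank" and \<kappa>: "\<forall>j\<in>J. fps_nth (A j j) 0 \<in> \<tau>"
    using adapted_basis_exists[OF assms(1) MC_D assms(4)] by blast
  interpret adapted_basis E D Drs J b A \<phi> rank by (rule ab)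
  let ?M = "limit_module E \<E>"
  have lat: "\<E> l = {vec l a |a. \<forall>j\<in>J. a j \<in> range fps_to_fls}" for l
    using Deligne_Manin_lattice_eq[OF ab assms(1) _ assms(5) assms(6)] \<kappa> by blast
  have M_simps: "\<zero>\<^bsub>?M\<^esub> = (\<lambda>l. \<zero>\<^bsub>reduction E l\<^esub>)" "v \<oplus>\<^bsub>?M\<^esub> w = (\<lambda>l. v l \<oplus>\<^bsub>reduction E l\<^esub> w l)"
    "f \<odot>\<^bsub>?M\<^esub> v = (\<lambda>l. f \<odot>\<^bsub>reduction E l\<^esub> v l)" for v w f
    by (simp_all add: limit_module_def)
  have M_carrier: "carrier ?M = {v. (\<forall>l. v l \<in> carrier (reduction E l) \<and> transition E l (v (Suc l)) = v l) \<and>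
      (\<exists>n. (\<lambda>l. fls_X ^ n \<odot>\<^bsub>reduction E l\<^esub> v l) \<in> limit_lattice E \<E>)}"
    by (simp add: limit_module_def)
  \<comment> \<open>The exponent \<open>n\<close> clears the poles of all coordinates at once.\<close>
  have in_M: "(\<lambda>l. vec l a) \<in> carrier ?M" for a
  proof -
    define n where "n = Max (insert 0 ((\<lambda>j. nat (- fls_subdegree (a j))) ` J))"
    have n: "- fls_subdegree (a j) \<le> int n" if "j \<in> J" for j
    proof -
      have "nat (- fls_subdegree (a j)) \<le> n" unfolding n_def using J that by (intro Max_ge) auto
      thus ?thesis by simp
    qed
    have "fls_X ^ n * a j \<in> range fps_to_fls" if "j \<in> J" for j
    proof -
      have "fls_X ^ n * a j = fps_to_fls (fls_regpart (fls_X ^ n * a j))"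
        using n[OF that] by (intro fls_eqI) (auto simp: fls_X_power_times_conv_shift)
      thus ?thesis by (rule range_eqI)
    qed
    hence "(\<lambda>l. fls_X ^ n \<odot>\<^bsub>reduction E l\<^esub> vec l a) \<in> limit_lattice E \<E>"
      by (auto simp: limit_lattice_def lat vec_scale vec_transition)
    thus ?thesis unfolding M_carrier by (auto simp: vec_transition)
  qed
  have M_surj: "\<exists>a. v = (\<lambda>l. vec l a)" if v: "v \<in> carrier ?M" for v
  proof -
    obtain n where n: "(\<lambda>l. fls_X ^ n \<odot>\<^bsub>reduction E l\<^esub> v l) \<in> limit_lattice E \<E>"
      and v_red: "\<And>l. v l \<in> carrier (reduction E l)" using v by (auto simp: M_carrier)
    have "\<exists>p. fls_X ^ n \<odot>\<^bsub>reduction E l\<^esub> v l = vec l (\<lambda>j. fps_to_fls (p j))" for l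
    proof -
      have "fls_X ^ n \<odot>\<^bsub>reduction E l\<^esub> v l \<in> \<E> l" using n by (simp add: limit_lattice_def)
      then obtain a where a: "fls_X ^ n \<odot>\<^bsub>reduction E l\<^esub> v l = vec l a" "\<forall>j\<in>J. a j \<in> range fps_to_fls"
        by (auto simp: lat)
      have "vec l a = vec l (\<lambda>j. fps_to_fls (fls_regpart (a j)))" using a(2) by (intro vec_cong) auto
      thus ?thesis using a(1) by metis
    qed
    then obtain p where p: "\<And>l. fls_X ^ n \<odot>\<^bsub>reduction E l\<^esub> v l = vec l (\<lambda>j. fps_to_fls (p l j))" by metis
    have "t_power (Suc l) dvd fps_to_fls (p (Suc l) j) - fps_to_fls (p l j)" if "j \<in> J" for l j
    proof -
      have "transition E l (fls_X ^ n \<odot>\<^bsub>reduction E (Suc l)\<^esub> v (Suc l)) = fls_X ^ n \<odot>\<^bsub>reduction E l\<^esub> v l"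
        using n by (simp add: limit_lattice_def)
      thus ?thesis using that unfolding p vec_transition vec_eq_iff by blast
    qed
    hence "\<exists>q. \<forall>l. t_power (Suc l) dvd fps_to_fls q - fps_to_fls (p l j)" if "j \<in> J" for j
      using fps_limit_t[of "\<lambda>l. p l j"] that by metis
    then obtain q where q: "\<And>j l. j \<in> J \<Longrightarrow> t_power (Suc l) dvd fps_to_fls (q j) - fps_to_fls (p l j)" by metis
    have "v l = vec l (\<lambda>j. fls_X_intpow (- int n) * fps_to_fls (q j))" for l
    proof -
      obtain c where c: "v l = vec l c" using vec_surj v_red by blast
      have "vec l (\<lambda>j. fls_X ^ n * c j) = vec l (\<lambda>j. fps_to_fls (p l j))"
        using p[of l] by (simp add: c vec_scale)
      also have "\<dots> = vec l (\<lambda>j. fps_to_fls (q j))"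
        using q by (subst eq_commute) (simp add: vec_eq_iff)
      finally have "fls_X_intpow (- int n) \<odot>\<^bsub>reduction E l\<^esub> vec l (\<lambda>j. fls_X ^ n * c j)
          = vec l (\<lambda>j. fls_X_intpow (- int n) * fps_to_fls (q j))" by (simp only: vec_scale)
      moreover have "fls_X_intpow (- int n) * (fls_X ^ n * c j) = c j" for j
        by (simp add: fls_X_intpow_times_conv_shift(1)[of "- int n", simplified] fls_X_power_times_conv_shift)
      ultimately show ?thesis by (simp only: vec_scale c)
    qed
    thus ?thesis by blast
  qed
  define co where "co v = (SOME a. v = lincomb E J b a)" for v
  have co: "v = lincomb E J b (co v)" if "v \<in> carrier E" for v
    unfolding co_def using basis that by (intro someI_ex[of "\<lambda>a. v = lincomb E J b a"]) (auto simp: basis_on_def)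
  define h where "h v = (\<lambda>l. vec l (co v))" for v
  have h: "h (lincomb E J b a) = (\<lambda>l. vec l a)" for a
  proof -
    have "co (lincomb E J b a) j = a j" if "j \<in> J" for j
      using E.basis_on_unique[OF basis co[symmetric] that] b by simp
    thus ?thesis unfolding h_def by (intro ext vec_cong)
  qed
  have iso: "MC_isomorphic E Drs ?M (limit_connection Drs_red)"
  proof (rule MC_transport[OF MC_Drs, of h])
    show "bij_betw h (carrier E) (carrier ?M)"
    proof (rule bij_betw_imageI)
      show "inj_on h (carrier E)"
      proof (rule inj_onI)
        fix v w assume v: "v \<in> carrier E" "w \<in> carrier E" "h v = h w"
        have "co v j = co w j" if "j \<in> J" for j
        proof -
          have "t_power (Suc l) dvd co v j - co w j" for l
            using fun_cong[OF v(3), of l] that by (simp add: h_def vec_eq_iff)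
          thus ?thesis using t_power_dvd_all_imp_zero[of "co v j - co w j"] by simp
        qed
        hence "lincomb E J b (co v) = lincomb E J b (co w)" using b by (intro E.lincomb_cong) auto
        thus "v = w" using co v(1,2) by metis
      qed
      have "\<exists>v\<in>carrier E. u = h v" if "u \<in> carrier ?M" for u
        using M_surj[OF that] h b by (metis E.lincomb_closed)
      thus "h ` carrier E = carrier ?M" using in_M by (auto simp: h_def)
    qed
    have "h \<zero>\<^bsub>E\<^esub> = h (lincomb E J b (\<lambda>_. 0))" using b by (simp add: E.lincomb_zero)
    thus "h \<zero>\<^bsub>E\<^esub> = \<zero>\<^bsub>?M\<^esub>" by (simp add: h M_simps vec_zero)
    fix v assume v: "v \<in> carrier E"
    have hv: "h v = (\<lambda>l. vec l (co v))" by (simp add: h_def)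
    show "h (f \<odot>\<^bsub>E\<^esub> v) = f \<odot>\<^bsub>?M\<^esub> h v" for f
    proof -
      have "h (f \<odot>\<^bsub>E\<^esub> v) = h (lincomb E J b (\<lambda>j. f * co v j))"
        using co[OF v] E.lincomb_scale[OF J b, of f "co v"] by simp
      thus ?thesis unfolding h by (simp add: hv M_simps vec_scale)
    qed
    show "h (Drs v) = limit_connection Drs_red (h v)"
    proof -
      have "h (Drs v) = h (lincomb E J b (\<lambda>j. theta_fls (co v j) + (\<Sum>i\<in>J. fls_const (A j i) * co v i)))"
        using co[OF v] Drs_lincomb[of "co v"] by simp
      thus ?thesis unfolding h by (simp add: hv limit_connection_def Drs_red_vec[OF assms(5)])
    qed
    fix w assume w: "w \<in> carrier E"
    have "h (v \<oplus>\<^bsub>E\<^esub> w) = h (lincomb E J b (\<lambda>j. co v j + co w j))"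
      using co[OF v] co[OF w] E.lincomb_add[OF b, of "co v" "co w"] by simp
    thus "h (v \<oplus>\<^bsub>E\<^esub> w) = h v \<oplus>\<^bsub>?M\<^esub> h w" unfolding h by (simp add: h_def M_simps vec_add)
  qed
  moreover have "MC_rs E Drs" using assms(4) by (simp add: log_decomposition_def)
  ultimately show ?thesis using MC_rs_isomorphic by blast
qed

end
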